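(* Let $p$ be a prime, let $K$ be a finite field extension of $\mathbb{Q}_p$, let $R$ be the ring of integers of $K$, let $\pi\in R$ be a uniformizing parameter, and let $q$ be the cardinality of the residue field of $R$. Let $n\geq 2$ be an integer. (1) All the $\mathbb{Z}_p$-Lie sublattices of finite index in $\mathrm{sl}_n(R)$, in $\mathrm{sp}_n(R)$ (for $n$ even), and in $\mathrm{so}_n(R)$ are self-similar. (2) Let $\sigma$ be any of the symbols $\mathrm{sl}$, $\mathrm{sp}$, $\mathrm{so}$. Assume that $k\geq 1$ and $m\geq 0$ are integers, that $n$ is even if $\sigma=\mathrm{sp}$, and that $n\geq 3$ if $\sigma=\mathrm{so}$. Let $L$ be a $\mathbb{Z}_p$-Lie sublattice of $\sigma_n(R)$ with $\sigma_n^m(R)\subseteq L\subseteq\sigma_n(R)$. Then $L$ is self-similar of index $[L:\sigma_n^m(R)]\,q^{F(n)k}$, where $$F(n)=\begin{cases} n-1 &\text{if }\sigma=\mathrm{sl},\\ n&\text{if }\sigma=\mathrm{sp},\\ n-2&\text{if }\sigma=\mathrm{so}.\end{cases}$$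
   Context: A $\mathbb{Z}_p$-Lie lattice is a finitely generated free $\mathbb{Z}_p$-module with a structure of Lie algebra over $\mathbb{Z}_p$. A virtual endomorphism of index $p^j$ ($j\in\mathbb{N}$) of a $\mathbb{Z}_p$-Lie lattice $L$ is a $\mathbb{Z}_p$-Lie algebra homomorphism $\varphi:M\to L$, where $M$ is a $\mathbb{Z}_p$-subalgebra of $L$ of index $p^j$ (index as additive groups). It is simple if there is no nonzero ideal $I$ of $L$ with $I\subseteq M$ and $\varphi(I)\subseteq I$. $L$ is self-similar of index $p^j$ if it has a simple virtual endomorphism of index $p^j$, and self-similar if it is self-similar of index $p^j$ for some $j$. Lie lattices (with commutator bracket): $\mathrm{sl}_n(R)=\{x\in\mathrm{M}_n(R):\mathrm{tr}(x)=0\}$; for $n=2l$, $\mathrm{sp}_n(R)=\{x\in\mathrm{M}_n(R): sx+x^{\mathrm t}s=0\}$ with $s=\begin{bmatrix}0&\mathrm{Id}_l\\-\mathrm{Id}_l&0\end{bmatrix}$; $\mathrm{so}_n(R)=\{x\in\mathrm{M}_n(R): sx+x^{\mathrm t}s=0\}$ with $s=\begin{bmatrix}0&\mathrm{Id}_l\\ \mathrm{Id}_l&0\end{bmatrix}$ if $n=2l$ and $s=\begin{bmatrix}1&0&0\\0&0&\mathrm{Id}_l\\0&\mathrm{Id}_l&0\end{bmatrix}$ if $n=2l+1$. For $\sigma\in\{\mathrm{sl},\mathrm{sp},\mathrm{so}\}$, $\sigma_n^m(R)=\pi^m\sigma_n(R)$. These are $R$-Lie lattices, regarded as $\mathbb{Z}_p$-Lie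 lattices by restriction of scalars. *)

theory Defs
  imports
    "HOL-Computational_Algebra.Computational_Algebra"
    "Jordan_Normal_Form.Matrix"
begin

section \<open>The p-adic numbers and their finite extensions\<close>

definition padic_abs :: "nat \<Rightarrow> rat \<Rightarrow> real" where
  "padic_abs p r =
    (if r = 0 then 0
     else real p powi (int (multiplicity (int p) (snd (quotient_of r)))
                     - int (multiplicity (int p) (fst (quotient_of r)))))"

text \<open>
  The field of p-adic numbers is the completion of the rationals with respect to the p-adic
  absolute value; the locale says that the subfield \<open>Q\<close> of the type \<open>'k\<close>, with absolute value
  \<open>v\<close>, is such a completion. It determines \<open>Q\<close> and \<open>v\<close> up to a unique isomorphism.
  Values of \<open>v\<close> outside \<open>Q\<close> are irrelevant. A finite extension of the p-adic numbers is a type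
  \<open>'k\<close> that is finite-dimensional over \<open>Q\<close>; it has characteristic 0.
\<close>

locale padic_numbers =
  fixes p :: nat and Q :: "'k::field_char_0 set" and v :: "'k \<Rightarrow> real"
  assumes zero_closed: "0 \<in> Q"
    and one_closed: "1 \<in> Q"
    and add_closed: "x \<in> Q \<Longrightarrow> y \<in> Q \<Longrightarrow> x + y \<in> Q"
    and uminus_closed: "x \<in> Q \<Longrightarrow> - x \<in> Q"
    and mult_closed: "x \<in> Q \<Longrightarrow> y \<in> Q \<Longrightarrow> x * y \<in> Q"
    and inverse_closed: "x \<in> Q \<Longrightarrow> inverse x \<in> Q"
    and abs_nonneg: "x \<in> Q \<Longrightarrow> 0 \<le> v x"
    and abs_eq_0_iff: "x \<in> Q \<Longrightarrow> v x = 0 \<longleftrightarrow> x = 0"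
    and abs_mult: "x \<in> Q \<Longrightarrow> y \<in> Q \<Longrightarrow> v (x * y) = v x * v y"
    and abs_triangle: "x \<in> Q \<Longrightarrow> y \<in> Q \<Longrightarrow> v (x + y) \<le> v x + v y"
    and abs_of_rat: "v (of_rat r) = padic_abs p r"
    and rat_dense: "x \<in> Q \<Longrightarrow> 0 < e \<Longrightarrow> \<exists>r. v (x - of_rat r) < e"
    and complete:
      "(\<And>i. X i \<in> Q) \<Longrightarrow>
       (\<And>e. 0 < e \<Longrightarrow> \<exists>N. \<forall>i\<ge>N. \<forall>j\<ge>N. v (X i - X j) < e) \<Longrightarrow>
       \<exists>x\<in>Q. (\<lambda>i. v (X i - x)) \<longlonglongrightarrow> 0"

definition padic_integers :: "'k set \<Rightarrow> ('k \<Rightarrow> real) \<Rightarrow> 'k set" where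
  "padic_integers Q v = {x \<in> Q. v x \<le> 1}"

definition finite_extension :: "'k::field set \<Rightarrow> bool" where
  "finite_extension Q \<longleftrightarrow>
    (\<exists>B. finite B \<and> (\<forall>x. \<exists>c. (\<forall>b\<in>B. c b \<in> Q) \<and> x = (\<Sum>b\<in>B. c b * b)))"

text \<open>The ring of integers is the integral closure of \<open>Z\<close> in the whole field \<open>'k\<close>.\<close>

definition ring_of_integers :: "'k::field set \<Rightarrow> 'k set" where
  "ring_of_integers Z =
    {x. \<exists>f. lead_coeff f = 1 \<and> (\<forall>i. coeff f i \<in> Z) \<and> poly f x = 0}"

text \<open>The ring of integers is local, so its maximal ideal is the set of its non-units.\<close>

definition maximal_ideal :: "'k::field set \<Rightarrow> 'k set" where
  "maximal_ideal R = {x \<in> R. \<not> (\<exists>y\<in>R. x * y = 1)}"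

definition uniformizer :: "'k::field set \<Rightarrow> 'k \<Rightarrow> bool" where
  "uniformizer R \<pi> \<longleftrightarrow> \<pi> \<in> R \<and> (\<lambda>r. \<pi> * r) ` R = maximal_ideal R"

definition residue_field :: "'k::field set \<Rightarrow> 'k set set" where
  "residue_field R = R // {(x, y). x \<in> R \<and> y \<in> R \<and> x - y \<in> maximal_ideal R}"

section \<open>Lie lattices of matrices\<close>

text \<open>
  All Lie lattices below are Lie subalgebras, over a subring \<open>Z\<close> of the field \<open>'k\<close>, of the
  \<open>n \<times> n\<close> matrices over \<open>'k\<close> with the commutator bracket.
\<close>

definition lie_bracket :: "'k::field mat \<Rightarrow> 'k mat \<Rightarrow> 'k mat" where
  "lie_bracket x y = x * y - y * x"

definition is_submodule :: "'k::field set \<Rightarrow> nat \<Rightarrow> 'k mat set \<Rightarrow> bool" where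
  "is_submodule Z n L \<longleftrightarrow>
    L \<subseteq> carrier_mat n n \<and> 0\<^sub>m n n \<in> L \<and>
    (\<forall>x\<in>L. \<forall>y\<in>L. x + y \<in> L) \<and> (\<forall>z\<in>Z. \<forall>x\<in>L. z \<cdot>\<^sub>m x \<in> L)"

definition lie_subalgebra :: "'k::field set \<Rightarrow> nat \<Rightarrow> 'k mat set \<Rightarrow> bool" where
  "lie_subalgebra Z n L \<longleftrightarrow>
    is_submodule Z n L \<and> (\<forall>x\<in>L. \<forall>y\<in>L. lie_bracket x y \<in> L)"

definition lie_ideal :: "'k::field set \<Rightarrow> nat \<Rightarrow> 'k mat set \<Rightarrow> 'k mat set \<Rightarrow> bool" where
  "lie_ideal Z n L I \<longleftrightarrow>
    is_submodule Z n I \<and> I \<subseteq> L \<and> (\<forall>x\<in>L. \<forall>y\<in>I. lie_bracket x y \<in> I)"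

text \<open>
  Linear combinations are written entrywise, because matrices of unrestricted size do not form
  an additive monoid.
\<close>

definition fg_free :: "'k::field set \<Rightarrow> nat \<Rightarrow> 'k mat set \<Rightarrow> bool" where
  "fg_free Z n L \<longleftrightarrow>
    (\<exists>(d::nat) b. (\<forall>i<d. b i \<in> L) \<and>
      (\<forall>x\<in>L. \<exists>!c. c \<in> {..<d} \<rightarrow>\<^sub>E Z \<and> x = mat n n (\<lambda>(s, t). \<Sum>i<d. c i * b i $$ (s, t))))"

definition lie_lattice :: "'k::field set \<Rightarrow> nat \<Rightarrow> 'k mat set \<Rightarrow> bool" where
  "lie_lattice Z n L \<longleftrightarrow> lie_subalgebra Z n L \<and> fg_free Z n L"

definition cosets_in :: "'k::field mat set \<Rightarrow> 'k mat set \<Rightarrow> 'k mat set set" where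
  "cosets_in L M = L // {(x, y). x \<in> L \<and> y \<in> L \<and> x - y \<in> M}"

text \<open>Since \<open>card\<close> is 0 on infinite sets, a positive index is a genuine finite index.\<close>

definition add_index :: "'k::field mat set \<Rightarrow> 'k mat set \<Rightarrow> nat" where
  "add_index L M = card (cosets_in L M)"

section \<open>Self-similarity\<close>

definition virtual_endomorphism ::
  "'k::field set \<Rightarrow> nat \<Rightarrow> 'k mat set \<Rightarrow> 'k mat set \<Rightarrow> ('k mat \<Rightarrow> 'k mat) \<Rightarrow> bool" where
  "virtual_endomorphism Z n L M \<phi> \<longleftrightarrow>
    lie_subalgebra Z n M \<and> M \<subseteq> L \<and> \<phi> ` M \<subseteq> L \<and>
    (\<forall>x\<in>M. \<forall>y\<in>M. \<phi> (x + y) = \<phi> x + \<phi> y) \<and>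
    (\<forall>z\<in>Z. \<forall>x\<in>M. \<phi> (z \<cdot>\<^sub>m x) = z \<cdot>\<^sub>m \<phi> x) \<and>
    (\<forall>x\<in>M. \<forall>y\<in>M. \<phi> (lie_bracket x y) = lie_bracket (\<phi> x) (\<phi> y))"

definition simple_virtual_endomorphism ::
  "'k::field set \<Rightarrow> nat \<Rightarrow> 'k mat set \<Rightarrow> 'k mat set \<Rightarrow> ('k mat \<Rightarrow> 'k mat) \<Rightarrow> bool" where
  "simple_virtual_endomorphism Z n L M \<phi> \<longleftrightarrow>
    virtual_endomorphism Z n L M \<phi> \<and>
    \<not> (\<exists>I. lie_ideal Z n L I \<and> I \<noteq> {0\<^sub>m n n} \<and> I \<subseteq> M \<and> \<phi> ` I \<subseteq> I)"

definition self_similar_of_index ::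
  "nat \<Rightarrow> 'k::field set \<Rightarrow> nat \<Rightarrow> 'k mat set \<Rightarrow> nat \<Rightarrow> bool" where
  "self_similar_of_index p Z n L N \<longleftrightarrow>
    (\<exists>j M \<phi>. N = p ^ j \<and> add_index L M = p ^ j \<and> simple_virtual_endomorphism Z n L M \<phi>)"

definition self_similar :: "nat \<Rightarrow> 'k::field set \<Rightarrow> nat \<Rightarrow> 'k mat set \<Rightarrow> bool" where
  "self_similar p Z n L \<longleftrightarrow> (\<exists>j. self_similar_of_index p Z n L (p ^ j))"

section \<open>The classical Lie lattices\<close>

datatype classical_type = SL | SP | SO

definition sl_lattice :: "'k::field set \<Rightarrow> nat \<Rightarrow> 'k mat set" where
  "sl_lattice R n = {x \<in> carrier_mat n n. elements_mat x \<subseteq> R \<and> (\<Sum>i<n. x $$ (i, i)) = 0}"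

definition form_lattice :: "'k::field mat \<Rightarrow> 'k set \<Rightarrow> nat \<Rightarrow> 'k mat set" where
  "form_lattice s R n =
    {x \<in> carrier_mat n n. elements_mat x \<subseteq> R \<and> s * x + transpose_mat x * s = 0\<^sub>m n n}"

text \<open>The matrix \<open>sp_form n\<close> is meaningful for even \<open>n\<close> only.\<close>

definition sp_form :: "nat \<Rightarrow> 'k::field mat" where
  "sp_form n = (let l = n div 2 in
    four_block_mat (0\<^sub>m l l) (1\<^sub>m l) (- 1\<^sub>m l) (0\<^sub>m l l))"

definition so_form :: "nat \<Rightarrow> 'k::field mat" where
  "so_form n = (let l = n div 2;
      h = four_block_mat (0\<^sub>m l l) (1\<^sub>m l) (1\<^sub>m l) (0\<^sub>m l l)
    in if even n then h
       else four_block_mat (1\<^sub>m 1) (0\<^sub>m 1 (2 * l)) (0\<^sub>m (2 * l) 1) h)"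

fun classical_lattice :: "classical_type \<Rightarrow> 'k::field set \<Rightarrow> nat \<Rightarrow> 'k mat set" where
  "classical_lattice SL R n = sl_lattice R n"
| "classical_lattice SP R n = form_lattice (sp_form n) R n"
| "classical_lattice SO R n = form_lattice (so_form n) R n"

definition congruence_lattice ::
  "classical_type \<Rightarrow> 'k::field set \<Rightarrow> 'k \<Rightarrow> nat \<Rightarrow> nat \<Rightarrow> 'k mat set" where
  "congruence_lattice \<sigma> R \<pi> m n = (\<lambda>x. \<pi> ^ m \<cdot>\<^sub>m x) ` classical_lattice \<sigma> R n"

fun index_exponent :: "classical_type \<Rightarrow> nat \<Rightarrow> nat" where
  "index_exponent SL n = n - 1"
| "index_exponent SP n = n"
| "index_exponent SO n = n - 2"

end

theory Submission
  imports Defs "HOL-Library.Function_Algebras" "Jordan_Normal_Form.Char_Poly"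
begin

text \<open>
  Conjugation by the diagonal matrix with entries \<open>\<pi> ^ (k * d i)\<close>, where \<open>d\<close> is the weight of an
  extremal vector of the natural representation, divides one column of a matrix by powers of
  \<open>\<pi>\<close>. It is defined, with values in the \<open>m\<close>-th congruence lattice, on a subalgebra of that lattice
  whose index \<open>q ^ (F n * k)\<close> counts the divisibility conditions on the free entries of the
  column. On an invariant ideal it can be iterated, so the entries of the column are divisible by
  all powers of \<open>\<pi>\<close> and vanish; taking brackets then kills the whole ideal. A sublattice of finite
  index contains a congruence lattice, and the remaining lattices, inside the abelian algebra
  \<open>so\<^sub>2\<close>, admit division by \<open>p\<close>.

  About the ring of integers \<open>R\<close> one needs that \<open>R\<close> modulo \<open>p\<close> is finite and that the powers of
  \<open>p\<close> have zero intersection. The first holds because elements independent modulo \<open>p\<close> are linearly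
  independent over \<open>Q\<close>, the second because every element of the field becomes integral after
  multiplication by a power of \<open>p\<close>.
\<close>

section \<open>Indices of additive subgroups\<close>

text \<open>The weight is largest at \<open>c\<close>. Conjugation therefore divides only entries of
  column \<open>c\<close> and, for a form, the entries of the opposite row, which mirror that
  column. Integrality of a conjugate thus amounts to conditions on independent coordinates, and the
  index is a product. The weights are 1, 0 for sl; for forms they are 2, 1, 0, so that the diagonal
  matrix scales the form by \<open>t ^ 2\<close>.

  An arbitrary \<open>L\<close> need not be compatible with the conjugation. The map is therefore
  taken from a part of the congruence lattice back into the congruence lattice, and \<open>L\<close>
  enters only through its index over that lattice and through being integral. Ideals of
  \<open>L\<close> are closed under brackets with \<open>\<pi> ^ m\<close> times integral matrices,
  and a nonzero scalar does no harm when entries are shown to vanish.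

  The absolute value is given on \<open>Q\<close> only and is never extended to the whole field;
  divisibility in \<open>R\<close> and counting modulo \<open>p\<close> take its place.\<close>

definition add_subgroup :: "'a::ab_group_add set \<Rightarrow> bool" where
  "add_subgroup B \<longleftrightarrow> 0 \<in> B \<and> (\<forall>x\<in>B. \<forall>y\<in>B. x - y \<in> B)"

lemma add_subgroup_zero: "add_subgroup B \<Longrightarrow> 0 \<in> B"
  and add_subgroup_diff: "add_subgroup B \<Longrightarrow> x \<in> B \<Longrightarrow> y \<in> B \<Longrightarrow> x - y \<in> B"
  by (auto simp: add_subgroup_def)

lemma add_subgroup_uminus: "add_subgroup B \<Longrightarrow> x \<in> B \<Longrightarrow> - x \<in> B"
  using add_subgroup_diff[of B 0 x] add_subgroup_zero[of B] by simp

lemma add_subgroup_add: "add_subgroup B \<Longrightarrow> x \<in> B \<Longrightarrow> y \<in> B \<Longrightarrow> x + y \<in> B"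
  using add_subgroup_diff[of B x "- y"] add_subgroup_uminus[of B y] by simp

definition cosets :: "'a::ab_group_add set \<Rightarrow> 'a set \<Rightarrow> 'a set set" where
  "cosets A B = A // {(x, y). x \<in> A \<and> y \<in> A \<and> x - y \<in> B}"

text \<open>The classes of \<open>r\<close> are the fibres of \<open>f\<close>. Counting classes
  becomes counting values, which underlies the index computations below.\<close>

lemma quotient_bij_betw_image:
  assumes "\<And>x y. (x, y) \<in> r \<longleftrightarrow> x \<in> A \<and> y \<in> A \<and> f x = f y"
  shows "bij_betw (\<lambda>z. {x \<in> A. f x = z}) (f ` A) (A // r)"
proof -
  have "r `` {x} = {y \<in> A. f y = f x}" if "x \<in> A" for x
    using that assms by auto
  then show ?thesis
    unfolding bij_betw_def by (fastforce simp: inj_on_def quotient_def)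
qed

lemma card_quotient_eq_card_image:
  assumes "\<And>x y. (x, y) \<in> r \<longleftrightarrow> x \<in> A \<and> y \<in> A \<and> f x = f y"
  shows "card (A // r) = card (f ` A)" and "finite (A // r) \<longleftrightarrow> finite (f ` A)"
  using quotient_bij_betw_image[OF assms] bij_betw_same_card bij_betw_finite by metis+

definition transversal :: "'a::ab_group_add set \<Rightarrow> 'a set \<Rightarrow> 'a set \<Rightarrow> bool" where
  "transversal A B T \<longleftrightarrow> T \<subseteq> A \<and> (\<forall>x\<in>A. \<exists>!t. t \<in> T \<and> x - t \<in> B)"

lemma transversal_subset: "transversal A B T \<Longrightarrow> T \<subseteq> A"
  by (simp add: transversal_def)

lemma transversal_ex:
  assumes "transversal A B T" "x \<in> A"
  obtains t where "t \<in> T" "x - t \<in> B"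
  using assms by (auto simp: transversal_def)

lemma transversal_unique:
  assumes "transversal A B T" "x \<in> A" "t \<in> T" "x - t \<in> B" "t' \<in> T" "x - t' \<in> B"
  shows "t = t'"
  using assms unfolding transversal_def by metis

lemma card_cosets_transversal:
  assumes "add_subgroup B" and T: "transversal A B T"
  shows "card (cosets A B) = card T" and "finite (cosets A B) \<longleftrightarrow> finite T"
proof -
  define f where "f x = (THE t. t \<in> T \<and> x - t \<in> B)" for x
  have f: "f x \<in> T \<and> x - f x \<in> B" if "x \<in> A" for x
    unfolding f_def by (rule theI') (use that T in \<open>auto simp: transversal_def\<close>)
  have f_eq: "f x = t" if "x \<in> A" "t \<in> T" "x - t \<in> B" for x t
    using transversal_unique[OF T that(1)] f[OF that(1)] that by metis
  have "f x = f y \<longleftrightarrow> x - y \<in> B" if "x \<in> A" "y \<in> A" for x y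
  proof
    assume "f x = f y"
    with f[OF that(1)] f[OF that(2)] add_subgroup_diff[OF assms(1), of "x - f x" "y - f y"]
    show "x - y \<in> B" by simp
  next
    assume "x - y \<in> B"
    with f[OF that(2)] add_subgroup_add[OF assms(1), of "x - y" "y - f y"]
    have "x - f y \<in> B" by simp
    with f_eq that f show "f x = f y" by simp
  qed
  moreover have "f ` A = T"
  proof
    show "T \<subseteq> f ` A"
    proof
      fix t assume "t \<in> T"
      then have "f t = t" "t \<in> A"
        using T add_subgroup_zero[OF assms(1)] by (auto intro!: f_eq simp: transversal_def)
      then show "t \<in> f ` A" by force
    qed
  qed (use f in auto)
  moreover have "(x, y) \<in> {(x, y). x \<in> A \<and> y \<in> A \<and> x - y \<in> B} \<longleftrightarrow> x \<in> A \<and> y \<in> A \<and> f x = f y" for x y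
    using calculation by auto
  note card_quotient_eq_card_image[OF this]
  ultimately show "card (cosets A B) = card T" "finite (cosets A B) \<longleftrightarrow> finite T"
    unfolding cosets_def by simp_all
qed

lemma ex_transversal:
  assumes "add_subgroup B"
  obtains T where "transversal A B T"
proof
  define f where "f x = (SOME y. y \<in> A \<and> x - y \<in> B)" for x
  have f: "f x \<in> A \<and> x - f x \<in> B" if "x \<in> A" for x
    unfolding f_def by (rule someI[of _ x]) (use that add_subgroup_zero[OF assms] in simp)
  \<comment> \<open>Elements of one coset satisfy the same predicate, so \<open>SOME\<close> picks
    the same representative for both.\<close>
  have f_eq: "f x = f y" if "x - y \<in> B" for x y
  proof -
    have "x - z \<in> B \<longleftrightarrow> y - z \<in> B" for z
      using add_subgroup_add[OF assms that, of "y - z"]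
        add_subgroup_diff[OF assms _ that, of "x - z"] by (simp, argo)
    then show ?thesis by (simp only: f_def)
  qed
  show "transversal A B (f ` A)"
    unfolding transversal_def
  proof (intro conjI ballI ex1I[of _ "f _"])
    fix x t assume x: "x \<in> A" and t: "t \<in> f ` A \<and> x - t \<in> B"
    then obtain y where y: "y \<in> A" "t = f y" by auto
    have "x - y \<in> B"
      using add_subgroup_diff[OF assms, of "x - t" "y - t"] f[OF y(1)] t y by simp
    then show "t = f x" using f_eq y by simp
  qed (use f in auto)
qed

text \<open>Sums \<open>t + s\<close> of representatives for \<open>A\<close> modulo
  \<open>B\<close> and for \<open>B\<close> modulo \<open>C\<close> represent \<open>A\<close>
  modulo \<open>C\<close>. With \<open>card\<close> 0 on infinite sets the product formula covers
  infinite indices too.\<close>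

lemma cosets_tower:
  assumes A: "add_subgroup A" and B: "add_subgroup B" and C: "add_subgroup C"
    and "C \<subseteq> B" "B \<subseteq> A"
  shows "card (cosets A C) = card (cosets A B) * card (cosets B C)" (is ?card)
    and "finite (cosets A B) \<Longrightarrow> finite (cosets B C) \<Longrightarrow> finite (cosets A C)"
    and "finite (cosets A C) \<Longrightarrow> finite (cosets A B)"
proof -
  obtain T where T: "transversal A B T" using ex_transversal[OF B] .
  obtain S where S: "transversal B C S" using ex_transversal[OF C] .
  have inj: "inj_on (\<lambda>(t, s). t + s) (T \<times> S)"
  proof (rule inj_onI, clarify)
    fix t s t' s' assume h: "t \<in> T" "t' \<in> T" "s \<in> S" "s' \<in> S" "t + s = t' + s'"
    then have "t - t' = s' - s" by (simp add: algebra_simps)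
    moreover have "s' - s \<in> B" using h S B by (auto simp: transversal_def intro: add_subgroup_diff)
    ultimately have "t - t' \<in> B" by simp
    moreover have "t \<in> A" using h transversal_subset[OF T] by auto
    moreover have "t - t \<in> B" using add_subgroup_zero[OF B] by simp
    ultimately have "t = t'" using h transversal_unique[OF T] by metis
    then show "t = t' \<and> s = s'" using h by simp
  qed
  have "transversal A C ((\<lambda>(t, s). t + s) ` (T \<times> S))"
    unfolding transversal_def
  proof (intro conjI ballI)
    show "(\<lambda>(t, s). t + s) ` (T \<times> S) \<subseteq> A"
      using transversal_subset[OF T] transversal_subset[OF S] \<open>B \<subseteq> A\<close>
      by (auto intro!: add_subgroup_add[OF A])
    fix x assume x: "x \<in> A"
    obtain t where t: "t \<in> T" "x - t \<in> B" using transversal_ex[OF T x] .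
    obtain s where s: "s \<in> S" "x - t - s \<in> C" using transversal_ex[OF S t(2)] .
    show "\<exists>!u. u \<in> (\<lambda>(t, s). t + s) ` (T \<times> S) \<and> x - u \<in> C"
    proof (rule ex1I[of _ "t + s"])
      show "t + s \<in> (\<lambda>(t, s). t + s) ` (T \<times> S) \<and> x - (t + s) \<in> C"
        using t s by (auto simp: diff_diff_eq)
      fix u assume "u \<in> (\<lambda>(t, s). t + s) ` (T \<times> S) \<and> x - u \<in> C"
      then obtain t' s' where u: "t' \<in> T" "s' \<in> S" "u = t' + s'" "x - (t' + s') \<in> C" by auto
      have "(x - (t' + s')) + s' \<in> B"
        using u transversal_subset[OF S] \<open>C \<subseteq> B\<close> by (intro add_subgroup_add[OF B]) auto
      then have "x - t' \<in> B" by simp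
      then have "t' = t" using transversal_unique[OF T x] t u by metis
      moreover have "x - t' - s' \<in> C" using u by (simp add: diff_diff_eq)
      ultimately have "s' = s" using transversal_unique[OF S t(2)] s u by metis
      then show "u = t + s" using u \<open>t' = t\<close> by simp
    qed
  qed
  note AC = card_cosets_transversal[OF C this]
  note AB = card_cosets_transversal[OF B T]
  note BC = card_cosets_transversal[OF C S]
  show ?card using AC AB BC inj by (simp add: card_image card_cartesian_product)
  show "finite (cosets A B) \<Longrightarrow> finite (cosets B C) \<Longrightarrow> finite (cosets A C)"
    using AC AB BC by simp
  \<comment> \<open>A nonempty \<open>S\<close> lets finiteness of \<open>T \<times> S\<close>
    descend to \<open>T\<close>.\<close>
  have "S \<noteq> {}" using transversal_ex[OF S add_subgroup_zero[OF B]] by auto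
  then show "finite (cosets A C) \<Longrightarrow> finite (cosets A B)"
    using AC AB inj by (auto simp: finite_image_iff dest: finite_cartesian_productD1)
qed

lemma card_cosets_pos:
  assumes "finite (cosets A B)" "add_subgroup A"
  shows "card (cosets A B) > 0"
  using assms add_subgroup_zero[of A] by (auto simp: card_gt_0_iff cosets_def quotient_def)

lemma add_subgroup_of_int_mult:
  fixes B :: "'a::ring_1 set"
  assumes B: "add_subgroup B" "x \<in> B"
  shows "of_int i * x \<in> B"
proof (induction i rule: int_induct[of _ 0])
  case (step1 i)
  then show ?case using add_subgroup_add[OF B(1) _ B(2)] by (simp add: distrib_right)
next
  case (step2 i)
  then show ?case using add_subgroup_diff[OF B(1) _ B(2)] by (simp add: left_diff_distrib)
qed (use add_subgroup_zero[OF B(1)] in simp)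

text \<open>Take the first power of \<open>p\<close> that annihilates \<open>x\<close> modulo
  \<open>B\<close>; the multiple of \<open>x\<close> just before it has order exactly
  \<open>p\<close> in the quotient.\<close>

lemma ex_prime_torsion_mod_subgroup:
  fixes B :: "'a::ring_1 set"
  assumes "of_nat (p ^ a) * x \<in> B" "x \<notin> B"
  obtains b where "of_nat (p ^ b) * x \<notin> B" "of_nat p * (of_nat (p ^ b) * x) \<in> B"
proof -
  define k where "k = (LEAST k. of_nat (p ^ k) * x \<in> B)"
  have k: "of_nat (p ^ k) * x \<in> B"
    unfolding k_def using assms(1) by (rule LeastI)
  then have "k \<noteq> 0" using assms(2) by (intro notI) simp
  then obtain b where b: "k = Suc b" using not0_implies_Suc by blast
  then have "of_nat (p ^ b) * x \<notin> B"
    using not_less_Least[of b "\<lambda>k. of_nat (p ^ k) * x \<in> B"] by (simp add: k_def)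
  with k b that show thesis by (simp add: mult.assoc)
qed

text \<open>\<open>C\<close> is the subgroup generated by \<open>B\<close> and \<open>x\<close>. By
  Bezout, \<open>p\<close> divides each \<open>i\<close> with \<open>of_int i * x\<close> in
  \<open>B\<close>, so the multiples of \<open>x\<close> by 0, ..., p - 1 represent the cosets. The
  type is a ring so that integer multiples can be written as products; it is later instantiated with
  functions under pointwise multiplication.\<close>

lemma card_cosets_cyclic_extension:
  fixes B :: "'a::ring_1 set"
  assumes B: "add_subgroup B" and A: "add_subgroup A" "B \<subseteq> A" and p: "prime p"
    and x: "x \<in> A" "x \<notin> B" "of_nat p * x \<in> B"
  defines "C \<equiv> {y \<in> A. \<exists>i. y - of_int i * x \<in> B}"
  shows "add_subgroup C" and "card (cosets C B) = p"
proof -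
  show "add_subgroup C"
    unfolding add_subgroup_def
  proof (intro conjI ballI)
    show "0 \<in> C" using add_subgroup_zero A(1) B by (auto simp: C_def intro!: exI[of _ 0])
    fix y z assume "y \<in> C" "z \<in> C"
    then obtain i j where ij: "y - of_int i * x \<in> B" "z - of_int j * x \<in> B" "y \<in> A" "z \<in> A"
      by (auto simp: C_def)
    have "(y - z) - of_int (i - j) * x = (y - of_int i * x) - (z - of_int j * x)"
      by (simp add: algebra_simps)
    then have "(y - z) - of_int (i - j) * x \<in> B" using add_subgroup_diff[OF B ij(1,2)] by metis
    then show "y - z \<in> C" using add_subgroup_diff[OF A(1) ij(3,4)] unfolding C_def by blast
  qed
  have px: "of_int (int p * j) * x \<in> B" for j
    using add_subgroup_of_int_mult[OF B x(3), of j]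
    by (simp only: of_int_mult of_int_of_nat_eq mult_of_nat_commute mult.assoc)
  have dvd: "int p dvd i" if "of_int i * x \<in> B" for i
  proof (rule ccontr)
    assume "\<not> int p dvd i"
    then have "coprime (int p) i" using p by (simp add: prime_imp_coprime)
    then obtain u w where uw: "u * int p + w * i = 1"
      using bezout_int[of "int p" i] by (auto simp: coprime_iff_gcd_eq_1)
    have "of_int (int p * u) * x + of_int w * (of_int i * x) \<in> B"
      by (intro add_subgroup_add[OF B] px add_subgroup_of_int_mult[OF B] that)
    moreover have "of_int (int p * u) * x + of_int w * (of_int i * x) = of_int (u * int p + w * i) * x"
      unfolding of_int_add of_int_mult distrib_right mult.assoc of_int_of_nat_eq
      by (simp only: mult.assoc[symmetric] mult_of_nat_commute[of p "of_int u"])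
    ultimately show False using uw x(2) by (metis mult_1 of_int_1)
  qed
  define T where "T = (\<lambda>i. of_int i * x) ` {0..<int p}"
  have uniq: "i = j" if "of_int i * x - of_int j * x \<in> B" "i \<in> {0..<int p}" "j \<in> {0..<int p}" for i j
  proof -
    have "int p dvd i - j" using dvd[of "i - j"] that by (simp add: left_diff_distrib)
    then have "i mod int p = j mod int p" by (simp add: mod_eq_dvd_iff)
    then show ?thesis using that by simp
  qed
  have "transversal C B T"
    unfolding transversal_def
  proof (intro conjI ballI)
    show "T \<subseteq> C"
    proof
      fix t assume "t \<in> T"
      then obtain i where "t = of_int i * x" by (auto simp: T_def)
      then show "t \<in> C" using add_subgroup_of_int_mult[OF A(1) x(1), of i] add_subgroup_zero[OF B]
        by (auto simp: C_def intro!: exI[of _ i])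
    qed
    fix y assume "y \<in> C"
    then obtain i where i: "y - of_int i * x \<in> B" by (auto simp: C_def)
    define r where "r = i mod int p"
    have r: "r \<in> {0..<int p}" using p by (simp add: r_def prime_gt_0_nat)
    have "of_int i * x = of_int (int p * (i div int p)) * x + of_int r * x"
      unfolding r_def distrib_right[symmetric] of_int_add[symmetric] mult_div_mod_eq ..
    then have "y - of_int r * x = (y - of_int i * x) + of_int (int p * (i div int p)) * x"
      by (simp only: algebra_simps)
    then have yr: "y - of_int r * x \<in> B"
      using add_subgroup_add[OF B i px[of "i div int p"]] by metis
    show "\<exists>!t. t \<in> T \<and> y - t \<in> B"
    proof (rule ex1I[of _ "of_int r * x"])
      show "of_int r * x \<in> T \<and> y - of_int r * x \<in> B" using r yr by (auto simp: T_def)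
      fix t assume "t \<in> T \<and> y - t \<in> B"
      then obtain j where j: "j \<in> {0..<int p}" "t = of_int j * x" "y - of_int j * x \<in> B"
        by (auto simp: T_def)
      have "of_int j * x - of_int r * x \<in> B"
        using add_subgroup_diff[OF B yr j(3)] by simp
      then show "t = of_int r * x" using uniq j r by blast
    qed
  qed
  note card_cosets_transversal(1)[OF B this]
  moreover have "inj_on (\<lambda>i. of_int i * x) {0..<int p}"
    using uniq add_subgroup_zero[OF B] by (auto simp: inj_on_def)
  ultimately show "card (cosets C B) = p" by (simp add: T_def card_image)
qed

text \<open>The order of a finite p-group, by induction on the index: adjoining to \<open>B\<close>
  an element of order \<open>p\<close> divides the index by \<open>p\<close>.\<close>

lemma card_cosets_prime_power:
  fixes A B :: "'a::ring_1 set"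
  assumes "prime p" "add_subgroup A" "add_subgroup B" "B \<subseteq> A" "finite (cosets A B)"
    and "\<And>x. x \<in> A \<Longrightarrow> of_nat (p ^ a) * x \<in> B"
  shows "\<exists>j. card (cosets A B) = p ^ j"
  using assms
proof (induction "card (cosets A B)" arbitrary: B rule: less_induct)
  case less
  show ?case
  proof (cases "A = B")
    case True
    have "transversal A A {0}"
      using add_subgroup_zero less.prems(2) by (auto simp: transversal_def)
    then have "card (cosets A B) = p ^ 0"
      using card_cosets_transversal(1)[OF less.prems(2)] True by simp
    then show ?thesis ..
  next
    case False
    then obtain y where y: "y \<in> A" "y \<notin> B" using less.prems(4) by auto
    then obtain b where b: "of_nat (p ^ b) * y \<notin> B" "of_nat p * (of_nat (p ^ b) * y) \<in> B"
      using ex_prime_torsion_mod_subgroup less.prems(6) by metis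
    define x where "x = of_nat (p ^ b) * y"
    have x: "x \<in> A" "x \<notin> B" "of_nat p * x \<in> B"
      using b add_subgroup_of_int_mult[OF less.prems(2) y(1), of "int (p ^ b)"]
      unfolding x_def by (metis of_int_of_nat_eq)+
    define C where "C = {y \<in> A. \<exists>i. y - of_int i * x \<in> B}"
    have C: "add_subgroup C" "card (cosets C B) = p"
      using card_cosets_cyclic_extension[OF less.prems(3,2,4,1) x] by (simp_all add: C_def)
    have BC: "B \<subseteq> C" "C \<subseteq> A" using less.prems(4) by (auto simp: C_def intro!: exI[of _ 0])
    note tower = cosets_tower[OF less.prems(2) C(1) less.prems(3) BC]
    have fin: "finite (cosets A C)" using tower(3) less.prems(5) .
    have card: "card (cosets A B) = card (cosets A C) * p" using tower(1) C(2) by simp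
    have "card (cosets A C) < card (cosets A B)"
      using card card_cosets_pos[OF fin less.prems(2)] prime_gt_1_nat[OF less.prems(1)] by simp
    then obtain j where "card (cosets A C) = p ^ j"
      using less.hyps[of C] less.prems C(1) BC fin by blast
    then show ?thesis using card by (metis power_Suc2)
  qed
qed

lemma prod_mem_mult_closed:
  assumes "1 \<in> S" "\<And>x y. x \<in> S \<Longrightarrow> y \<in> S \<Longrightarrow> x * y \<in> S" "\<And>i. i \<in> I \<Longrightarrow> f i \<in> S"
  shows "(\<Prod>i\<in>I. f i) \<in> (S :: 'a::comm_monoid_mult set)"
  using assms by (induction I rule: infinite_finite_induct) auto

lemma sum_mem_add_closed:
  assumes "0 \<in> S" "\<And>x y. x \<in> S \<Longrightarrow> y \<in> S \<Longrightarrow> x + y \<in> S" "\<And>i. i \<in> I \<Longrightarrow> f i \<in> S"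
  shows "(\<Sum>i\<in>I. f i) \<in> (S :: 'a::comm_monoid_add set)"
  using assms by (induction I rule: infinite_finite_induct) auto

section \<open>The p-adic integers\<close>

locale padic_field = padic_numbers p Q v
  for p :: nat and Q :: "'k::field_char_0 set" and v :: "'k \<Rightarrow> real" +
  assumes prime_p: "prime p"
begin

abbreviation Z where "Z \<equiv> padic_integers Q v"

lemma p_gt_1: "1 < p"
  using prime_p by (rule prime_gt_1_nat)

lemma diff_closed: "x \<in> Q \<Longrightarrow> y \<in> Q \<Longrightarrow> x - y \<in> Q"
  using add_closed[of x "- y"] uminus_closed by simp

lemma of_nat_closed: "of_nat n \<in> Q"
  by (induction n) (auto intro: zero_closed one_closed add_closed)

lemma of_int_closed: "of_int i \<in> Q"
  by (cases i rule: int_cases2) (auto intro: of_nat_closed uminus_closed)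

lemma of_rat_closed: "of_rat r \<in> Q"
proof -
  obtain a b where "r = Rat.Fract a b" "b > 0" by (cases r)
  then have "of_rat r = of_int a * inverse (of_int b :: 'k)"
    by (simp add: of_rat_rat divide_inverse)
  then show ?thesis by (simp add: mult_closed inverse_closed of_int_closed)
qed

lemma power_closed: "x \<in> Q \<Longrightarrow> x ^ i \<in> Q"
  by (induction i) (auto intro: one_closed mult_closed)

lemma sum_closed: "(\<And>i. i \<in> I \<Longrightarrow> f i \<in> Q) \<Longrightarrow> (\<Sum>i\<in>I. f i) \<in> Q"
  by (intro sum_mem_add_closed zero_closed add_closed)

lemma abs_of_int: "v (of_int a) = (if a = 0 then 0 else inverse (real p ^ multiplicity (int p) a))"
proof -
  have "v (of_rat (of_int a)) = padic_abs p (of_int a)" by (rule abs_of_rat)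
  then show ?thesis
    by (simp add: padic_abs_def quotient_of_int power_int_minus)
qed

lemma abs_of_int_le_1: "v (of_int a) \<le> 1"
  using p_gt_1 by (simp add: abs_of_int inverse_le_1_iff)

lemma abs_of_int_coprime: "\<not> int p dvd a \<Longrightarrow> v (of_int a) = 1"
  by (auto simp: abs_of_int not_dvd_imp_multiplicity_0)

lemma abs_of_nat_le_1: "v (of_nat n) \<le> 1"
  using abs_of_int_le_1[of "int n"] by simp

lemma abs_one: "v 1 = 1"
  using abs_of_int[of 1] by simp

lemma abs_zero: "v 0 = 0"
  using abs_eq_0_iff[OF zero_closed] by simp

lemma abs_uminus: "x \<in> Q \<Longrightarrow> v (- x) = v x"
  using abs_mult[of "- 1" x] abs_of_int[of "- 1"] uminus_closed[OF one_closed] by simp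

lemma abs_p: "v (of_nat p) = 1 / p"
proof -
  have "multiplicity (int p) (int p) = 1"
    using p_gt_1 by (intro multiplicity_self) auto
  then show ?thesis
    using abs_of_int[of "int p"] p_gt_1 by (simp add: divide_inverse)
qed

lemma abs_power: "x \<in> Q \<Longrightarrow> v (x ^ i) = v x ^ i"
  by (induction i) (simp_all add: abs_one abs_mult power_closed)

lemma abs_inverse: "x \<in> Q \<Longrightarrow> v (inverse x) = inverse (v x)"
  using abs_mult[of x "inverse x"] inverse_closed[of x] abs_eq_0_iff[of x]
  by (cases "x = 0") (auto simp: abs_one abs_zero field_simps)

lemma abs_divide: "x \<in> Q \<Longrightarrow> y \<in> Q \<Longrightarrow> v (x / y) = v x / v y"
  by (simp add: divide_inverse abs_mult abs_inverse inverse_closed)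

lemma abs_sum_le: "(\<And>i. i \<in> I \<Longrightarrow> f i \<in> Q) \<Longrightarrow> v (\<Sum>i\<in>I. f i) \<le> (\<Sum>i\<in>I. v (f i))"
proof (induction I rule: infinite_finite_induct)
  case (insert x F)
  then show ?case
    using abs_triangle[of "f x" "\<Sum>i\<in>F. f i"] sum_closed[of F f] by force
qed (auto simp: abs_zero)

text \<open>
  The powers of \<open>v (x + y) / max (v x) (v y)\<close> grow at most linearly, by the binomial theorem
  and \<open>v \<le> 1\<close> on the binomial coefficients.
\<close>

lemma abs_add_le_max:
  assumes x: "x \<in> Q" and y: "y \<in> Q"
  shows "v (x + y) \<le> max (v x) (v y)"
proof (rule ccontr)
  define m where "m = max (v x) (v y)"
  assume "\<not> v (x + y) \<le> max (v x) (v y)"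
  then have less: "m < v (x + y)" unfolding m_def by linarith
  have m0: "0 \<le> m" using abs_nonneg[OF x] by (simp add: m_def)
  have bound: "v (x + y) ^ n \<le> (real n + 1) * m ^ n" for n
  proof -
    have "v (x + y) ^ n = v (\<Sum>k\<le>n. of_nat (n choose k) * x ^ k * y ^ (n - k))"
      using abs_power[OF add_closed[OF x y]] by (simp add: binomial_ring)
    also have "\<dots> \<le> (\<Sum>k\<le>n. v (of_nat (n choose k) * x ^ k * y ^ (n - k)))"
      by (intro abs_sum_le mult_closed of_nat_closed power_closed x y)
    also have "\<dots> \<le> (\<Sum>k\<le>n. m ^ n)"
    proof (rule sum_mono)
      fix k assume "k \<in> {..n}"
      then have "m ^ n = 1 * m ^ k * m ^ (n - k)" by (simp flip: power_add)
      moreover have "v (of_nat (n choose k) * x ^ k * y ^ (n - k))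
          = v (of_nat (n choose k)) * v x ^ k * v y ^ (n - k)"
        by (simp add: abs_mult abs_power mult_closed of_nat_closed power_closed x y)
      moreover have "\<dots> \<le> 1 * m ^ k * m ^ (n - k)"
        using abs_nonneg[OF x] abs_nonneg[OF y] m0
        by (intro mult_mono power_mono abs_of_nat_le_1) (auto simp: m_def)
      ultimately show "v (of_nat (n choose k) * x ^ k * y ^ (n - k)) \<le> m ^ n" by simp
    qed
    finally show ?thesis by (simp add: add.commute)
  qed
  have mpos: "0 < m"
  proof (rule ccontr)
    assume "\<not> 0 < m"
    then have "m = 0" using m0 by simp
    then show False using bound[of 1] less by simp
  qed
  define c where "c = v (x + y) / m"
  have c: "1 < c" using less mpos by (simp add: c_def)
  \<comment> \<open>The bounds 1/2 and \<open>n \<ge> 1\<close> are chosen so that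
    \<open>c ^ n > 2 * n \<ge> n + 1\<close>, against the linear bound on
    \<open>c ^ n\<close>.\<close>
  have "(\<lambda>n. real n / c ^ n) \<longlonglongrightarrow> 0"
    using lim_n_over_pown[of c] c by simp
  then have "\<forall>\<^sub>F n in sequentially. real n / c ^ n < 1 / 2"
    by (rule order_tendstoD) simp
  then have "\<forall>\<^sub>F n in sequentially. n \<ge> 1 \<and> real n / c ^ n < 1 / 2"
    by (intro eventually_conj eventually_ge_at_top)
  then obtain n where n: "n \<ge> 1" "real n / c ^ n < 1 / 2"
    unfolding eventually_sequentially by auto
  have "c ^ n \<le> real n + 1"
    using bound[of n] mpos by (simp add: c_def power_divide field_simps)
  moreover have "2 * real n < c ^ n" using n c by (simp add: field_simps)
  moreover have "real n \<ge> 1" using n by simp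
  ultimately show False by linarith
qed

lemma Z_add: "x \<in> Z \<Longrightarrow> y \<in> Z \<Longrightarrow> x + y \<in> Z"
  using abs_add_le_max[of x y] add_closed by (fastforce simp: padic_integers_def)

lemma Z_mult: "x \<in> Z \<Longrightarrow> y \<in> Z \<Longrightarrow> x * y \<in> Z"
  using mult_le_one[of "v x" "v y"] by (auto simp: padic_integers_def mult_closed abs_mult abs_nonneg)

lemma Z_uminus: "x \<in> Z \<Longrightarrow> - x \<in> Z"
  by (auto simp: padic_integers_def uminus_closed abs_uminus)

lemma Z_of_int: "of_int i \<in> Z"
  by (simp add: padic_integers_def of_int_closed abs_of_int_le_1)

lemma Z_of_nat: "of_nat i \<in> Z"
  using Z_of_int[of "int i"] by simp

lemma Z_zero: "0 \<in> Z" and Z_one: "1 \<in> Z"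
  using Z_of_int[of 0] Z_of_int[of 1] by simp_all

lemma Z_sum: "(\<And>i. i \<in> I \<Longrightarrow> f i \<in> Z) \<Longrightarrow> (\<Sum>i\<in>I. f i) \<in> Z"
  by (intro sum_mem_add_closed Z_zero Z_add)

lemma Z_power: "x \<in> Z \<Longrightarrow> x ^ i \<in> Z"
  by (induction i) (auto intro: Z_one Z_mult)

lemma Z_subset_Q: "x \<in> Z \<Longrightarrow> x \<in> Q"
  by (simp add: padic_integers_def)

lemma Z_inverse: "x \<in> Z \<Longrightarrow> v x = 1 \<Longrightarrow> inverse x \<in> Z"
  by (simp add: padic_integers_def inverse_closed abs_inverse)

section \<open>Residues of p-adic integers modulo \<open>p\<close>\<close>

lemma Z_divide_p:
  assumes "x \<in> Q" "v x \<le> 1 / p"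
  shows "x / of_nat p \<in> Z"
proof -
  have "v (x / of_nat p) = v x * p" by (simp add: abs_divide of_nat_closed abs_p assms)
  also have "\<dots> \<le> 1 / p * p" using assms(2) by (rule mult_right_mono) simp
  also have "\<dots> = 1" using p_gt_1 by simp
  finally show ?thesis
    using assms(1) by (simp add: padic_integers_def divide_inverse mult_closed inverse_closed of_nat_closed)
qed

lemma abs_int_multiple_le: "int p dvd a \<Longrightarrow> v (of_int a) \<le> 1 / p"
proof -
  assume "int p dvd a"
  then obtain b where "a = int p * b" ..
  then have "v (of_int a) = 1 / p * v (of_int b)"
    using abs_mult[OF of_nat_closed of_int_closed, of p b] abs_p by simp
  then show ?thesis
    using abs_of_int_le_1[of b] abs_nonneg[OF of_int_closed, of b]
    by (simp add: divide_right_mono)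
qed

text \<open>Density of the rationals gives \<open>a / b\<close> at distance less than 1/p from
  \<open>x\<close>. It has absolute value at most 1, so \<open>p\<close> does not divide
  \<open>b\<close>, and the residue is that of \<open>a\<close> times an inverse of \<open>b\<close>
  modulo \<open>p\<close>.\<close>

lemma residue_mod_p:
  assumes x: "x \<in> Z"
  obtains i where "i < p" "(x - of_nat i) / of_nat p \<in> Z"
proof -
  have xQ: "x \<in> Q" and vx: "v x \<le> 1" using x by (auto simp: padic_integers_def)
  have p: "0 < 1 / real p" "1 / real p < 1" using p_gt_1 by auto
  obtain r where r: "v (x - of_rat r) < 1 / p" using rat_dense[OF xQ p(1)] by auto
  obtain a b where ab: "r = Rat.Fract a b" "b > 0" "coprime a b" by (cases r)
  have r_eq: "of_rat r = of_int a / (of_int b :: 'k)" using ab by (simp add: of_rat_rat)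
  have diff: "x - of_rat r \<in> Q" by (intro diff_closed xQ of_rat_closed)
  have "v (of_rat r) \<le> max (v x) (v (- (x - of_rat r)))"
    using abs_add_le_max[OF xQ uminus_closed[OF diff]] by simp
  then have vr: "v (of_rat r) \<le> 1" using vx r p abs_uminus[OF diff] by linarith
  have b0: "(of_int b :: 'k) \<noteq> 0" using ab by simp
  have b: "\<not> int p dvd b"
  proof
    assume pb: "int p dvd b"
    have "\<not> int p dvd a"
    proof
      assume "int p dvd a"
      then have "is_unit (int p)" using pb ab(3) by (meson coprime_common_divisor)
      then show False using p_gt_1 by simp
    qed
    then have "1 = v (of_int a)" by (simp add: abs_of_int_coprime)
    also have "of_int a = of_rat r * (of_int b :: 'k)" using r_eq b0 by simp
    also have "v \<dots> = v (of_rat r) * v (of_int b)"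
      by (intro abs_mult of_rat_closed of_int_closed)
    also have "\<dots> \<le> 1 * v (of_int b)"
      using vr abs_nonneg[OF of_int_closed] by (intro mult_right_mono)
    also have "\<dots> \<le> 1 / p" using abs_int_multiple_le[OF pb] by simp
    finally show False using p by simp
  qed
  then have "coprime (int p) b" using prime_p by (simp add: prime_imp_coprime)
  then obtain s t where st: "s * int p + t * b = 1"
    using bezout_int[of "int p" b] by (auto simp: coprime_iff_gcd_eq_1)
  define i where "i = nat (a * t mod int p)"
  have i: "i < p" "int i = a * t mod int p" using p_gt_1 by (auto simp: i_def nat_less_iff)
  \<comment> \<open>Both summands have absolute value at most 1/p: the first because
    \<open>t\<close> inverts \<open>b\<close> modulo \<open>p\<close>, the second by the choice of
    \<open>i\<close>.\<close>
  have "of_rat r - of_nat i = (of_int a :: 'k) * of_int (1 - b * t) / of_int b + of_int (a * t - int i)"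
    unfolding r_eq using b0 by (simp add: field_simps)
  moreover have "v (of_int a * of_int (1 - b * t) / of_int b) \<le> 1 / p"
  proof -
    have "int p dvd 1 - b * t" using st by (intro dvdI[of _ _ s]) (simp add: algebra_simps)
    then have "v (of_int a) * v (of_int (1 - b * t)) \<le> 1 * (1 / p)"
      by (intro mult_mono abs_of_int_le_1 abs_int_multiple_le abs_nonneg of_int_closed) auto
    moreover have "v (of_int a * of_int (1 - b * t) / of_int b)
        = v (of_int a) * v (of_int (1 - b * t)) / v (of_int b)"
      by (simp only: abs_divide abs_mult mult_closed of_int_closed)
    ultimately show ?thesis using abs_of_int_coprime[OF b] by simp
  qed
  moreover have "v (of_int (a * t - int i)) \<le> 1 / p"
    by (rule abs_int_multiple_le) (simp add: i(2) minus_mod_eq_mult_div)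
  ultimately have vi: "v (of_rat r - of_nat i) \<le> 1 / p"
    using abs_add_le_max[of "of_int a * of_int (1 - b * t) / of_int b" "of_int (a * t - int i)"]
    by (simp add: divide_inverse mult_closed inverse_closed of_int_closed del: of_int_diff of_int_mult)
  have iQ: "of_rat r - of_nat i \<in> Q" by (intro diff_closed of_rat_closed of_nat_closed)
  have "v (x - of_nat i) \<le> max (v (x - of_rat r)) (v (of_rat r - of_nat i))"
    using abs_add_le_max[OF diff iQ] by simp
  then have "v (x - of_nat i) \<le> 1 / p" using r vi by linarith
  then have "(x - of_nat i) / of_nat p \<in> Z"
    by (intro Z_divide_p diff_closed xQ of_nat_closed)
  then show thesis by (rule that[OF i(1)])
qed

text \<open>The absolute value takes no value on \<open>Q\<close> strictly between 1/p and 1. A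
  nonzero residue \<open>i < p\<close> would have absolute value 1, whereas both \<open>x\<close>
  and \<open>x - of_nat i\<close> lie strictly below 1.\<close>

lemma abs_less_1_divide_p:
  assumes "x \<in> Q" "v x < 1"
  shows "x / of_nat p \<in> Z"
proof -
  have x: "x \<in> Z" using assms by (simp add: padic_integers_def)
  obtain i where i: "i < p" "(x - of_nat i) / of_nat p \<in> Z" using residue_mod_p[OF x] .
  have "i = 0"
  proof (rule ccontr)
    assume "i \<noteq> 0"
    then have "v (of_nat i) = 1"
      using abs_of_int_coprime[of "int i"] i by (simp add: nat_dvd_not_less)
    moreover have "v (of_nat p * ((x - of_nat i) / of_nat p)) \<le> 1 / p * 1"
      using i(2) by (subst abs_mult)
        (auto simp: of_nat_closed abs_p padic_integers_def intro: divide_right_mono)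
    then have "v (x - of_nat i) \<le> 1 / p" using p_gt_1 by simp
    moreover have "1 / real p < 1" using p_gt_1 by simp
    ultimately have "v (x - of_nat i) < 1" "v (of_nat i) = 1" by linarith+
    moreover have "v (of_nat i) \<le> max (v x) (v (- (x - of_nat i)))"
      using abs_add_le_max[of x "- (x - of_nat i)"] assms
      by (simp add: diff_closed uminus_closed of_nat_closed)
    ultimately show False
      using assms abs_uminus[OF diff_closed[OF assms(1) of_nat_closed, of i]] by simp
  qed
  then show ?thesis using i by simp
qed

lemma ex_p_power_mult_mem_Z:
  assumes "x \<in> Q"
  obtains a where "of_nat p ^ a * x \<in> Z"
proof -
  obtain a where a: "v x < real p ^ a" using real_arch_pow[of "real p" "v x"] p_gt_1 by auto
  have "v (of_nat p ^ a * x) = v x / real p ^ a"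
    using assms by (simp add: abs_mult power_closed of_nat_closed abs_power abs_p power_one_over)
  then have "of_nat p ^ a * x \<in> Z"
    using a p_gt_1 assms by (simp add: padic_integers_def mult_closed power_closed of_nat_closed)
  then show thesis by (rule that)
qed

end

section \<open>Integral closure\<close>

lemma restrict_eq_iff: "restrict f A = restrict g A \<longleftrightarrow> (\<forall>a\<in>A. f a = g a)"
  by (metis restrict_apply' restrict_ext)

text \<open>The Leibniz formula uses only ring operations. It will be applied to the polynomials
  with coefficients in \<open>Z\<close>, a subring that is a set and not a type.\<close>

lemma det_mem_subring:
  fixes A :: "'a::comm_ring_1 mat"
  assumes A: "A \<in> carrier_mat n n" "\<And>i j. i < n \<Longrightarrow> j < n \<Longrightarrow> A $$ (i, j) \<in> S"
    and S: "0 \<in> S" "1 \<in> S" "\<And>x y. x \<in> S \<Longrightarrow> y \<in> S \<Longrightarrow> x + y \<in> S"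
      "\<And>x y. x \<in> S \<Longrightarrow> y \<in> S \<Longrightarrow> x * y \<in> S" "\<And>x. x \<in> S \<Longrightarrow> - x \<in> S"
  shows "det A \<in> S"
  unfolding det_def'[OF A(1)]
proof (rule sum_mem_add_closed[OF S(1,3)])
  fix \<pi> assume "\<pi> \<in> {\<pi>. \<pi> permutes {0..<n}}"
  then have "\<pi> i < n" if "i < n" for i
    using that permutes_in_image[of \<pi> "{0..<n}" i] by simp
  then have "(\<Prod>i = 0..<n. A $$ (i, \<pi> i)) \<in> S"
    by (intro prod_mem_mult_closed S) (auto intro: A)
  moreover have "(signof \<pi> :: 'a) \<in> S" by (cases \<pi> rule: sign_cases) (auto intro: S)
  ultimately show "signof \<pi> * (\<Prod>i = 0..<n. A $$ (i, \<pi> i)) \<in> S" by (rule S(4)[rotated])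
qed

lemma finite_cosets_if_covered:
  assumes B: "add_subgroup B" and T: "finite T" "T \<subseteq> A" "\<And>x. x \<in> A \<Longrightarrow> \<exists>t\<in>T. x - t \<in> B"
  shows "finite (cosets A B)"
proof (rule finite_surj[OF T(1)])
  let ?r = "{(x, y). x \<in> A \<and> y \<in> A \<and> x - y \<in> B}"
  show "cosets A B \<subseteq> (\<lambda>t. ?r `` {t}) ` T"
  proof
    fix X assume "X \<in> cosets A B"
    then obtain x where x: "x \<in> A" "X = ?r `` {x}" by (auto simp: cosets_def quotient_def)
    obtain t where t: "t \<in> T" "x - t \<in> B" using T(3) x by auto
    have "x - y \<in> B \<longleftrightarrow> t - y \<in> B" for y
      using add_subgroup_add[OF B t(2), of "t - y"] add_subgroup_diff[OF B _ t(2), of "x - y"]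
      by (simp, argo)
    then have "X = ?r `` {t}" using x t T(2) by auto
    then show "X \<in> (\<lambda>t. ?r `` {t}) ` T" using t by blast
  qed
qed

text \<open>An injective additive map carries a transversal to a transversal. The maps in question
  are multiplications by a nonzero scalar.\<close>

lemma cosets_image_additive:
  fixes h :: "'a::ab_group_add \<Rightarrow> 'b::ab_group_add"
  assumes h: "inj h" "\<And>x y. h (x - y) = h x - h y" and B: "add_subgroup B"
  shows "card (cosets (h ` A) (h ` B)) = card (cosets A B)"
    and "finite (cosets (h ` A) (h ` B)) \<longleftrightarrow> finite (cosets A B)"
    and "add_subgroup (h ` B)"
proof -
  show sub: "add_subgroup (h ` B)"
    using B h(2)[of 0 0] h(2) unfolding add_subgroup_def
    by (auto simp flip: h(2))
  obtain T where T: "transversal A B T" using ex_transversal[OF B] .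
  have "transversal (h ` A) (h ` B) (h ` T)"
    unfolding transversal_def
  proof (intro conjI ballI)
    show "h ` T \<subseteq> h ` A" using transversal_subset[OF T] by auto
    fix y assume "y \<in> h ` A"
    then obtain x where x: "x \<in> A" "y = h x" by auto
    have iff: "y - h u \<in> h ` B \<longleftrightarrow> x - u \<in> B" for u
      using inj_image_mem_iff[OF h(1)] by (simp add: x(2) flip: h(2))
    obtain t where t: "t \<in> T" "x - t \<in> B" using transversal_ex[OF T x(1)] .
    show "\<exists>!u. u \<in> h ` T \<and> y - u \<in> h ` B"
    proof (rule ex1I[of _ "h t"])
      show "h t \<in> h ` T \<and> y - h t \<in> h ` B" using t by (simp add: iff)
      fix u assume u: "u \<in> h ` T \<and> y - u \<in> h ` B"
      then obtain s where s: "s \<in> T" "u = h s" by auto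
      with u have "x - s \<in> B" by (simp add: iff)
      then show "u = h t" using transversal_unique[OF T x(1)] s t by metis
    qed
  qed
  note card_cosets_transversal[OF sub this] card_cosets_transversal[OF B T]
  then show "card (cosets (h ` A) (h ` B)) = card (cosets A B)"
    and "finite (cosets (h ` A) (h ` B)) \<longleftrightarrow> finite (cosets A B)"
    using inj_on_subset[OF h(1)] by (simp_all add: card_image finite_image_iff)
qed

locale padic_extension = padic_field p Q v
  for p :: nat and Q :: "'k::field_char_0 set" and v :: "'k \<Rightarrow> real" +
  assumes finite_ext: "finite_extension Q"
begin

abbreviation R where "R \<equiv> ring_of_integers Z"

lemma ring_of_integersE:
  assumes "x \<in> R"
  obtains n a where "x ^ n = (\<Sum>i<n. a i * x ^ i)" "\<And>i. a i \<in> Z"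
proof -
  obtain f where f: "lead_coeff f = 1" "\<And>i. coeff f i \<in> Z" "poly f x = 0"
    using assms by (auto simp: ring_of_integers_def)
  have "0 = (\<Sum>i<degree f. coeff f i * x ^ i) + x ^ degree f"
    using f(1,3) by (simp add: poly_altdef flip: lessThan_Suc_atMost)
  then have "x ^ degree f = (\<Sum>i<degree f. (- coeff f i) * x ^ i)"
    by (simp add: sum_negf eq_neg_iff_add_eq_0 add.commute)
  then show thesis by (rule that) (simp add: Z_uminus f(2))
qed

lemma ring_of_integersI:
  assumes "x ^ n = (\<Sum>i<n. a i * x ^ i)" "\<And>i. i < n \<Longrightarrow> a i \<in> Z"
  shows "x \<in> R"
proof -
  define g where "g = (\<Sum>i<n. monom (a i) i)"
  define f where "f = monom 1 n - g"
  have g: "coeff g i = (if i < n then a i else 0)" for i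
    by (simp add: g_def coeff_sum if_distrib sum.If_cases)
  have f: "coeff f i = (if i < n then - a i else if i = n then 1 else 0)" for i
    by (simp add: f_def g)
  have "degree f = n"
    by (rule antisym[OF degree_le le_degree]) (auto simp: f)
  then have "lead_coeff f = 1" by (simp add: f)
  moreover have "coeff f i \<in> Z" for i
    using assms(2) by (auto simp: f Z_zero Z_one Z_uminus)
  moreover have "poly f x = 0"
    using assms(1) by (simp add: f_def g_def poly_sum poly_monom)
  ultimately show ?thesis by (auto simp: ring_of_integers_def)
qed

section \<open>Integral elements form a ring\<close>

definition Zspan where
  "Zspan W = {x. \<exists>c. (\<forall>w\<in>W. c w \<in> Z) \<and> x = (\<Sum>w\<in>W. c w * w)}"

lemma Zspan_zero: "0 \<in> Zspan W"
  unfolding Zspan_def by (auto intro!: exI[of _ "\<lambda>_. 0"] Z_zero)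

lemma Zspan_add:
  assumes "x \<in> Zspan W" "y \<in> Zspan W" shows "x + y \<in> Zspan W"
proof -
  obtain c d where "\<forall>w\<in>W. c w \<in> Z" "x = (\<Sum>w\<in>W. c w * w)" "\<forall>w\<in>W. d w \<in> Z" "y = (\<Sum>w\<in>W. d w * w)"
    using assms by (auto simp: Zspan_def)
  then show ?thesis
    unfolding Zspan_def
    by (auto intro!: exI[of _ "\<lambda>w. c w + d w"] Z_add simp: distrib_right sum.distrib)
qed

lemma Zspan_mult:
  assumes "z \<in> Z" "x \<in> Zspan W" shows "z * x \<in> Zspan W"
proof -
  obtain c where "\<forall>w\<in>W. c w \<in> Z" "x = (\<Sum>w\<in>W. c w * w)"
    using assms by (auto simp: Zspan_def)
  then show ?thesis
    using assms(1) unfolding Zspan_def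
    by (auto intro!: exI[of _ "\<lambda>w. z * c w"] Z_mult simp: sum_distrib_left mult.assoc)
qed

lemma Zspan_sum: "(\<And>i. i \<in> I \<Longrightarrow> f i \<in> Zspan W) \<Longrightarrow> (\<Sum>i\<in>I. f i) \<in> Zspan W"
  by (intro sum_mem_add_closed Zspan_zero Zspan_add)

lemma Zspan_base:
  assumes "finite W" "w \<in> W" shows "w \<in> Zspan W"
proof -
  have "(\<Sum>u\<in>W. (if u = w then 1 else 0) * u) = (\<Sum>u\<in>W. if u = w then u else 0)"
    by (rule sum.cong) auto
  then show ?thesis
    using assms unfolding Zspan_def
    by (auto intro!: exI[of _ "\<lambda>u. if u = w then 1 else 0"] Z_zero Z_one)
qed

lemma Zspan_stable:
  assumes "\<And>w. w \<in> W \<Longrightarrow> x * w \<in> Zspan W" "y \<in> Zspan W"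
  shows "x * y \<in> Zspan W"
proof -
  obtain c where c: "\<forall>w\<in>W. c w \<in> Z" "y = (\<Sum>w\<in>W. c w * w)"
    using assms by (auto simp: Zspan_def)
  have "x * y = (\<Sum>w\<in>W. c w * (x * w))"
    by (simp add: c(2) sum_distrib_left algebra_simps)
  also have "\<dots> \<in> Zspan W" by (rule Zspan_sum, rule Zspan_mult) (use c(1) assms(1) in auto)
  finally show ?thesis .
qed

lemma char_poly_coeff_mem_Z:
  assumes A: "A \<in> carrier_mat n n" "\<And>i j. i < n \<Longrightarrow> j < n \<Longrightarrow> A $$ (i, j) \<in> Z"
  shows "coeff (char_poly A) i \<in> Z"
proof -
  define S where "S = {f. \<forall>i. coeff f i \<in> Z}"
  have const: "[:a:] \<in> S" if "a \<in> Z" for a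
    using that by (auto simp: S_def coeff_pCons Z_zero split: nat.split)
  have X: "[:0, 1:] \<in> S"
    by (auto simp: S_def coeff_pCons Z_zero Z_one split: nat.split)
  have "det (char_poly_matrix A) \<in> S"
  proof (rule det_mem_subring)
    show "char_poly_matrix A \<in> carrier_mat n n" using A(1) by simp
    show S0: "0 \<in> S" and "1 \<in> S" using const[OF Z_zero] const[OF Z_one] by (simp_all add: one_pCons)
    show S_add: "x + y \<in> S" if "x \<in> S" "y \<in> S" for x y using that by (simp add: S_def Z_add)
    show "x * y \<in> S" if "x \<in> S" "y \<in> S" for x y
      using that by (auto simp: S_def coeff_mult intro!: Z_sum Z_mult)
    show "- x \<in> S" if "x \<in> S" for x using that by (simp add: S_def Z_uminus)
    fix i j assume ij: "i < n" "j < n"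
    have "char_poly_matrix A $$ (i, j) = (if i = j then [:0, 1:] else 0) + [:- A $$ (i, j):]"
      using A(1) ij by (auto simp: char_poly_matrix_def)
    also have "\<dots> \<in> S" using X S0 ij A(2) by (intro S_add const Z_uminus) auto
    finally show "char_poly_matrix A $$ (i, j) \<in> S" .
  qed
  then show ?thesis by (simp add: char_poly_def S_def)
qed

text \<open>The determinant trick. Multiplication by \<open>x\<close> on \<open>W\<close> is given
  by a matrix over \<open>Z\<close> that has the vector of elements of \<open>W\<close> as an
  eigenvector for \<open>x\<close>, so \<open>x\<close> is a root of a monic characteristic
  polynomial over \<open>Z\<close>. The element \<open>w0\<close> makes this vector nonzero.\<close>

lemma ring_of_integers_if_stable:
  assumes W: "finite W" "w0 \<in> W" "w0 \<noteq> 0" and stable: "\<And>w. w \<in> W \<Longrightarrow> x * w \<in> Zspan W"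
  shows "x \<in> R"
proof -
  define n where "n = card W"
  obtain f where f: "bij_betw f {0..<n} W"
    unfolding n_def using ex_bij_betw_nat_finite[OF W(1)] by auto
  have "\<forall>w\<in>W. \<exists>c. (\<forall>u\<in>W. c u \<in> Z) \<and> x * w = (\<Sum>u\<in>W. c u * u)"
    using stable by (auto simp: Zspan_def)
  then obtain C where C: "\<And>w u. w \<in> W \<Longrightarrow> u \<in> W \<Longrightarrow> C w u \<in> Z"
      "\<And>w. w \<in> W \<Longrightarrow> x * w = (\<Sum>u\<in>W. C w u * u)"
    by metis
  have fW: "f i \<in> W" if "i < n" for i using f that by (auto simp: bij_betw_def)
  define A where "A = mat n n (\<lambda>(i, j). C (f i) (f j))"
  have A: "A \<in> carrier_mat n n" "\<And>i j. i < n \<Longrightarrow> j < n \<Longrightarrow> A $$ (i, j) \<in> Z"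
    by (auto simp: A_def C(1) fW)
  have "A *\<^sub>v vec n f = x \<cdot>\<^sub>v vec n f"
  proof (rule eq_vecI)
    fix i assume "i < dim_vec (x \<cdot>\<^sub>v vec n f)"
    then have i: "i < n" by simp
    have "(A *\<^sub>v vec n f) $ i = (\<Sum>j = 0..<n. C (f i) (f j) * f j)"
      using i by (simp add: A_def scalar_prod_def)
    also have "\<dots> = (\<Sum>u\<in>W. C (f i) u * u)"
      using sum.reindex_bij_betw[OF f] .
    also have "\<dots> = x * f i" using C(2)[OF fW[OF i]] by simp
    finally show "(A *\<^sub>v vec n f) $ i = (x \<cdot>\<^sub>v vec n f) $ i" using i by simp
  qed (simp add: A_def)
  moreover have "vec n f \<noteq> 0\<^sub>v n"
  proof
    assume h: "vec n f = 0\<^sub>v n"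
    obtain i where "i < n" "f i = w0" using f W(2) by (auto simp: bij_betw_def)
    then show False using W(3) h by (metis index_vec index_zero_vec(1))
  qed
  ultimately have "eigenvalue A x"
    using A(1) by (auto simp: eigenvalue_def eigenvector_def intro!: exI[of _ "vec n f"])
  then have "poly (char_poly A) x = 0" using eigenvalue_root_char_poly[OF A(1)] by simp
  then show ?thesis
    unfolding ring_of_integers_def
    using degree_monic_char_poly[OF A(1)] char_poly_coeff_mem_Z[OF A] by auto
qed

text \<open>Products of low powers of \<open>x\<close> and \<open>y\<close> span a module stable
  under both, because the top powers reduce by the integral equations. The sum and the product of
  \<open>x\<close> and \<open>y\<close> then stabilise it too.\<close>

lemma ring_of_integers_common_module:
  assumes "x \<in> R" "y \<in> R"
  obtains W where "finite W" "1 \<in> W" "\<And>w. w \<in> W \<Longrightarrow> x * w \<in> Zspan W" "\<And>w. w \<in> W \<Longrightarrow> y * w \<in> Zspan W"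
proof -
  obtain n a where a: "x ^ n = (\<Sum>i<n. a i * x ^ i)" "\<And>i. a i \<in> Z"
    using ring_of_integersE[OF assms(1)] by metis
  obtain m b where b: "y ^ m = (\<Sum>i<m. b i * y ^ i)" "\<And>i. b i \<in> Z"
    using ring_of_integersE[OF assms(2)] by metis
  \<comment> \<open>For \<open>n = 0\<close> the equation would read 1 = 0.\<close>
  have "n \<noteq> 0" using a(1) by (intro notI) simp
  have "m \<noteq> 0" using b(1) by (intro notI) simp
  define W where "W = (\<lambda>(i, j). x ^ i * y ^ j) ` ({..<n} \<times> {..<m})"
  have fin: "finite W" by (simp add: W_def)
  have W: "x ^ i * y ^ j \<in> Zspan W" if "i < n" "j < m" for i j
    using that by (intro Zspan_base[OF fin]) (auto simp: W_def)
  show thesis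
  proof (rule that[OF fin])
    show "1 \<in> W" using \<open>n \<noteq> 0\<close> \<open>m \<noteq> 0\<close> by (force simp: W_def)
    fix w assume "w \<in> W"
    then obtain i j where ij: "i < n" "j < m" "w = x ^ i * y ^ j" by (auto simp: W_def)
    show "x * w \<in> Zspan W"
    proof (cases "Suc i < n")
      case True
      then show ?thesis using W[OF True ij(2)] ij(3) by (simp add: mult.assoc)
    next
      case False
      then have "Suc i = n" using ij by simp
      then have "x * w = x ^ n * y ^ j" using ij(3) by (auto simp: mult.assoc)
      also have "\<dots> = (\<Sum>i<n. a i * (x ^ i * y ^ j))" by (simp add: a(1) sum_distrib_right mult.assoc)
      also have "\<dots> \<in> Zspan W" by (rule Zspan_sum, rule Zspan_mult) (use ij(2) a(2) W in auto)
      finally show ?thesis .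
    qed
    show "y * w \<in> Zspan W"
    proof (cases "Suc j < m")
      case True
      then show ?thesis using W[OF ij(1) True] ij(3) by (simp add: mult.left_commute)
    next
      case False
      then have "Suc j = m" using ij by simp
      then have "y * w = y ^ m * x ^ i" using ij(3) by (auto simp: mult_ac)
      also have "\<dots> = (\<Sum>j<m. b j * (x ^ i * y ^ j))"
        unfolding b(1) sum_distrib_right by (rule sum.cong) (auto simp: mult_ac)
      also have "\<dots> \<in> Zspan W" by (rule Zspan_sum, rule Zspan_mult) (use ij(1) b(2) W in auto)
      finally show ?thesis .
    qed
  qed
qed

lemma R_add: assumes "x \<in> R" "y \<in> R" shows "x + y \<in> R"
proof -
  obtain W where W: "finite W" "1 \<in> W" "\<And>w. w \<in> W \<Longrightarrow> x * w \<in> Zspan W" "\<And>w. w \<in> W \<Longrightarrow> y * w \<in> Zspan W"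
    using ring_of_integers_common_module[OF assms] by metis
  show ?thesis
    by (rule ring_of_integers_if_stable[OF W(1,2)]) (auto simp: distrib_right intro!: Zspan_add W)
qed

lemma R_mult: assumes "x \<in> R" "y \<in> R" shows "x * y \<in> R"
proof -
  obtain W where W: "finite W" "1 \<in> W" "\<And>w. w \<in> W \<Longrightarrow> x * w \<in> Zspan W" "\<And>w. w \<in> W \<Longrightarrow> y * w \<in> Zspan W"
    using ring_of_integers_common_module[OF assms] by metis
  show ?thesis
    by (rule ring_of_integers_if_stable[OF W(1,2)])
      (auto simp: mult.assoc intro!: Zspan_stable[OF W(3)] W(4))
qed

lemma Z_subset_R: "z \<in> Z \<Longrightarrow> z \<in> R"
  by (rule ring_of_integersI[of _ 1 "\<lambda>_. z"]) auto

lemma R_zero: "0 \<in> R" and R_one: "1 \<in> R" and R_of_nat: "of_nat n \<in> R"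
  using Z_subset_R Z_zero Z_one Z_of_nat by auto

lemma R_uminus: "x \<in> R \<Longrightarrow> - x \<in> R"
  using R_mult[of "- 1" x] Z_subset_R[OF Z_uminus[OF Z_one]] by simp

lemma R_diff: "x \<in> R \<Longrightarrow> y \<in> R \<Longrightarrow> x - y \<in> R"
  using R_add[of x "- y"] R_uminus by simp

lemma R_power: "x \<in> R \<Longrightarrow> x ^ i \<in> R"
  by (induction i) (auto intro: R_one R_mult)

lemma R_sum: "(\<And>i. i \<in> I \<Longrightarrow> f i \<in> R) \<Longrightarrow> (\<Sum>i\<in>I. f i) \<in> R"
  by (intro sum_mem_add_closed R_zero R_add)

lemma add_subgroup_R: "add_subgroup R"
  by (simp add: add_subgroup_def R_zero R_diff)

lemma add_subgroup_multiples: "add_subgroup ((*) c ` R)"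
  unfolding add_subgroup_def
proof (intro conjI ballI)
  show "0 \<in> (*) c ` R" using R_zero by (intro image_eqI[of _ _ 0]) auto
  fix x y assume "x \<in> (*) c ` R" "y \<in> (*) c ` R"
  then obtain r s where "r \<in> R" "s \<in> R" "x = c * r" "y = c * s" by auto
  then show "x - y \<in> (*) c ` R"
    by (intro image_eqI[of _ _ "r - s"]) (auto simp: right_diff_distrib R_diff)
qed

section \<open>Divisibility by \<open>p\<close> and finiteness modulo \<open>p\<close>\<close>

lemma of_nat_p_nonzero: "(of_nat p :: 'k) \<noteq> 0"
  using p_gt_1 by simp

text \<open>Multiplying an integral equation of 1/p by \<open>p ^ n\<close> leaves 1 on one side and
  a multiple of \<open>p\<close> in \<open>Z\<close> on the other, which has absolute value at most
  1/p.\<close>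

lemma inverse_p_notin_R: "inverse (of_nat p) \<notin> R"
proof
  let ?p = "of_nat p :: 'k"
  assume "inverse ?p \<in> R"
  then obtain n a where a: "inverse ?p ^ n = (\<Sum>i<n. a i * inverse ?p ^ i)" "\<And>i. a i \<in> Z"
    by (rule ring_of_integersE) blast
  have "1 = ?p ^ n * inverse ?p ^ n" using of_nat_p_nonzero by (simp flip: power_mult_distrib)
  also have "\<dots> = (\<Sum>i<n. a i * (?p ^ n * inverse ?p ^ i))"
    by (simp add: a(1) sum_distrib_left mult_ac)
  also have "\<dots> = (\<Sum>i<n. ?p * (a i * ?p ^ (n - Suc i)))"
  proof (rule sum.cong)
    fix i assume "i \<in> {..<n}"
    then have "?p ^ n = ?p * ?p ^ (n - Suc i) * ?p ^ i"
      by (simp flip: power_Suc power_add add: Suc_diff_Suc)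
    then have "?p ^ n * inverse ?p ^ i = ?p * ?p ^ (n - Suc i)"
      using of_nat_p_nonzero by (simp add: mult.assoc flip: power_mult_distrib)
    then show "a i * (?p ^ n * inverse ?p ^ i) = ?p * (a i * ?p ^ (n - Suc i))" by (simp add: mult_ac)
  qed simp
  also have "\<dots> = ?p * (\<Sum>i<n. a i * ?p ^ (n - Suc i))" by (simp add: sum_distrib_left)
  finally have one: "1 = ?p * (\<Sum>i<n. a i * ?p ^ (n - Suc i))" .
  have "(\<Sum>i<n. a i * ?p ^ (n - Suc i)) \<in> Z" by (intro Z_sum Z_mult a(2) Z_power Z_of_nat)
  then have "v (?p * (\<Sum>i<n. a i * ?p ^ (n - Suc i))) \<le> 1 / p * 1"
    using p_gt_1 by (subst abs_mult) (auto simp: of_nat_closed abs_p padic_integers_def intro: divide_right_mono)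
  then show False using one abs_one p_gt_1 by simp
qed

text \<open>Gaussian elimination, by induction on the spanning set. The family is indexed, with
  repetitions allowed, since it will consist of powers of one element, which may coincide.\<close>

lemma ex_linear_dependence:
  assumes "finite B" "finite I" "card B < card I"
    and "\<And>i. i \<in> I \<Longrightarrow> \<exists>c. (\<forall>b\<in>B. c b \<in> Q) \<and> x i = (\<Sum>b\<in>B. c b * b)"
  shows "\<exists>c. (\<forall>i\<in>I. c i \<in> Q) \<and> (\<exists>i\<in>I. c i \<noteq> 0) \<and> (\<Sum>i\<in>I. c i * x i) = 0"
  using assms
proof (induction B arbitrary: I x)
  case empty
  then obtain i where "i \<in> I" by fastforce
  then show ?case using empty by (intro exI[of _ "\<lambda>_. 1"]) (auto simp: one_closed)
next
  case (insert b B)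
  have "\<forall>i\<in>I. \<exists>c. (\<forall>u\<in>insert b B. c u \<in> Q) \<and> x i = (\<Sum>u\<in>insert b B. c u * u)"
    using insert.prems(3) by blast
  then obtain C where C: "\<And>i u. i \<in> I \<Longrightarrow> u \<in> insert b B \<Longrightarrow> C i u \<in> Q"
      "\<And>i. i \<in> I \<Longrightarrow> x i = (\<Sum>u\<in>insert b B. C i u * u)"
    by metis
  have x: "x i = C i b * b + (\<Sum>u\<in>B. C i u * u)" if "i \<in> I" for i
    using C(2)[OF that] insert.hyps by simp
  show ?case
  proof (cases "\<forall>i\<in>I. C i b = 0")
    case True
    then have "\<exists>c. (\<forall>u\<in>B. c u \<in> Q) \<and> x i = (\<Sum>u\<in>B. c u * u)" if "i \<in> I" for i
      using x[OF that] C(1)[OF that] that by auto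
    then show ?thesis using insert by (intro insert.IH) auto
  next
    case False
    then obtain k where k: "k \<in> I" "C k b \<noteq> 0" by auto
    \<comment> \<open>With \<open>k\<close> as pivot, subtracting \<open>t i * x k\<close> from
      \<open>x i\<close> removes the coordinate at \<open>b\<close>.\<close>
    define t where "t i = C i b / C k b" for i
    have t: "t i \<in> Q" if "i \<in> I" for i
      using C(1) k that by (auto simp: t_def divide_inverse intro: mult_closed inverse_closed)
    have "\<exists>c. (\<forall>u\<in>B. c u \<in> Q) \<and> x i - t i * x k = (\<Sum>u\<in>B. c u * u)" if "i \<in> I - {k}" for i
    proof (intro exI conjI ballI)
      show "C i u - t i * C k u \<in> Q" if "u \<in> B" for u
        using C(1)[of i u] C(1)[of k u] t[of i] k that \<open>i \<in> I - {k}\<close>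
        by (intro diff_closed mult_closed) auto
      show "x i - t i * x k = (\<Sum>u\<in>B. (C i u - t i * C k u) * u)"
        using that k x[of i] x[of k]
        by (simp add: t_def algebra_simps sum_subtractf sum_distrib_left)
    qed
    then have "\<exists>c. (\<forall>i\<in>I - {k}. c i \<in> Q) \<and> (\<exists>i\<in>I - {k}. c i \<noteq> 0) \<and>
        (\<Sum>i\<in>I - {k}. c i * (x i - t i * x k)) = 0"
      using insert.prems insert.hyps k by (intro insert.IH) auto
    then obtain c where c: "\<forall>i\<in>I - {k}. c i \<in> Q" "\<exists>i\<in>I - {k}. c i \<noteq> 0"
        "(\<Sum>i\<in>I - {k}. c i * (x i - t i * x k)) = 0"
      by blast
    \<comment> \<open>The coefficient of \<open>x k\<close> gathers the multiples subtracted from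
      the other elements, so a dependence of the reduced family becomes one of
      \<open>x\<close>.\<close>
    define d where "d = c(k := - (\<Sum>i\<in>I - {k}. c i * t i))"
    have "(\<Sum>i\<in>I. d i * x i) = d k * x k + (\<Sum>i\<in>I - {k}. d i * x i)"
      using k insert.prems by (simp add: sum.remove)
    also have "(\<Sum>i\<in>I - {k}. d i * x i) = (\<Sum>i\<in>I - {k}. c i * x i)"
      by (rule sum.cong) (auto simp: d_def)
    also have "d k * x k + \<dots> = (\<Sum>i\<in>I - {k}. c i * (x i - t i * x k))"
      by (simp add: d_def algebra_simps sum_subtractf sum_distrib_left)
    finally have "(\<Sum>i\<in>I. d i * x i) = 0" using c(3) by simp
    moreover have "\<forall>i\<in>I. d i \<in> Q"
      using c(1) t by (auto simp: d_def intro!: uminus_closed sum_closed mult_closed)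
    moreover have "\<exists>i\<in>I. d i \<noteq> 0" using c(2) by (auto simp: d_def)
    ultimately show ?thesis by blast
  qed
qed

lemma ex_spanning_set:
  obtains B where "finite B" "\<forall>x. \<exists>c. (\<forall>b\<in>B. c b \<in> Q) \<and> x = (\<Sum>b\<in>B. c b * b)"
  using finite_ext by (auto simp: finite_extension_def)

lemma ex_common_p_power:
  fixes n :: nat
  assumes "\<And>i. i < n \<Longrightarrow> d i \<in> Q"
  shows "\<exists>a. \<forall>i<n. of_nat p ^ a * d i \<in> Z"
  using assms
proof (induction n)
  case (Suc n)
  then obtain a where a: "\<forall>i<n. of_nat p ^ a * d i \<in> Z" by force
  obtain b where b: "of_nat p ^ b * d n \<in> Z"
    using ex_p_power_mult_mem_Z[OF Suc.prems[of n]] by auto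
  have "of_nat p ^ (a + b) * d i \<in> Z" if "i < Suc n" for i
  proof (cases "i = n")
    case True
    have "of_nat p ^ a * (of_nat p ^ b * d n) \<in> Z" by (rule Z_mult[OF Z_power[OF Z_of_nat] b])
    then show ?thesis using True by (simp add: power_add mult.assoc)
  next
    case False
    have "of_nat p ^ b * (of_nat p ^ a * d i) \<in> Z"
      by (rule Z_mult[OF Z_power[OF Z_of_nat]]) (use a that False in auto)
    then show ?thesis by (simp add: power_add mult_ac)
  qed
  then show ?case by blast
qed simp

text \<open>The powers of \<open>x\<close> up to \<open>card B\<close> are dependent over
  \<open>Q\<close>, which yields a monic equation over \<open>Q\<close>. If \<open>p ^ a\<close>
  clears the denominators of its coefficients, then \<open>p ^ a * x\<close> is integral.\<close>

lemma ex_p_power_mult_mem_R: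
  obtains a where "of_nat p ^ a * x \<in> R"
proof -
  obtain B where B: "finite B" "\<forall>x. \<exists>c. (\<forall>b\<in>B. c b \<in> Q) \<and> x = (\<Sum>b\<in>B. c b * b)"
    by (rule ex_spanning_set)
  obtain c where c: "\<forall>i\<in>{..card B}. c i \<in> Q" "\<exists>i\<in>{..card B}. c i \<noteq> 0"
      "(\<Sum>i\<in>{..card B}. c i * x ^ i) = 0"
    using ex_linear_dependence[OF B(1), of "{..card B}" "\<lambda>i. x ^ i"] B(2) by auto
  define n where "n = Max {i. i \<le> card B \<and> c i \<noteq> 0}"
  have fin: "finite {i. i \<le> card B \<and> c i \<noteq> 0}" by simp
  have "n \<in> {i. i \<le> card B \<and> c i \<noteq> 0}"
    unfolding n_def using c(2) by (intro Max_in fin) auto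
  then have n: "n \<le> card B" "c n \<noteq> 0" by auto
  have above: "c i = 0" if "n < i" "i \<le> card B" for i
  proof (rule ccontr)
    assume "c i \<noteq> 0"
    then have "i \<le> n" unfolding n_def using that(2) by (intro Max_ge fin) simp
    then show False using that(1) by simp
  qed
  have "(\<Sum>i\<in>{..card B}. c i * x ^ i) = (\<Sum>i\<in>{..n}. c i * x ^ i)"
    using n above by (intro sum.mono_neutral_right) auto
  also have "\<dots> = (\<Sum>i<n. c i * x ^ i) + c n * x ^ n"
    by (simp flip: lessThan_Suc_atMost)
  finally have "c n * x ^ n = - (\<Sum>i<n. c i * x ^ i)"
    using c(3) by (simp add: add_eq_0_iff add.commute)
  then have "x ^ n = - (\<Sum>i<n. c i * x ^ i) / c n" using n(2) by (simp add: field_simps)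
  then have xn: "x ^ n = (\<Sum>i<n. - c i / c n * x ^ i)"
    by (simp add: sum_divide_distrib sum_negf)
  have "- c i / c n \<in> Q" if "i < n" for i
    using c(1) n that by (auto simp: divide_inverse intro!: uminus_closed mult_closed inverse_closed)
  then obtain a where a: "\<forall>i<n. of_nat p ^ a * (- c i / c n) \<in> Z"
    using ex_common_p_power[of n "\<lambda>i. - c i / c n"] by auto
  let ?q = "of_nat p ^ a :: 'k"
  \<comment> \<open>Scaling \<open>x\<close> by \<open>p ^ a\<close> multiplies the coefficient at
    \<open>i\<close> by the (n - i)-th power of \<open>p ^ a\<close>; one factor clears the
    denominator and the others stay in \<open>Z\<close>.\<close>
  have "(?q * x) ^ n = (\<Sum>i<n. ?q ^ (n - Suc i) * (?q * (- c i / c n)) * (?q * x) ^ i)"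
    unfolding power_mult_distrib xn sum_distrib_left
  proof (rule sum.cong)
    fix i assume "i \<in> {..<n}"
    then have "?q ^ n = ?q ^ (n - Suc i) * ?q * ?q ^ i"
      by (simp flip: power_Suc2 power_add add: Suc_diff_Suc)
    then show "?q ^ n * (- c i / c n * x ^ i) = ?q ^ (n - Suc i) * (?q * (- c i / c n)) * (?q ^ i * x ^ i)"
      by (simp only: mult_ac)
  qed simp
  moreover have "?q ^ (n - Suc i) * (?q * (- c i / c n)) \<in> Z" if "i < n" for i
    by (rule Z_mult[OF Z_power[OF Z_power[OF Z_of_nat]]]) (use a that in blast)
  ultimately have "?q * x \<in> R" by (rule ring_of_integersI)
  then show thesis by (rule that)
qed

text \<open>For nonzero \<open>x\<close> some \<open>p ^ a / x\<close> is integral, and divisibility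
  of \<open>x\<close> by the next power \<open>p ^ Suc a\<close> would make 1/p integral.\<close>

lemma p_divisible_imp_zero:
  assumes "\<And>j. x \<in> (*) (of_nat p ^ j) ` R"
  shows "x = 0"
proof (rule ccontr)
  assume x: "x \<noteq> 0"
  obtain a where a: "of_nat p ^ a * inverse x \<in> R" using ex_p_power_mult_mem_R .
  obtain r where r: "r \<in> R" "x = of_nat p ^ Suc a * r" using assms[of "Suc a"] by blast
  have "of_nat p * (r * (of_nat p ^ a * inverse x)) = x * inverse x" by (simp add: r(2) mult_ac)
  then have "of_nat p * (r * (of_nat p ^ a * inverse x)) = 1" using x by simp
  then have "inverse (of_nat p) = r * (of_nat p ^ a * inverse x)"
    by (rule inverse_unique)
  then show False using R_mult[OF r(1) a] inverse_p_notin_R by simp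
qed

text \<open>Linear independence of the residue classes in \<open>R\<close> modulo \<open>p\<close>
  over the field with \<open>p\<close> elements: a coefficient in \<open>Z\<close> vanishes modulo
  \<open>p\<close> exactly if its absolute value is less than 1.\<close>

definition independent_mod_p :: "nat \<Rightarrow> (nat \<Rightarrow> 'k) \<Rightarrow> bool" where
  "independent_mod_p r x \<longleftrightarrow> (\<forall>i<r. x i \<in> R) \<and>
    (\<forall>c. (\<forall>i<r. c i \<in> Z) \<longrightarrow> (\<Sum>i<r. c i * x i) \<in> (*) (of_nat p) ` R \<longrightarrow> (\<forall>i<r. v (c i) < 1))"

lemma independent_mod_pD:
  assumes "independent_mod_p r x" "\<forall>i<r. c i \<in> Z" "(\<Sum>i<r. c i * x i) \<in> (*) (of_nat p) ` R" "i < r"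
  shows "v (c i) < 1"
  using assms by (simp add: independent_mod_p_def)

text \<open>
  A linear dependence over \<open>Q\<close> can be divided by a coefficient of largest absolute value; it then
  contradicts independence modulo \<open>p\<close>.
\<close>

lemma independent_mod_p_bound:
  assumes "finite B" "\<forall>x. \<exists>c. (\<forall>b\<in>B. c b \<in> Q) \<and> x = (\<Sum>b\<in>B. c b * b)"
    and ind: "independent_mod_p r x"
  shows "r \<le> card B"
proof (rule ccontr)
  assume "\<not> r \<le> card B"
  then obtain c where c: "\<forall>i\<in>{..<r}. c i \<in> Q" "\<exists>i\<in>{..<r}. c i \<noteq> 0"
      "(\<Sum>i\<in>{..<r}. c i * x i) = 0"
    using ex_linear_dependence[OF assms(1), of "{..<r}" x] assms(2) by auto
  then have "{..<r} \<noteq> {}" by auto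
  then have "Max ((\<lambda>i. v (c i)) ` {..<r}) \<in> (\<lambda>i. v (c i)) ` {..<r}" by (intro Max_in) auto
  then obtain k where k: "k < r" "v (c k) = Max ((\<lambda>i. v (c i)) ` {..<r})" by auto
  have max: "v (c i) \<le> v (c k)" if "i < r" for i
    unfolding k(2) using that by (intro Max_ge) auto
  obtain l where l: "l < r" "c l \<noteq> 0" using c(2) by auto
  then have "0 < v (c l)" using c(1) abs_nonneg[of "c l"] abs_eq_0_iff[of "c l"] by force
  then have vk: "0 < v (c k)" using max[OF l(1)] by simp
  then have ck: "c k \<noteq> 0" by (auto simp: abs_zero)
  have "\<forall>i<r. c i / c k \<in> Z"
    using c(1) k(1) max vk
    by (auto simp: padic_integers_def abs_divide divide_inverse mult_closed inverse_closed)
      (simp add: abs_divide abs_mult abs_inverse inverse_closed field_simps)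
  moreover have "(\<Sum>i<r. c i / c k * x i) = 0"
    using c(3) by (simp flip: sum_divide_distrib)
  then have "(\<Sum>i<r. c i / c k * x i) \<in> (*) (of_nat p) ` R"
    using add_subgroup_zero[OF add_subgroup_multiples] by simp
  ultimately have "v (c k / c k) < 1"
    using independent_mod_pD[OF ind, of "\<lambda>i. c i / c k" k] k(1) by blast
  then show False using ck abs_one by simp
qed

text \<open>Independent families have bounded length, so a longest one exists, and it spans
  \<open>R\<close> modulo \<open>p\<close>. The finitely many combinations with coefficients below
  \<open>p\<close> then meet every class.\<close>

lemma finite_R_mod_p: "finite (cosets R ((*) (of_nat p) ` R))"
proof -
  let ?pR = "(*) (of_nat p) ` R"
  obtain B where B: "finite B" "\<forall>x. \<exists>c. (\<forall>b\<in>B. c b \<in> Q) \<and> x = (\<Sum>b\<in>B. c b * b)"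
    by (rule ex_spanning_set)
  have "\<exists>x. independent_mod_p 0 x" by (simp add: independent_mod_p_def)
  then obtain r where r: "\<exists>x. independent_mod_p r x" "\<And>s. \<exists>x. independent_mod_p s x \<Longrightarrow> s \<le> r"
    using ex_has_greatest_nat[of "\<lambda>r. \<exists>x. independent_mod_p r x" 0 "\<lambda>r. r" "card B + 1"]
      independent_mod_p_bound[OF B] by (metis Suc_eq_plus1 le_imp_less_Suc less_imp_le)
  then obtain x where x: "independent_mod_p r x" by blast
  then have xR: "x i \<in> R" if "i < r" for i using that by (simp add: independent_mod_p_def)
  have comb_R: "(\<Sum>i<r. c i * x i) \<in> R" if "\<And>i. i < r \<Longrightarrow> c i \<in> Z" for c
    using that by (intro R_sum R_mult Z_subset_R xR) auto
  have span: "\<exists>d. (\<forall>i<r. d i \<in> Z) \<and> y - (\<Sum>i<r. d i * x i) \<in> ?pR" if y: "y \<in> R" for y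
  proof -
    have "\<not> independent_mod_p (Suc r) (x(r := y))" using r(2) by fastforce
    then obtain c where c: "\<forall>i<Suc r. c i \<in> Z" "(\<Sum>i<Suc r. c i * (x(r := y)) i) \<in> ?pR"
        "\<not> (\<forall>i<Suc r. v (c i) < 1)"
      unfolding independent_mod_p_def using xR y by (auto simp: less_Suc_eq)
    have sum: "(\<Sum>i<r. c i * x i) + c r * y \<in> ?pR" using c(2) by simp
    \<comment> \<open>The coefficient of \<open>y\<close> is a unit: otherwise its term is divisible
      by \<open>p\<close>, and the relation would be one among the independent
      \<open>x i\<close>.\<close>
    have "\<not> v (c r) < 1"
    proof
      assume less: "v (c r) < 1"
      then have "c r / of_nat p \<in> Z" using c(1) Z_subset_Q by (intro abs_less_1_divide_p) auto
      then have "of_nat p * (c r / of_nat p * y) \<in> ?pR"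
        using y by (intro imageI R_mult[OF Z_subset_R])
      then have "c r * y \<in> ?pR" using of_nat_p_nonzero by simp
      then have "(\<Sum>i<r. c i * x i) \<in> ?pR"
        using add_subgroup_diff[OF add_subgroup_multiples sum] by force
      then have "\<forall>i<r. v (c i) < 1" using independent_mod_pD[OF x, of c] c(1) by auto
      then show False using c(3) less by (auto simp: less_Suc_eq)
    qed
    then have "v (c r) = 1" using c(1) by (auto simp: padic_integers_def)
    then have inv: "inverse (c r) \<in> Z" "c r \<noteq> 0" using c(1) by (auto intro: Z_inverse simp: abs_zero)
    obtain s where s: "s \<in> R" "(\<Sum>i<r. c i * x i) + c r * y = of_nat p * s" using sum by auto
    have "inverse (c r) * ((\<Sum>i<r. c i * x i) + c r * y) = of_nat p * (inverse (c r) * s)"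
      by (simp add: s(2))
    then have "y - (\<Sum>i<r. - (inverse (c r) * c i) * x i) = of_nat p * (inverse (c r) * s)"
      using inv(2) by (simp add: distrib_left sum_distrib_left sum_negf mult.assoc add.commute flip: mult.assoc[of _ "c r"])
    moreover have "of_nat p * (inverse (c r) * s) \<in> ?pR"
      using inv(1) s(1) by (intro imageI R_mult[OF Z_subset_R])
    ultimately show ?thesis
      using inv(1) c(1) by (intro exI[of _ "\<lambda>i. - (inverse (c r) * c i)"]) (auto intro!: Z_uminus Z_mult)
  qed
  define T where "T = (\<lambda>e. \<Sum>i<r. of_nat (e i) * x i) ` (PiE {..<r} (\<lambda>_. {..<p}))"
  show ?thesis
  proof (rule finite_cosets_if_covered[OF add_subgroup_multiples])
    show "finite T" by (simp add: T_def finite_PiE)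
    show "T \<subseteq> R" using comb_R Z_of_nat by (auto simp: T_def)
    fix y assume "y \<in> R"
    then obtain d where d: "\<forall>i<r. d i \<in> Z" "y - (\<Sum>i<r. d i * x i) \<in> ?pR" using span by blast
    have "\<forall>i<r. \<exists>e. e < p \<and> (d i - of_nat e) / of_nat p \<in> Z" using d(1) residue_mod_p by metis
    then obtain e where e: "\<And>i. i < r \<Longrightarrow> e i < p \<and> (d i - of_nat (e i)) / of_nat p \<in> Z" by metis
    \<comment> \<open>Members of \<open>PiE\<close> must be \<open>undefined\<close> outside the
      index set.\<close>
    define e' where "e' = restrict e {..<r}"
    have "of_nat p * (\<Sum>i<r. (d i - of_nat (e i)) / of_nat p * x i) \<in> ?pR"
      using e by (intro imageI comb_R) auto
    also have "of_nat p * (\<Sum>i<r. (d i - of_nat (e i)) / of_nat p * x i)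
        = (\<Sum>i<r. d i * x i) - (\<Sum>i<r. of_nat (e' i) * x i)"
      using of_nat_p_nonzero
      by (simp add: sum_distrib_left left_diff_distrib sum_subtractf e'_def)
    finally have "(\<Sum>i<r. d i * x i) - (\<Sum>i<r. of_nat (e' i) * x i) \<in> ?pR" .
    from add_subgroup_add[OF add_subgroup_multiples d(2) this]
    have "y - (\<Sum>i<r. of_nat (e' i) * x i) \<in> ?pR" by simp
    moreover have "(\<Sum>i<r. of_nat (e' i) * x i) \<in> T"
      unfolding T_def e'_def
      by (rule imageI, rule restrict_PiE_iff[THEN iffD2], rule ballI) (use e in auto)
    ultimately show "\<exists>t\<in>T. y - t \<in> ?pR" by blast
  qed
qed

end

section \<open>Powers of the uniformizer\<close>

locale padic_uniformizer = padic_extension p Q v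
  for p :: nat and Q :: "'k::field_char_0 set" and v :: "'k \<Rightarrow> real" +
  fixes \<pi> :: 'k
  assumes uniformizer: "uniformizer R \<pi>"
begin

lemma pi_in_R: "\<pi> \<in> R"
  using uniformizer by (simp add: uniformizer_def)

lemma maximal_ideal_eq: "maximal_ideal R = (*) \<pi> ` R"
  using uniformizer by (simp add: uniformizer_def)

lemma one_notin_pi_R: "1 \<notin> (*) \<pi> ` R"
  unfolding maximal_ideal_eq[symmetric] by (auto simp: maximal_ideal_def R_one intro!: bexI[of _ 1])

lemma p_in_pi_R: "of_nat p \<in> (*) \<pi> ` R"
proof -
  have "of_nat p * y \<noteq> 1" if "y \<in> R" for y
    using that inverse_unique[of "of_nat p" y] inverse_p_notin_R by auto
  then show ?thesis
    unfolding maximal_ideal_eq[symmetric] by (auto simp: maximal_ideal_def R_of_nat)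
qed

lemma pi_nonzero: "\<pi> \<noteq> 0"
  using p_in_pi_R of_nat_p_nonzero by auto

lemma multiples_power_mono: "c \<in> R \<Longrightarrow> i \<le> j \<Longrightarrow> (*) (c ^ j) ` R \<subseteq> (*) (c ^ i) ` R"
proof
  fix x assume c: "c \<in> R" and ij: "i \<le> j" and "x \<in> (*) (c ^ j) ` R"
  then obtain r where r: "r \<in> R" "x = c ^ j * r" by auto
  have "x = c ^ i * (c ^ (j - i) * r)" using ij by (simp add: r(2) flip: mult.assoc power_add)
  then show "x \<in> (*) (c ^ i) ` R" using c r(1) by (blast intro: R_mult R_power)
qed

text \<open>Two powers of \<open>\<pi>\<close> agree modulo \<open>p\<close>, and \<open>1 - \<pi> ^ d\<close> is a unit for \<open>d > 0\<close>.\<close>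

lemma ex_pi_power_in_p_R:
  obtains e where "e > 0" "\<pi> ^ e \<in> (*) (of_nat p) ` R"
proof -
  let ?pR = "(*) (of_nat p) ` R"
  obtain T where T: "transversal R ?pR T" using ex_transversal[OF add_subgroup_multiples] .
  have "finite T"
    using card_cosets_transversal(2)[OF add_subgroup_multiples T] finite_R_mod_p by simp
  have "\<forall>j. \<exists>t\<in>T. \<pi> ^ j - t \<in> ?pR"
    using transversal_ex[OF T] R_power[OF pi_in_R] by metis
  then obtain t where t: "\<And>j. t j \<in> T" "\<And>j. \<pi> ^ j - t j \<in> ?pR" by metis
  have "range t \<subseteq> T" using t(1) by auto
  then have "finite (range t)" using \<open>finite T\<close> finite_subset by blast
  then have "\<not> inj t" using finite_imageD infinite_UNIV_nat by blast
  then obtain i j where ij: "i < j" "t i = t j" by (metis injI linorder_neqE_nat)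
  have "(\<pi> ^ i - t i) - (\<pi> ^ j - t j) \<in> ?pR"
    by (rule add_subgroup_diff[OF add_subgroup_multiples t(2) t(2)])
  moreover have "\<pi> ^ j = \<pi> ^ i * \<pi> ^ (j - i)" using ij(1) by (simp flip: power_add)
  ultimately have "\<pi> ^ i * (1 - \<pi> ^ (j - i)) \<in> ?pR" using ij(2) by (simp add: right_diff_distrib)
  then obtain s where s: "s \<in> R" "\<pi> ^ i * (1 - \<pi> ^ (j - i)) = of_nat p * s" by auto
  have d: "\<pi> ^ (j - i) \<in> (*) \<pi> ` R"
    using multiples_power_mono[OF pi_in_R, of 1 "j - i"] ij(1) R_one by force
  have "1 - \<pi> ^ (j - i) \<notin> (*) \<pi> ` R"
    using add_subgroup_add[OF add_subgroup_multiples _ d, of "1 - \<pi> ^ (j - i)"] one_notin_pi_R by auto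
  then obtain u where u: "u \<in> R" "(1 - \<pi> ^ (j - i)) * u = 1"
    unfolding maximal_ideal_eq[symmetric]
    by (auto simp: maximal_ideal_def R_diff R_one R_power pi_in_R)
  \<comment> \<open>Cancelling the unit \<open>1 - \<pi> ^ (j - i)\<close> shows
    \<open>\<pi> ^ i\<close> to be divisible by \<open>p\<close>; one more factor
    \<open>\<pi>\<close> makes the exponent visibly positive.\<close>
  have "\<pi> ^ Suc i = \<pi> * (\<pi> ^ i * ((1 - \<pi> ^ (j - i)) * u))" using u by simp
  also have "\<dots> = of_nat p * (\<pi> * (s * u))" using s(2) by (metis mult.assoc mult.left_commute)
  finally have "\<pi> ^ Suc i \<in> ?pR" using s(1) u(1) pi_in_R by (blast intro: R_mult)
  then show thesis using that by blast
qed

lemma multiples_power_subset: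
  assumes "c \<in> (*) d ` R" shows "(*) (c ^ j) ` R \<subseteq> (*) (d ^ j) ` R"
proof
  fix x assume "x \<in> (*) (c ^ j) ` R"
  then obtain r s where "r \<in> R" "x = c ^ j * r" "s \<in> R" "c = d * s" using assms by auto
  then have "x = d ^ j * (s ^ j * r)" "s ^ j * r \<in> R"
    by (auto simp: power_mult_distrib mult.assoc intro: R_mult R_power)
  then show "x \<in> (*) (d ^ j) ` R" by blast
qed

text \<open>The exponents are multiples of \<open>k\<close> because a conjugation will be iterated.
  Some power of \<open>\<pi>\<close> is divisible by \<open>p\<close>, which reduces the claim to
  divisibility by all powers of \<open>p\<close>.\<close>

lemma pi_divisible_imp_zero:
  assumes "k > 0" "\<And>j. x \<in> (*) (\<pi> ^ (k * j)) ` R"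
  shows "x = 0"
proof (rule p_divisible_imp_zero)
  fix j
  obtain e where e: "e > 0" "\<pi> ^ e \<in> (*) (of_nat p) ` R" using ex_pi_power_in_p_R .
  have "e * j \<le> k * (e * j)" using assms(1) by simp
  then have "x \<in> (*) (\<pi> ^ (e * j)) ` R"
    using assms(2)[of "e * j"] multiples_power_mono[OF pi_in_R] by blast
  then show "x \<in> (*) (of_nat p ^ j) ` R"
    using multiples_power_subset[OF e(2), of j] by (auto simp: power_mult)
qed

lemma residue_field_eq: "residue_field R = cosets R ((*) \<pi> ` R)"
  by (simp add: residue_field_def cosets_def maximal_ideal_eq)

lemma multiples_subset_R: "c \<in> R \<Longrightarrow> (*) c ` R \<subseteq> R"
  by (auto intro: R_mult)

lemma multiples_p_subset: "(*) (of_nat p) ` R \<subseteq> (*) \<pi> ` R"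
  using multiples_power_subset[OF p_in_pi_R, of 1] by simp

lemma finite_R_mod_pi: "finite (cosets R ((*) \<pi> ` R))"
  by (rule cosets_tower(3)[OF add_subgroup_R add_subgroup_multiples add_subgroup_multiples
        multiples_p_subset multiples_subset_R[OF pi_in_R] finite_R_mod_p])

text \<open>Multiplication by \<open>\<pi> ^ j\<close> carries \<open>R\<close> modulo
  \<open>\<pi>\<close> to the j-th layer of the filtration by powers of \<open>\<pi>\<close>, so
  every layer has the size of the residue field.\<close>

lemma card_R_mod_pi_power:
  "card (cosets R ((*) (\<pi> ^ j) ` R)) = card (residue_field R) ^ j"
  "finite (cosets R ((*) (\<pi> ^ j) ` R))"
proof (induction j)
  case 0
  have T: "transversal R R {0}"
    using R_zero by (auto simp: transversal_def)
  {
    case 1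
    show ?case using card_cosets_transversal(1)[OF add_subgroup_R T] by simp
  next
    case 2
    show ?case using card_cosets_transversal(2)[OF add_subgroup_R T] by simp
  }
next
  case (Suc j)
  let ?B = "(*) (\<pi> ^ j) ` R" and ?C = "(*) (\<pi> ^ Suc j) ` R"
  have inj: "inj ((*) (\<pi> ^ j))" using pi_nonzero by (auto simp: inj_on_def)
  have C: "?C = (*) (\<pi> ^ j) ` ((*) \<pi> ` R)" by (auto simp: image_image mult_ac)
  have BC: "card (cosets ?B ?C) = card (residue_field R)" "finite (cosets ?B ?C)"
    using cosets_image_additive(1,2)[OF inj right_diff_distrib add_subgroup_multiples[of \<pi>], of R] finite_R_mod_pi
    by (simp_all only: C residue_field_eq)
  have sub: "?C \<subseteq> ?B" "?B \<subseteq> R"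
    using multiples_power_mono[OF pi_in_R, of j "Suc j"] multiples_subset_R[OF R_power[OF pi_in_R]] by auto
  note tower = cosets_tower[OF add_subgroup_R add_subgroup_multiples add_subgroup_multiples sub]
  {
    case 1
    show ?case using tower(1) Suc BC by simp
  next
    case 2
    show ?case using tower(2) Suc BC by simp
  }
qed

end

section \<open>Indices of groups of matrices\<close>

lemma finite_cosets_subset:
  assumes "finite (cosets A C)" "B \<subseteq> A"
  shows "finite (cosets B C)"
proof (rule finite_subset)
  show "cosets B C \<subseteq> (\<lambda>X. X \<inter> B) ` cosets A C"
  proof
    fix X assume "X \<in> cosets B C"
    then obtain x where x: "x \<in> B" "X = {y \<in> B. x - y \<in> C}" by (auto simp: cosets_def quotient_def)
    have "{y \<in> A. x - y \<in> C} \<in> cosets A C"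
      using x(1) assms(2) by (auto simp: cosets_def quotient_def)
    then show "X \<in> (\<lambda>X. X \<inter> B) ` cosets A C"
      using x assms(2) by (intro image_eqI[of _ _ "{y \<in> A. x - y \<in> C}"]) auto
  qed
qed (use assms(1) in simp)

text \<open>The witness sends \<open>x\<close> to its coset, as a set. It serves as quotient map
  when cosets are counted coordinate by coordinate.\<close>

lemma ex_coset_invariant:
  assumes "add_subgroup (B :: 'a::ab_group_add set)"
  obtains g :: "'a::ab_group_add \<Rightarrow> 'a set" where "\<And>x y. x \<in> A \<Longrightarrow> y \<in> A \<Longrightarrow> g x = g y \<longleftrightarrow> x - y \<in> B"
proof (rule that[of "\<lambda>x. {z. x - z \<in> B}"])
  fix x y
  have iff: "x - z \<in> B \<longleftrightarrow> y - z \<in> B" if "x - y \<in> B" for z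
    using add_subgroup_add[OF assms that, of "y - z"]
      add_subgroup_diff[OF assms _ that, of "x - z"] by (simp, argo)
  have "y - y \<in> B" using add_subgroup_zero[OF assms] by simp
  then show "{z. x - z \<in> B} = {z. y - z \<in> B} \<longleftrightarrow> x - y \<in> B"
    using iff by (auto simp: set_eq_iff)
qed

section \<open>Matrix groups as groups of functions\<close>

definition mat_subgroup :: "nat \<Rightarrow> 'k::field mat set \<Rightarrow> bool" where
  "mat_subgroup n M \<longleftrightarrow>
    M \<subseteq> carrier_mat n n \<and> 0\<^sub>m n n \<in> M \<and> (\<forall>x\<in>M. \<forall>y\<in>M. x - y \<in> M)"

text \<open>
  Matrices do not form an additive group as a type; their entries, as functions, do, which gives
  access to the results on indices of additive subgroups.
\<close>

definition entries :: "nat \<Rightarrow> 'k::zero mat \<Rightarrow> nat \<times> nat \<Rightarrow> 'k" where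
  "entries n x = (\<lambda>(i, j). if i < n \<and> j < n then x $$ (i, j) else 0)"

lemma entries_eq_iff:
  assumes "x \<in> carrier_mat n n" "y \<in> carrier_mat n n"
  shows "entries n x = entries n y \<longleftrightarrow> x = y"
proof
  assume h: "entries n x = entries n y"
  show "x = y"
  proof (rule eq_matI)
    fix i j assume "i < dim_row y" "j < dim_col y"
    then show "x $$ (i, j) = y $$ (i, j)"
      using assms fun_cong[OF h, of "(i, j)"] by (simp add: entries_def)
  qed (use assms in auto)
qed simp

lemma inj_on_entries: "A \<subseteq> carrier_mat n n \<Longrightarrow> inj_on (entries n) A"
  by (rule inj_onI) (metis entries_eq_iff subsetD)

lemma entries_diff:
  "x \<in> carrier_mat n n \<Longrightarrow> y \<in> carrier_mat n n \<Longrightarrow>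
    entries n (x - y) = entries n x - entries n (y :: 'k::field mat)"
  by (auto simp: entries_def fun_eq_iff)

lemma entries_zero: "entries n (0\<^sub>m n n) = (0 :: nat \<times> nat \<Rightarrow> 'k::field)"
  by (auto simp: entries_def fun_eq_iff)

lemma entries_smult:
  "x \<in> carrier_mat n n \<Longrightarrow> entries n (c \<cdot>\<^sub>m x) = (\<lambda>_. c) * entries n (x :: 'k::field mat)"
  by (auto simp: entries_def fun_eq_iff)

lemma add_subgroup_entries:
  assumes "mat_subgroup n M" shows "add_subgroup (entries n ` M)"
  unfolding add_subgroup_def
proof (intro conjI ballI)
  show "0 \<in> entries n ` M"
    using assms unfolding mat_subgroup_def by (metis entries_zero image_eqI)
  fix f g assume "f \<in> entries n ` M" "g \<in> entries n ` M"
  then obtain x y where xy: "x \<in> M" "y \<in> M" "f = entries n x" "g = entries n y" by auto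
  then have "f - g = entries n (x - y)" "x - y \<in> M"
    using assms by (auto simp: mat_subgroup_def subset_iff entries_diff)
  then show "f - g \<in> entries n ` M" by blast
qed

lemma diff_entries_mem_iff:
  assumes "mat_subgroup n M" "x \<in> carrier_mat n n" "y \<in> carrier_mat n n"
  shows "entries n x - entries n y \<in> entries n ` M \<longleftrightarrow> x - y \<in> M"
proof -
  have "M \<subseteq> carrier_mat n n" "x - y \<in> carrier_mat n n"
    using assms by (auto simp: mat_subgroup_def)
  then show ?thesis
    unfolding entries_diff[OF assms(2,3), symmetric]
    by (intro inj_on_image_mem_iff[OF inj_on_entries[OF subset_refl]])
qed

text \<open>One invariant \<open>g\<close> separates cosets on both sides, on matrices after
  composition with \<open>entries\<close>, so both counts are numbers of values of \<open>g\<close>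
  on the same set.\<close>

lemma cosets_in_entries:
  assumes "L \<subseteq> carrier_mat n n" "mat_subgroup n M"
  shows "add_index L M = card (cosets (entries n ` L) (entries n ` M))"
    and "finite (cosets_in L M) \<longleftrightarrow> finite (cosets (entries n ` L) (entries n ` M))"
proof -
  obtain g :: "(nat \<times> nat \<Rightarrow> 'a) \<Rightarrow> (nat \<times> nat \<Rightarrow> 'a) set"
    where g: "\<And>x y. x \<in> entries n ` L \<Longrightarrow> y \<in> entries n ` L \<Longrightarrow>
      g x = g y \<longleftrightarrow> x - y \<in> entries n ` M"
    by (rule ex_coset_invariant[OF add_subgroup_entries[OF assms(2)], of "entries n ` L"]) blast
  have 1: "(x, y) \<in> {(x, y). x \<in> entries n ` L \<and> y \<in> entries n ` L \<and> x - y \<in> entries n ` M}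
      \<longleftrightarrow> x \<in> entries n ` L \<and> y \<in> entries n ` L \<and> g x = g y" for x y
    using g by auto
  have 2: "(x, y) \<in> {(x, y). x \<in> L \<and> y \<in> L \<and> x - y \<in> M}
      \<longleftrightarrow> x \<in> L \<and> y \<in> L \<and> g (entries n x) = g (entries n y)" for x y
    using g[of "entries n x" "entries n y"] assms(1) diff_entries_mem_iff[OF assms(2), of x y] by auto
  show "add_index L M = card (cosets (entries n ` L) (entries n ` M))"
    and "finite (cosets_in L M) \<longleftrightarrow> finite (cosets (entries n ` L) (entries n ` M))"
    using card_quotient_eq_card_image[OF 1] card_quotient_eq_card_image[OF 2]
    by (simp_all add: add_index_def cosets_in_def cosets_def image_image)
qed

lemma card_cosets_in_invariant:
  assumes "\<And>x y. x \<in> L \<Longrightarrow> y \<in> L \<Longrightarrow> f x = f y \<longleftrightarrow> x - y \<in> M"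
  shows "add_index L M = card (f ` L)" and "finite (cosets_in L M) \<longleftrightarrow> finite (f ` L)"
proof -
  have "(x, y) \<in> {(x, y). x \<in> L \<and> y \<in> L \<and> x - y \<in> M} \<longleftrightarrow> x \<in> L \<and> y \<in> L \<and> f x = f y" for x y
    using assms by auto
  note card_quotient_eq_card_image[OF this]
  then show "add_index L M = card (f ` L)" and "finite (cosets_in L M) \<longleftrightarrow> finite (f ` L)"
    by (simp_all add: add_index_def cosets_in_def)
qed

lemma add_index_tower:
  assumes A: "mat_subgroup n A" and B: "mat_subgroup n B" and C: "mat_subgroup n C"
    and sub: "C \<subseteq> B" "B \<subseteq> A"
  shows "add_index A C = add_index A B * add_index B C"
    and "finite (cosets_in A B) \<Longrightarrow> finite (cosets_in B C) \<Longrightarrow> finite (cosets_in A C)"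
    and "finite (cosets_in A C) \<Longrightarrow> finite (cosets_in A B)"
proof -
  have "A \<subseteq> carrier_mat n n" "B \<subseteq> carrier_mat n n" using A B by (auto simp: mat_subgroup_def)
  note eqs = cosets_in_entries[OF this(1) B] cosets_in_entries[OF this(1) C] cosets_in_entries[OF this(2) C]
  note tower = cosets_tower[OF add_subgroup_entries[OF A] add_subgroup_entries[OF B]
      add_subgroup_entries[OF C] image_mono[OF sub(1)] image_mono[OF sub(2)]]
  show "add_index A C = add_index A B * add_index B C"
    and "finite (cosets_in A B) \<Longrightarrow> finite (cosets_in B C) \<Longrightarrow> finite (cosets_in A C)"
    and "finite (cosets_in A C) \<Longrightarrow> finite (cosets_in A B)"
    unfolding eqs by (rule tower; assumption?)+
qed

lemma finite_cosets_in_subset: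
  assumes "finite (cosets_in A C)" "B \<subseteq> A" "A \<subseteq> carrier_mat n n" "mat_subgroup n C"
  shows "finite (cosets_in B C)"
proof -
  have B: "B \<subseteq> carrier_mat n n" using assms by auto
  show ?thesis
    using assms(1) finite_cosets_subset[of "entries n ` A" "entries n ` C" "entries n ` B"] assms(2)
    unfolding cosets_in_entries(2)[OF assms(3,4)] cosets_in_entries(2)[OF B assms(4)] by blast
qed

lemma mat_subgroup_smult:
  assumes "mat_subgroup n M" shows "mat_subgroup n ((\<cdot>\<^sub>m) c ` M)"
  unfolding mat_subgroup_def
proof (intro conjI ballI)
  have M: "M \<subseteq> carrier_mat n n" "0\<^sub>m n n \<in> M" "\<And>x y. x \<in> M \<Longrightarrow> y \<in> M \<Longrightarrow> x - y \<in> M"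
    using assms by (auto simp: mat_subgroup_def)
  show "(\<cdot>\<^sub>m) c ` M \<subseteq> carrier_mat n n" using M by auto
  show "0\<^sub>m n n \<in> (\<cdot>\<^sub>m) c ` M" using M(2) by (intro image_eqI[of _ _ "0\<^sub>m n n"]) auto
  fix x y assume "x \<in> (\<cdot>\<^sub>m) c ` M" "y \<in> (\<cdot>\<^sub>m) c ` M"
  then obtain a b where ab: "a \<in> M" "b \<in> M" "x = c \<cdot>\<^sub>m a" "y = c \<cdot>\<^sub>m b" by auto
  then have car: "a \<in> carrier_mat n n" "b \<in> carrier_mat n n" using M(1) by auto
  have "x - y = c \<cdot>\<^sub>m (a - b)"
    unfolding ab(3,4) by (rule eq_matI) (use car in \<open>auto simp: right_diff_distrib\<close>)
  then show "x - y \<in> (\<cdot>\<^sub>m) c ` M" using M(3)[OF ab(1,2)] by blast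
qed

lemma add_index_smult:
  fixes c :: "'k::field"
  assumes "c \<noteq> 0" "A \<subseteq> carrier_mat n n" "mat_subgroup n B"
  shows "add_index ((\<cdot>\<^sub>m) c ` A) ((\<cdot>\<^sub>m) c ` B) = add_index A B"
    and "finite (cosets_in ((\<cdot>\<^sub>m) c ` A) ((\<cdot>\<^sub>m) c ` B)) \<longleftrightarrow> finite (cosets_in A B)"
proof -
  define h where "h f = (\<lambda>_. c) * f" for f :: "nat \<times> nat \<Rightarrow> 'k"
  have h: "inj h" "\<And>f g. h (f - g) = h f - h g"
    using assms(1) by (auto simp: h_def inj_on_def fun_eq_iff right_diff_distrib)
  have eq: "entries n ` ((\<cdot>\<^sub>m) c ` M) = h ` (entries n ` M)" if "M \<subseteq> carrier_mat n n" for M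
    using that by (auto simp: image_image h_def subset_iff entries_smult)
  have B: "B \<subseteq> carrier_mat n n" using assms(3) by (simp add: mat_subgroup_def)
  have cA: "(\<cdot>\<^sub>m) c ` A \<subseteq> carrier_mat n n" using assms(2) by auto
  show "add_index ((\<cdot>\<^sub>m) c ` A) ((\<cdot>\<^sub>m) c ` B) = add_index A B"
    and "finite (cosets_in ((\<cdot>\<^sub>m) c ` A) ((\<cdot>\<^sub>m) c ` B)) \<longleftrightarrow> finite (cosets_in A B)"
    unfolding cosets_in_entries[OF cA mat_subgroup_smult[OF assms(3)]]
      cosets_in_entries[OF assms(2,3)] eq[OF assms(2)] eq[OF B]
    by (rule cosets_image_additive[OF h add_subgroup_entries[OF assms(3)]])+
qed

lemma add_index_prime_power:
  assumes "prime p" "mat_subgroup n A" "mat_subgroup n B" "B \<subseteq> A" "finite (cosets_in A B)"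
    and "\<And>x. x \<in> A \<Longrightarrow> of_nat (p ^ a) \<cdot>\<^sub>m x \<in> B"
  shows "\<exists>j. add_index A B = p ^ j"
proof -
  have A: "A \<subseteq> carrier_mat n n" using assms(2) by (simp add: mat_subgroup_def)
  \<comment> \<open>In the ring of functions \<open>of_nat m\<close> is a constant function, so
    these scalar multiples of a matrix become natural multiples of its entry function.\<close>
  have const: "(\<lambda>_. of_nat m) = (of_nat m :: nat \<times> nat \<Rightarrow> 'a)" for m
    by (simp add: of_nat_fun_apply fun_eq_iff)
  show ?thesis
    unfolding cosets_in_entries(1)[OF A assms(3)]
  proof (rule card_cosets_prime_power[OF assms(1)])
    fix f assume "f \<in> entries n ` A"
    then obtain x where x: "x \<in> A" "f = entries n x" by auto
    then have "entries n (of_nat (p ^ a) \<cdot>\<^sub>m x) = of_nat (p ^ a) * f"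
      using A entries_smult[of x n "of_nat (p ^ a)"] by (simp only: const subset_iff)
    then show "of_nat (p ^ a) * f \<in> entries n ` B" using assms(6)[OF x(1)] by (metis image_eqI)
  qed (use assms A in \<open>auto intro: add_subgroup_entries simp: cosets_in_entries(2)[OF A assms(3), symmetric]\<close>)
qed

section \<open>Graded lattices of matrices\<close>

text \<open>The conjugate of \<open>x\<close> by the diagonal matrix with entries
  \<open>t ^ d i\<close>, spelled out entrywise so that no inverse matrix is formed.\<close>

definition diag_conj :: "nat \<Rightarrow> (nat \<Rightarrow> nat) \<Rightarrow> 'k::field \<Rightarrow> 'k mat \<Rightarrow> 'k mat" where
  "diag_conj n d t x = mat n n (\<lambda>(i, j). t ^ d i * x $$ (i, j) / t ^ d j)"

lemma diag_conj_carrier [simp]: "diag_conj n d t x \<in> carrier_mat n n"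
  by (simp add: diag_conj_def)

lemma diag_conj_index [simp]:
  "i < n \<Longrightarrow> j < n \<Longrightarrow> diag_conj n d t x $$ (i, j) = t ^ d i * x $$ (i, j) / t ^ d j"
  by (simp add: diag_conj_def)

lemma diag_conj_dim [simp]: "dim_row (diag_conj n d t x) = n" "dim_col (diag_conj n d t x) = n"
  by (simp_all add: diag_conj_def)

lemma diag_conj_add:
  "x \<in> carrier_mat n n \<Longrightarrow> y \<in> carrier_mat n n \<Longrightarrow>
    diag_conj n d t (x + y) = diag_conj n d t x + diag_conj n d t y"
  by (rule eq_matI) (auto simp: distrib_left add_divide_distrib)

lemma diag_conj_diff:
  "x \<in> carrier_mat n n \<Longrightarrow> y \<in> carrier_mat n n \<Longrightarrow>
    diag_conj n d t (x - y) = diag_conj n d t x - diag_conj n d t y"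
  by (rule eq_matI) (auto simp: right_diff_distrib diff_divide_distrib)

lemma diag_conj_smult:
  "x \<in> carrier_mat n n \<Longrightarrow> diag_conj n d t (z \<cdot>\<^sub>m x) = z \<cdot>\<^sub>m diag_conj n d t x"
  by (rule eq_matI) (auto simp: mult_ac)

lemma diag_conj_zero: "diag_conj n d t (0\<^sub>m n n) = 0\<^sub>m n n"
  by (rule eq_matI) auto

lemma mult_mat_index:
  assumes "x \<in> carrier_mat n n" "y \<in> carrier_mat n n" "i < n" "j < n"
  shows "(x * y) $$ (i, j) = (\<Sum>l<n. x $$ (i, l) * y $$ (l, j))"
  using assms by (auto simp: scalar_prod_def lessThan_atLeast0 intro!: sum.cong)

lemma diag_conj_mult:
  assumes "t \<noteq> 0" and xy: "x \<in> carrier_mat n n" "y \<in> carrier_mat n n"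
  shows "diag_conj n d t (x * y) = diag_conj n d t x * diag_conj n d t y"
proof (rule eq_matI)
  fix i j assume "i < dim_row (diag_conj n d t x * diag_conj n d t y)"
    "j < dim_col (diag_conj n d t x * diag_conj n d t y)"
  then have ij: "i < n" "j < n" by auto
  then have "diag_conj n d t (x * y) $$ (i, j) = t ^ d i * (\<Sum>l<n. x $$ (i, l) * y $$ (l, j)) / t ^ d j"
    by (simp only: diag_conj_index mult_mat_index[OF xy])
  also have "\<dots> = (\<Sum>l<n. (t ^ d i * x $$ (i, l) / t ^ d l) * (t ^ d l * y $$ (l, j) / t ^ d j))"
    unfolding sum_distrib_left sum_divide_distrib
    by (rule sum.cong) (use \<open>t \<noteq> 0\<close> in auto)
  also have "\<dots> = (diag_conj n d t x * diag_conj n d t y) $$ (i, j)"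
    unfolding mult_mat_index[OF diag_conj_carrier diag_conj_carrier ij]
    by (rule sum.cong) (use ij in auto)
  finally show "diag_conj n d t (x * y) $$ (i, j) = (diag_conj n d t x * diag_conj n d t y) $$ (i, j)" .
qed auto

lemma lie_bracket_carrier:
  "x \<in> carrier_mat n n \<Longrightarrow> y \<in> carrier_mat n n \<Longrightarrow> lie_bracket x y \<in> carrier_mat n n"
  unfolding lie_bracket_def by (intro minus_carrier_mat mult_carrier_mat)

lemma lie_bracket_index:
  assumes "x \<in> carrier_mat n n" "y \<in> carrier_mat n n" "i < n" "j < n"
  shows "lie_bracket x y $$ (i, j) =
    (\<Sum>l<n. x $$ (i, l) * y $$ (l, j)) - (\<Sum>l<n. y $$ (i, l) * x $$ (l, j))"
  using assms mult_mat_index[OF assms] mult_mat_index[OF assms(2,1,3,4)]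
  by (simp add: lie_bracket_def)

lemma diag_conj_lie_bracket:
  assumes "t \<noteq> 0" "x \<in> carrier_mat n n" "y \<in> carrier_mat n n"
  shows "diag_conj n d t (lie_bracket x y) = lie_bracket (diag_conj n d t x) (diag_conj n d t y)"
  unfolding lie_bracket_def using assms
  by (subst diag_conj_diff) (auto simp: diag_conj_mult)

lemma smult_diff_distrib_mat:
  "x \<in> carrier_mat n m \<Longrightarrow> y \<in> carrier_mat n m \<Longrightarrow>
    z \<cdot>\<^sub>m (x - y) = z \<cdot>\<^sub>m x - z \<cdot>\<^sub>m (y :: 'k::field mat)"
  by (rule eq_matI) (auto simp: right_diff_distrib)

lemma lie_bracket_smult_left:
  assumes "x \<in> carrier_mat n n" "y \<in> carrier_mat n n"
  shows "lie_bracket (z \<cdot>\<^sub>m x) y = z \<cdot>\<^sub>m lie_bracket x y"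
  unfolding lie_bracket_def mult_smult_assoc_mat[OF assms] mult_smult_distrib[OF assms(2,1)]
  by (rule smult_diff_distrib_mat[symmetric]) (rule mult_carrier_mat assms)+

lemma lie_bracket_smult_right:
  assumes "x \<in> carrier_mat n n" "y \<in> carrier_mat n n"
  shows "lie_bracket x (z \<cdot>\<^sub>m y) = z \<cdot>\<^sub>m lie_bracket x y"
  unfolding lie_bracket_def mult_smult_assoc_mat[OF assms(2,1)] mult_smult_distrib[OF assms]
  by (rule smult_diff_distrib_mat[symmetric]) (rule mult_carrier_mat assms)+

lemma smult_smult_mat: "a \<cdot>\<^sub>m (b \<cdot>\<^sub>m x) = (a * b) \<cdot>\<^sub>m (x :: 'k::field mat)"
  by (rule eq_matI) auto

lemma diag_conj_diag_conj:
  "diag_conj n d s (diag_conj n d t x) = diag_conj n d (s * t) x"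
  by (rule eq_matI) (auto simp: power_mult_distrib mult_ac)

text \<open>\<open>P\<close> stands for membership in a Lie algebra over the whole field:
  \<open>P_smult\<close> admits every scalar, so its members may be divided. The lattice
  \<open>S\<close> consists of the integral points.\<close>

locale matrix_lattice = padic_uniformizer p Q v \<pi>
  for p :: nat and Q :: "'k::field_char_0 set" and v :: "'k \<Rightarrow> real" and \<pi> :: 'k +
  fixes n :: nat and P :: "'k mat \<Rightarrow> bool"
  assumes P_zero: "P (0\<^sub>m n n)"
    and P_add: "\<lbrakk>x \<in> carrier_mat n n; y \<in> carrier_mat n n; P x; P y\<rbrakk> \<Longrightarrow> P (x + y)"
    and P_smult: "\<lbrakk>x \<in> carrier_mat n n; P x\<rbrakk> \<Longrightarrow> P (r \<cdot>\<^sub>m x)"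
    and P_bracket: "\<lbrakk>x \<in> carrier_mat n n; y \<in> carrier_mat n n; P x; P y\<rbrakk> \<Longrightarrow> P (lie_bracket x y)"
begin

definition S :: "'k mat set" where
  "S = {x \<in> carrier_mat n n. elements_mat x \<subseteq> R \<and> P x}"

lemma mem_S_iff: "x \<in> S \<longleftrightarrow> x \<in> carrier_mat n n \<and> (\<forall>i<n. \<forall>j<n. x $$ (i, j) \<in> R) \<and> P x"
  by (fastforce simp: S_def elements_mat_def)

lemma S_subset: "S \<subseteq> carrier_mat n n"
  by (auto simp: mem_S_iff)

lemma S_carrier: "x \<in> S \<Longrightarrow> x \<in> carrier_mat n n"
  by (simp add: mem_S_iff)

lemma S_zero: "0\<^sub>m n n \<in> S"
  by (simp add: mem_S_iff P_zero R_zero)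

lemma S_add: "x \<in> S \<Longrightarrow> y \<in> S \<Longrightarrow> x + y \<in> S"
  by (auto simp: mem_S_iff P_add R_add)

lemma S_smult: "r \<in> R \<Longrightarrow> x \<in> S \<Longrightarrow> r \<cdot>\<^sub>m x \<in> S"
  by (auto simp: mem_S_iff P_smult R_mult)

lemma mat_diff_eq: "x \<in> carrier_mat n n \<Longrightarrow> y \<in> carrier_mat n n \<Longrightarrow> x - y = x + (- 1) \<cdot>\<^sub>m (y :: 'k mat)"
  by (rule eq_matI) auto

lemma P_diff: "\<lbrakk>x \<in> carrier_mat n n; y \<in> carrier_mat n n; P x; P y\<rbrakk> \<Longrightarrow> P (x - y)"
  by (simp add: mat_diff_eq P_add P_smult)

lemma S_lie_bracket: "x \<in> S \<Longrightarrow> y \<in> S \<Longrightarrow> lie_bracket x y \<in> S"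
  by (auto simp: mem_S_iff lie_bracket_carrier lie_bracket_index P_bracket intro!: R_diff R_sum R_mult)

lemma mat_subgroup_submodule:
  assumes "is_submodule Z n M" shows "mat_subgroup n M"
  unfolding mat_subgroup_def
proof (intro conjI ballI)
  fix x y assume xy: "x \<in> M" "y \<in> M"
  then have "x - y = x + (- 1) \<cdot>\<^sub>m y"
    using assms by (intro mat_diff_eq) (auto simp: is_submodule_def)
  then show "x - y \<in> M"
    using assms xy Z_uminus[OF Z_one] unfolding is_submodule_def by auto
qed (use assms in \<open>auto simp: is_submodule_def\<close>)

lemma S_multiples_submodule: "is_submodule Z n ((\<cdot>\<^sub>m) c ` S)"
  unfolding is_submodule_def
proof (intro conjI ballI)
  show "0\<^sub>m n n \<in> (\<cdot>\<^sub>m) c ` S" using S_zero by (intro image_eqI[of _ _ "0\<^sub>m n n"]) auto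
  fix x assume "x \<in> (\<cdot>\<^sub>m) c ` S"
  then obtain a where a: "a \<in> S" "x = c \<cdot>\<^sub>m a" by auto
  {
    fix y assume "y \<in> (\<cdot>\<^sub>m) c ` S"
    then obtain b where b: "b \<in> S" "y = c \<cdot>\<^sub>m b" by auto
    have "x + y = c \<cdot>\<^sub>m (a + b)"
      using S_carrier a b by (simp add: add_smult_distrib_left_mat[of _ n n])
    then show "x + y \<in> (\<cdot>\<^sub>m) c ` S" using S_add a b by blast
  }
  fix z assume z: "z \<in> Z"
  have "z \<cdot>\<^sub>m x = c \<cdot>\<^sub>m (z \<cdot>\<^sub>m a)" using a(2) by (simp add: smult_smult_mat mult.commute)
  then show "z \<cdot>\<^sub>m x \<in> (\<cdot>\<^sub>m) c ` S" using S_smult[OF Z_subset_R[OF z] a(1)] by blast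
qed (auto simp: S_carrier)

lemma S_multiples_lie_bracket:
  assumes "c \<in> R" "x \<in> (\<cdot>\<^sub>m) c ` S" "y \<in> (\<cdot>\<^sub>m) c ` S"
  shows "lie_bracket x y \<in> (\<cdot>\<^sub>m) c ` S"
proof -
  obtain a b where ab: "a \<in> S" "b \<in> S" "x = c \<cdot>\<^sub>m a" "y = c \<cdot>\<^sub>m b" using assms by auto
  then have "lie_bracket x y = c \<cdot>\<^sub>m (c \<cdot>\<^sub>m lie_bracket a b)"
    by (simp add: lie_bracket_smult_left[of _ n] lie_bracket_smult_right[of _ n] S_carrier)
  then show ?thesis using S_smult[OF assms(1) S_lie_bracket[OF ab(1,2)]] by blast
qed

lemma S_multiples_mono: "c \<in> (*) d ` R \<Longrightarrow> (\<cdot>\<^sub>m) c ` S \<subseteq> (\<cdot>\<^sub>m) d ` S"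
proof
  fix x assume "c \<in> (*) d ` R" "x \<in> (\<cdot>\<^sub>m) c ` S"
  then obtain r a where "r \<in> R" "c = d * r" "a \<in> S" "x = c \<cdot>\<^sub>m a" by auto
  then have "x = d \<cdot>\<^sub>m (r \<cdot>\<^sub>m a)" "r \<cdot>\<^sub>m a \<in> S" by (auto simp: smult_smult_mat S_smult)
  then show "x \<in> (\<cdot>\<^sub>m) d ` S" by blast
qed

text \<open>\<open>P\<close> survives division by \<open>c\<close>, so divisibility in
  \<open>S\<close> may be tested entry by entry.\<close>

lemma mem_S_multiples_iff:
  assumes "c \<noteq> 0"
  shows "x \<in> (\<cdot>\<^sub>m) c ` S \<longleftrightarrow>
    x \<in> carrier_mat n n \<and> (\<forall>i<n. \<forall>j<n. x $$ (i, j) \<in> (*) c ` R) \<and> P x"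
proof
  assume "x \<in> (\<cdot>\<^sub>m) c ` S"
  then show "x \<in> carrier_mat n n \<and> (\<forall>i<n. \<forall>j<n. x $$ (i, j) \<in> (*) c ` R) \<and> P x"
    by (auto simp: mem_S_iff P_smult intro!: imageI)
next
  assume x: "x \<in> carrier_mat n n \<and> (\<forall>i<n. \<forall>j<n. x $$ (i, j) \<in> (*) c ` R) \<and> P x"
  have "inverse c * x $$ (i, j) \<in> R" if "i < n" "j < n" for i j
  proof -
    obtain r where "r \<in> R" "x $$ (i, j) = c * r" using x \<open>i < n\<close> \<open>j < n\<close> by auto
    then show ?thesis using assms by (simp flip: mult.assoc)
  qed
  then have "inverse c \<cdot>\<^sub>m x \<in> S" using x by (auto simp: mem_S_iff P_smult)
  moreover have "x = c \<cdot>\<^sub>m (inverse c \<cdot>\<^sub>m x)"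
    by (rule eq_matI) (use assms in auto)
  ultimately show "x \<in> (\<cdot>\<^sub>m) c ` S" by blast
qed

text \<open>The class of a matrix is determined by the residues of its finitely many entries, and
  each entry has finitely many residues.\<close>

lemma finite_S_mod_pi_power: "finite (cosets_in S ((\<cdot>\<^sub>m) (\<pi> ^ m) ` S))"
proof -
  obtain g :: "'k \<Rightarrow> 'k set" where g: "\<And>x y. x \<in> R \<Longrightarrow> y \<in> R \<Longrightarrow> g x = g y \<longleftrightarrow> x - y \<in> (*) (\<pi> ^ m) ` R"
    by (rule ex_coset_invariant[OF add_subgroup_multiples[of "\<pi> ^ m"], of R]) blast
  have "finite (cosets R ((*) (\<pi> ^ m) ` R)) \<longleftrightarrow> finite (g ` R)"
    unfolding cosets_def by (rule card_quotient_eq_card_image(2)) (use g in auto)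
  then have fin: "finite (g ` R)" using card_R_mod_pi_power(2) by simp
  define f where "f x = restrict (\<lambda>(i, j). g (x $$ (i, j))) ({..<n} \<times> {..<n})" for x
  have f: "f x = f y \<longleftrightarrow> x - y \<in> (\<cdot>\<^sub>m) (\<pi> ^ m) ` S" if "x \<in> S" "y \<in> S" for x y
  proof -
    have xy: "x \<in> carrier_mat n n" "y \<in> carrier_mat n n" using that by (simp_all add: S_carrier)
    have "x - y \<in> (\<cdot>\<^sub>m) (\<pi> ^ m) ` S \<longleftrightarrow>
        (\<forall>i<n. \<forall>j<n. x $$ (i, j) - y $$ (i, j) \<in> (*) (\<pi> ^ m) ` R)"
      using that pi_nonzero xy
      by (subst mem_S_multiples_iff) (auto simp: mem_S_iff P_diff)
    also have "\<dots> \<longleftrightarrow> (\<forall>i<n. \<forall>j<n. g (x $$ (i, j)) = g (y $$ (i, j)))"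
      using that g by (auto simp: mem_S_iff)
    also have "\<dots> \<longleftrightarrow> f x = f y"
      unfolding f_def restrict_eq_iff by (simp add: Ball_def) blast
    finally show ?thesis by simp
  qed
  have "f ` S \<subseteq> PiE ({..<n} \<times> {..<n}) (\<lambda>_. g ` R)"
  proof (rule image_subsetI)
    fix x assume "x \<in> S"
    then show "f x \<in> PiE ({..<n} \<times> {..<n}) (\<lambda>_. g ` R)"
      unfolding f_def
      by (intro restrict_PiE_iff[THEN iffD2] ballI) (auto simp: mem_S_iff)
  qed
  moreover have "finite (PiE ({..<n} \<times> {..<n}) (\<lambda>_. g ` R))"
    using fin by (intro finite_PiE) auto
  ultimately have "finite (f ` S)" by (rule finite_subset)
  then show ?thesis using card_cosets_in_invariant(2)[OF f] by simp
qed

text \<open>With \<open>N\<close> the index, two of the multiples of \<open>x\<close> by 0, ..., N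
  lie in one coset. A positive multiple by at most \<open>N\<close>, hence also the one by the
  factorial of \<open>N\<close>, lies in \<open>L\<close>. As \<open>L\<close> is a
  \<open>Z\<close>-module, the factorial may be replaced by a power of \<open>p\<close>, and this in
  turn by a power of \<open>\<pi>\<close>.\<close>

lemma finite_index_imp_congruence:
  assumes L: "is_submodule Z n L" "L \<subseteq> S" "finite (cosets_in S L)"
  obtains m where "(\<cdot>\<^sub>m) (\<pi> ^ m) ` S \<subseteq> L"
proof -
  define N where "N = card (cosets_in S L)"
  have fact_mem: "(of_nat (fact N) :: 'k) \<cdot>\<^sub>m x \<in> L" if x: "x \<in> S" for x
  proof -
    define h where "h i = {(x, y). x \<in> S \<and> y \<in> S \<and> x - y \<in> L} `` {of_nat i \<cdot>\<^sub>m x}" for i :: nat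
    have ix: "of_nat i \<cdot>\<^sub>m x \<in> S" for i by (intro S_smult R_of_nat x)
    have "h ` {..N} \<subseteq> cosets_in S L" using ix by (auto simp: h_def cosets_in_def quotient_def)
    then have "card (h ` {..N}) < card {..N}"
      using card_mono[OF L(3)] by (simp add: N_def le_imp_less_Suc)
    then have "\<not> inj_on h {..N}" using pigeonhole by blast
    then obtain a b where ab: "a \<le> N" "b \<le> N" "a < b" "h a = h b"
      by (metis (no_types, lifting) atMost_iff inj_onI linorder_neqE_nat)
    have "0\<^sub>m n n \<in> L" using L(1) by (simp add: is_submodule_def)
    moreover have "of_nat a \<cdot>\<^sub>m x - of_nat a \<cdot>\<^sub>m x = 0\<^sub>m n n"
      using S_carrier[OF ix[of a]] by simp
    ultimately have "of_nat a \<cdot>\<^sub>m x \<in> h a" using ix by (simp add: h_def)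
    then have "of_nat b \<cdot>\<^sub>m x - of_nat a \<cdot>\<^sub>m x \<in> L"
      using ab(4) ix by (auto simp: h_def)
    moreover have "of_nat b \<cdot>\<^sub>m x - of_nat a \<cdot>\<^sub>m x = of_nat (b - a) \<cdot>\<^sub>m x"
      using ab(3) S_carrier[OF x] by (intro eq_matI) (auto simp: of_nat_diff left_diff_distrib)
    moreover have "b - a dvd fact N" using ab by (intro dvd_fact) auto
    then obtain k where "fact N = k * (b - a)" by (metis dvd_def mult.commute)
    then have "of_nat (fact N) \<cdot>\<^sub>m x = of_nat k \<cdot>\<^sub>m (of_nat (b - a) \<cdot>\<^sub>m x)"
      by (simp only: smult_smult_mat of_nat_mult)
    ultimately show ?thesis
      using L(1) Z_of_nat unfolding is_submodule_def by metis
  qed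
  obtain a where a: "of_nat p ^ a * inverse (of_nat (fact N)) \<in> Z"
    by (rule ex_p_power_mult_mem_Z[OF inverse_closed[OF of_nat_closed]])
  have p_mem: "(\<cdot>\<^sub>m) (of_nat p ^ a) ` S \<subseteq> L"
  proof
    fix y assume "y \<in> (\<cdot>\<^sub>m) (of_nat p ^ a) ` S"
    then obtain x where x: "x \<in> S" "y = of_nat p ^ a \<cdot>\<^sub>m x" by auto
    have "(of_nat (fact N) :: 'k) \<noteq> 0" by (simp only: of_nat_eq_0_iff fact_nonzero not_False_eq_True)
    then have "of_nat p ^ a * inverse (of_nat (fact N)) * of_nat (fact N) = (of_nat p ^ a :: 'k)"
      by (simp only: mult.assoc left_inverse mult_1_right not_False_eq_True)
    then have "y = (of_nat p ^ a * inverse (of_nat (fact N))) \<cdot>\<^sub>m (of_nat (fact N) \<cdot>\<^sub>m x)"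
      by (simp only: x(2) smult_smult_mat)
    moreover have "(of_nat p ^ a * inverse (of_nat (fact N))) \<cdot>\<^sub>m (of_nat (fact N) \<cdot>\<^sub>m x) \<in> L"
      using a fact_mem[OF x(1)] L(1) unfolding is_submodule_def by blast
    ultimately show "y \<in> L" by simp
  qed
  obtain e where e: "\<pi> ^ e \<in> (*) (of_nat p) ` R" using ex_pi_power_in_p_R by blast
  have "(\<pi> ^ e) ^ a \<in> (*) (of_nat p ^ a) ` R"
    using multiples_power_subset[OF e, of a] R_one by force
  then have "(\<cdot>\<^sub>m) (\<pi> ^ (e * a)) ` S \<subseteq> L"
    unfolding power_mult using S_multiples_mono p_mem by blast
  then show thesis by (rule that)
qed

end

text \<open>
  The entries of column \<open>c\<close> at the positions in \<open>A\<close> are free coordinates on the lattice, and their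
  divisibility by powers of \<open>t\<close> decides whether a conjugate under \<open>diag_conj n d t\<close> is integral.
\<close>

locale graded_lattice = matrix_lattice p Q v \<pi> n P
  for p :: nat and Q :: "'k::field_char_0 set" and v :: "'k \<Rightarrow> real" and \<pi> :: 'k
    and n :: nat and P :: "'k mat \<Rightarrow> bool" +
  fixes c :: nat and A :: "nat set" and d :: "nat \<Rightarrow> nat"
  assumes c_less: "c < n" and A_subset: "A \<subseteq> {..<n} - {c}"
    and weight_less: "i \<in> A \<Longrightarrow> d i < d c"
    and column_zero: "\<lbrakk>x \<in> carrier_mat n n; P x; i < n; i \<noteq> c; i \<notin> A\<rbrakk> \<Longrightarrow> x $$ (i, c) = 0"
    and column_surj: "(\<And>i. i \<in> A \<Longrightarrow> r i \<in> R) \<Longrightarrow> \<exists>a\<in>S. \<forall>i\<in>A. a $$ (i, c) = r i"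
    and scalar_imp_zero: "\<lbrakk>x \<in> carrier_mat n n; P x;
        \<And>i j. i < n \<Longrightarrow> i \<noteq> c \<Longrightarrow> j \<in> insert c A \<Longrightarrow> x $$ (i, j) = (if i = j then x $$ (c, c) else 0)\<rbrakk>
      \<Longrightarrow> x $$ (c, c) = 0"
    and columns_zero_imp_zero: "\<lbrakk>x \<in> carrier_mat n n; P x;
        \<And>i j. i < n \<Longrightarrow> j \<in> insert c A \<Longrightarrow> x $$ (i, j) = 0\<rbrakk> \<Longrightarrow> x = 0\<^sub>m n n"
    and diag_conj_integral: "\<lbrakk>x \<in> S; t \<in> R; t \<noteq> 0;
        \<And>i. i \<in> A \<Longrightarrow> x $$ (i, c) \<in> (*) (t ^ (d c - d i)) ` R\<rbrakk> \<Longrightarrow> diag_conj n d t x \<in> S"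
begin

lemma A_D: "i \<in> A \<Longrightarrow> i < n" "i \<in> A \<Longrightarrow> i \<noteq> c"
  using A_subset by auto

lemma finite_A: "finite A"
  using A_subset finite_subset by blast

definition M0 :: "nat \<Rightarrow> 'k mat set" where
  "M0 k = {x \<in> S. diag_conj n d (\<pi> ^ k) x \<in> S}"

lemma column_divisible:
  assumes "x \<in> carrier_mat n n" "diag_conj n d t x \<in> S" "t \<noteq> 0" "i \<in> A"
  shows "x $$ (i, c) \<in> (*) (t ^ (d c - d i)) ` R"
proof -
  have i: "i < n" using assms(4) by (rule A_D)
  have "t ^ d i * x $$ (i, c) / t ^ d c \<in> R"
    using assms(2) i c_less by (auto simp: mem_S_iff)
  moreover have "t ^ d c = t ^ d i * t ^ (d c - d i)"
    using weight_less[OF assms(4)] by (simp flip: power_add)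
  then have "x $$ (i, c) = t ^ (d c - d i) * (t ^ d i * x $$ (i, c) / t ^ d c)"
    using assms(3) by simp
  ultimately show ?thesis by blast
qed

text \<open>Integrality of the conjugate is visible in column \<open>c\<close> alone. Its entries at
  \<open>A\<close> are free coordinates, which will turn the index of \<open>M0 k\<close> into a
  product.\<close>

lemma mem_M0_iff:
  assumes "x \<in> S"
  shows "x \<in> M0 k \<longleftrightarrow> (\<forall>i\<in>A. x $$ (i, c) \<in> (*) (\<pi> ^ (k * (d c - d i))) ` R)"
  using assms column_divisible[of x "\<pi> ^ k"] diag_conj_integral[of x "\<pi> ^ k"] pi_nonzero
    R_power[OF pi_in_R] S_carrier
  by (auto simp: M0_def power_mult)

lemma M0_subset: "M0 k \<subseteq> S"
  by (auto simp: M0_def)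

lemma M0_submodule: "is_submodule Z n (M0 k)"
  unfolding is_submodule_def M0_def
  by (auto simp: S_zero diag_conj_zero S_carrier S_add diag_conj_add diag_conj_smult S_smult Z_subset_R)

text \<open>Reducing entry \<open>(i, c)\<close> modulo \<open>\<pi> ^ (k * (d c - d i))\<close> for
  all \<open>i\<close> in \<open>A\<close> has kernel \<open>M0 k\<close>, and by
  \<open>column_surj\<close> every tuple of residues occurs.\<close>

lemma card_S_mod_M0:
  "add_index S (M0 k) = card (residue_field R) ^ (k * (\<Sum>i\<in>A. d c - d i))"
  "finite (cosets_in S (M0 k))"
proof -
  define I where "I i = (*) (\<pi> ^ (k * (d c - d i))) ` R" for i
  have "\<exists>g :: 'k \<Rightarrow> 'k set. \<forall>x\<in>R. \<forall>y\<in>R. g x = g y \<longleftrightarrow> x - y \<in> I i" for i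
    unfolding I_def
    by (rule ex_coset_invariant[OF add_subgroup_multiples[of "\<pi> ^ (k * (d c - d i))"], of R]) blast
  then obtain g :: "nat \<Rightarrow> 'k \<Rightarrow> 'k set"
    where g: "\<And>i x y. x \<in> R \<Longrightarrow> y \<in> R \<Longrightarrow> g i x = g i y \<longleftrightarrow> x - y \<in> I i"
    by metis
  have gR: "card (g i ` R) = card (residue_field R) ^ (k * (d c - d i))" "finite (g i ` R)" for i
  proof -
    have "(x, y) \<in> {(x, y). x \<in> R \<and> y \<in> R \<and> x - y \<in> I i} \<longleftrightarrow> x \<in> R \<and> y \<in> R \<and> g i x = g i y" for x y
      using g by auto
    note card_quotient_eq_card_image[OF this]
    then show "card (g i ` R) = card (residue_field R) ^ (k * (d c - d i))" "finite (g i ` R)"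
      using card_R_mod_pi_power[of "k * (d c - d i)"] by (simp_all only: cosets_def I_def)
  qed
  define f where "f x = restrict (\<lambda>i. g i (x $$ (i, c))) A" for x
  have f: "f x = f y \<longleftrightarrow> x - y \<in> M0 k" if "x \<in> S" "y \<in> S" for x y
  proof -
    have xy: "x \<in> carrier_mat n n" "y \<in> carrier_mat n n" using that by (simp_all add: S_carrier)
    have "x - y \<in> S" using that by (auto simp: mem_S_iff P_diff R_diff)
    then have "x - y \<in> M0 k \<longleftrightarrow> (\<forall>i\<in>A. x $$ (i, c) - y $$ (i, c) \<in> I i)"
      using xy c_less A_D(1) by (auto simp: mem_M0_iff I_def)
    also have "\<dots> \<longleftrightarrow> (\<forall>i\<in>A. g i (x $$ (i, c)) = g i (y $$ (i, c)))"
      by (intro ball_cong refl) (use that c_less A_D(1) in \<open>simp add: g mem_S_iff\<close>)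
    also have "\<dots> \<longleftrightarrow> f x = f y"
      unfolding f_def restrict_eq_iff ..
    finally show ?thesis by simp
  qed
  have "f ` S = PiE A (\<lambda>i. g i ` R)"
  proof (intro equalityI subsetI)
    fix u assume "u \<in> f ` S"
    then obtain x where x: "x \<in> S" "u = f x" by auto
    show "u \<in> PiE A (\<lambda>i. g i ` R)"
      unfolding x(2) f_def
      by (rule restrict_PiE_iff[THEN iffD2], rule ballI, rule imageI)
        (use x(1) c_less A_D(1) in \<open>simp add: mem_S_iff\<close>)
  next
    fix u assume u: "u \<in> PiE A (\<lambda>i. g i ` R)"
    then have "\<forall>i\<in>A. \<exists>r\<in>R. u i = g i r" by (auto simp: PiE_iff)
    then obtain r where r: "\<And>i. i \<in> A \<Longrightarrow> r i \<in> R \<and> u i = g i (r i)" by metis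
    then obtain a where a: "a \<in> S" "\<forall>i\<in>A. a $$ (i, c) = r i" using column_surj[of r] by auto
    have "u = f a"
    proof
      \<comment> \<open>Outside \<open>A\<close> both functions are
        \<open>undefined\<close>.\<close>
      fix i show "u i = f a i"
        using u r a(2) by (cases "i \<in> A") (simp_all add: f_def PiE_arb[OF u])
    qed
    then show "u \<in> f ` S" using a(1) by blast
  qed
  moreover have "card (PiE A (\<lambda>i. g i ` R)) = card (residue_field R) ^ (k * (\<Sum>i\<in>A. d c - d i))"
    using finite_A by (simp add: card_PiE gR(1) power_sum sum_distrib_left flip: power_sum)
  moreover have "finite (PiE A (\<lambda>i. g i ` R))" using finite_A gR(2) by (intro finite_PiE) auto
  ultimately show "add_index S (M0 k) = card (residue_field R) ^ (k * (\<Sum>i\<in>A. d c - d i))"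
    "finite (cosets_in S (M0 k))"
    using card_cosets_in_invariant[OF f] by simp_all
qed

text \<open>
  Membership of all iterates of \<open>x\<close> in \<open>S\<close> kills column \<open>c\<close> of \<open>x\<close> off the diagonal. Applied to the
  brackets of \<open>x\<close> with elements of prescribed column \<open>c\<close>, this first shows that \<open>x\<close> is scalar outside
  row \<open>c\<close> and then that \<open>x = 0\<close>.
\<close>

lemma invariant_ideal_trivial:
  assumes k: "k > 0" and b: "b \<noteq> 0"
    and I: "I \<subseteq> S" "\<And>x. x \<in> I \<Longrightarrow> diag_conj n d (\<pi> ^ k) x \<in> I"
    and ideal: "\<And>a x. a \<in> S \<Longrightarrow> x \<in> I \<Longrightarrow> b \<cdot>\<^sub>m lie_bracket a x \<in> I"
    and x: "x \<in> I"
  shows "x = 0\<^sub>m n n"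
proof -
  have carrier: "y \<in> carrier_mat n n" if "y \<in> I" for y
    using that I(1) S_carrier by auto
  have P: "P y" if "y \<in> I" for y using that I(1) by (auto simp: mem_S_iff)
  have iter: "diag_conj n d (\<pi> ^ (k * j)) y \<in> I" if "y \<in> I" for j y
  proof (induction j)
    case 0
    have "diag_conj n d 1 y = y" by (rule eq_matI) (use carrier[OF that] in auto)
    then show ?case using that by simp
  next
    case (Suc j)
    then show ?case using I(2)[OF Suc] by (simp add: diag_conj_diag_conj flip: power_add)
  qed
  have column: "y $$ (i, c) = 0" if y: "y \<in> I" and i: "i < n" "i \<noteq> c" for y i
  proof (cases "i \<in> A")
    case True
    show ?thesis
    proof (rule pi_divisible_imp_zero)
      show "k * (d c - d i) > 0" using k weight_less[OF True] by simp
      fix j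
      have "y $$ (i, c) \<in> (*) ((\<pi> ^ (k * j)) ^ (d c - d i)) ` R"
        using iter[OF y] I(1) pi_nonzero True carrier[OF y] by (intro column_divisible) auto
      then show "y $$ (i, c) \<in> (*) (\<pi> ^ (k * (d c - d i) * j)) ` R"
        by (simp add: mult_ac flip: power_mult)
    qed
  next
    case False
    then show ?thesis using column_zero carrier[OF y] P[OF y] i by blast
  qed
  \<comment> \<open>Column \<open>c\<close> of \<open>y\<close> is zero off the diagonal, so only
    the term \<open>l = c\<close> of the first sum survives.\<close>
  have bracket_column: "lie_bracket a y $$ (i, c) = a $$ (i, c) * y $$ (c, c) - (\<Sum>l<n. y $$ (i, l) * a $$ (l, c))"
    if "a \<in> S" "y \<in> I" "i < n" for a y i
  proof -
    have "(\<Sum>l<n. a $$ (i, l) * y $$ (l, c)) = a $$ (i, c) * y $$ (c, c) + (\<Sum>l\<in>{..<n} - {c}. a $$ (i, l) * y $$ (l, c))"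
      using c_less by (simp add: sum.remove)
    also have "(\<Sum>l\<in>{..<n} - {c}. a $$ (i, l) * y $$ (l, c)) = 0"
      using column[OF that(2)] by (intro sum.neutral) auto
    finally show ?thesis
      using lie_bracket_index[OF S_carrier[OF that(1)] carrier[OF that(2)] that(3) c_less] by simp
  qed
  have bracket_zero: "lie_bracket a y $$ (i, c) = 0" if "a \<in> S" "y \<in> I" "i < n" "i \<noteq> c" for a y i
  proof -
    have "(b \<cdot>\<^sub>m lie_bracket a y) $$ (i, c) = 0" using column[OF ideal] that by blast
    then show ?thesis
      using b that(3) c_less lie_bracket_carrier[OF S_carrier[OF that(1)] carrier[OF that(2)]] by simp
  qed
  \<comment> \<open>Entry \<open>(c, c)\<close> of \<open>a\<close> cannot be prescribed; in the
    sums below it only meets entries already known to be 0.\<close>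
  have unit_column: "\<exists>a\<in>S. \<forall>l<n. l \<noteq> c \<longrightarrow> a $$ (l, c) = (if l = j then 1 else 0)" if j: "j \<in> A" for j
  proof -
    have "\<exists>a\<in>S. \<forall>i\<in>A. a $$ (i, c) = (if i = j then 1 else 0)"
      by (rule column_surj) (simp add: R_one R_zero)
    then obtain a where a: "a \<in> S" "\<forall>i\<in>A. a $$ (i, c) = (if i = j then 1 else 0)" by blast
    have "a $$ (l, c) = (if l = j then 1 else 0)" if "l < n" "l \<noteq> c" for l
      using a j column_zero[of a l] that by (cases "l \<in> A") (auto simp: mem_S_iff)
    then show ?thesis using a(1) by blast
  qed
  have row_sum: "(\<Sum>l<n. y $$ (i, l) * a $$ (l, c)) = y $$ (i, j) + y $$ (i, c) * a $$ (c, c)"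
    if "j \<in> A" "\<forall>l<n. l \<noteq> c \<longrightarrow> a $$ (l, c) = (if l = j then 1 else 0)" for y a :: "'k mat" and i j
  proof -
    have "(\<Sum>l<n. y $$ (i, l) * a $$ (l, c)) = y $$ (i, c) * a $$ (c, c) + (\<Sum>l\<in>{..<n} - {c}. y $$ (i, l) * a $$ (l, c))"
      using c_less by (simp add: sum.remove)
    also have "(\<Sum>l\<in>{..<n} - {c}. y $$ (i, l) * a $$ (l, c)) = (\<Sum>l\<in>{..<n} - {c}. if l = j then y $$ (i, l) else 0)"
      using that(2) by (intro sum.cong) auto
    also have "\<dots> = y $$ (i, j)" using A_D[OF that(1)] by simp
    finally show ?thesis by simp
  qed
  have scalar: "y $$ (i, j) = (if i = j then y $$ (c, c) else 0)"
    if y: "y \<in> I" and i: "i < n" "i \<noteq> c" and j: "j \<in> insert c A" for y i j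
  proof (cases "j = c")
    case True
    then show ?thesis using column[OF y i] i by simp
  next
    case False
    then have jA: "j \<in> A" using j by simp
    obtain a where a: "a \<in> S" "\<forall>l<n. l \<noteq> c \<longrightarrow> a $$ (l, c) = (if l = j then 1 else 0)"
      using unit_column[OF jA] by blast
    have "0 = a $$ (i, c) * y $$ (c, c) - (y $$ (i, j) + y $$ (i, c) * a $$ (c, c))"
      using bracket_zero[OF a(1) y i] bracket_column[OF a(1) y i(1)] row_sum[OF jA a(2)] by simp
    then show ?thesis using column[OF y i] a(2) i by (simp split: if_splits)
  qed
  have diag: "y $$ (c, c) = 0" if "y \<in> I" for y
    using scalar_imp_zero[OF carrier[OF that] P[OF that]] scalar[OF that] by blast
  have row: "x $$ (c, j) = 0" if j: "j \<in> A" for j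
  proof -
    obtain a where a: "a \<in> S" "\<forall>l<n. l \<noteq> c \<longrightarrow> a $$ (l, c) = (if l = j then 1 else 0)"
      using unit_column[OF j] by blast
    \<comment> \<open>Up to the factor \<open>b\<close> the bracket lies in the ideal, so its entry
      \<open>(c, c)\<close> vanishes. As \<open>x $$ (c, c) = 0\<close>, this entry is
      \<open>- x $$ (c, j)\<close>.\<close>
    have "b \<cdot>\<^sub>m lie_bracket a x \<in> I" using ideal a(1) x .
    then have "(b \<cdot>\<^sub>m lie_bracket a x) $$ (c, c) = 0" by (rule diag)
    then have "lie_bracket a x $$ (c, c) = 0"
      using b c_less lie_bracket_carrier[OF S_carrier[OF a(1)] carrier[OF x]] by simp
    then show ?thesis
      using bracket_column[OF a(1) x c_less] row_sum[OF j a(2), of x c] diag[OF x] by simp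
  qed
  show ?thesis
  proof (rule columns_zero_imp_zero[OF carrier[OF x] P[OF x]])
    fix i j assume ij: "i < n" "j \<in> insert c A"
    show "x $$ (i, j) = 0"
    proof (cases "i = c")
      case True
      then show ?thesis using ij(2) row diag[OF x] by auto
    next
      case False
      then show ?thesis using scalar[OF x ij(1) False ij(2)] diag[OF x] by simp
    qed
  qed
qed

text \<open>The domain is \<open>\<pi> ^ m\<close> times \<open>M0 k\<close>, the part of the
  congruence lattice \<open>N\<close> that the conjugation maps into \<open>N\<close>; domain and
  image thus lie in every \<open>L\<close> above \<open>N\<close>. Scaling keeps indices, so the
  index of \<open>M\<close> in \<open>L\<close> is that of \<open>N\<close> in \<open>L\<close>
  times that of \<open>M0 k\<close> in \<open>S\<close>. Brackets of \<open>S\<close> with an ideal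
  of \<open>L\<close> are available up to the factor \<open>\<pi> ^ m\<close>, the \<open>b\<close>
  of \<open>invariant_ideal_trivial\<close>.\<close>

lemma self_similar_of_index_power:
  assumes k: "k > 0" and L: "lie_subalgebra Z n L" "(\<cdot>\<^sub>m) (\<pi> ^ m) ` S \<subseteq> L" "L \<subseteq> S"
  shows "self_similar_of_index p Z n L
    (add_index L ((\<cdot>\<^sub>m) (\<pi> ^ m) ` S) * card (residue_field R) ^ ((\<Sum>i\<in>A. d c - d i) * k))"
proof -
  define N where "N = (\<cdot>\<^sub>m) (\<pi> ^ m) ` S"
  define M where "M = (\<cdot>\<^sub>m) (\<pi> ^ m) ` M0 k"
  define \<phi> where "\<phi> = diag_conj n d (\<pi> ^ k)"
  have pim: "\<pi> ^ m \<noteq> 0" "\<pi> ^ m \<in> R" and pik: "\<pi> ^ k \<noteq> 0"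
    using pi_nonzero R_power[OF pi_in_R] by auto
  have L_sub: "is_submodule Z n L" using L(1) by (simp add: lie_subalgebra_def)
  have groups: "mat_subgroup n L" "mat_subgroup n N" "mat_subgroup n M" "mat_subgroup n (M0 k)"
    using L_sub S_multiples_submodule M0_submodule
    by (simp_all add: mat_subgroup_submodule mat_subgroup_smult N_def M_def)
  have MN: "M \<subseteq> N" using M0_subset by (auto simp: M_def N_def)
  have NL: "N \<subseteq> L" using L(2) by (simp add: N_def)
  have M_iff: "x \<in> M \<longleftrightarrow> x \<in> N \<and> \<phi> x \<in> N" for x
  proof
    assume "x \<in> M"
    then obtain y where y: "y \<in> S" "\<phi> y \<in> S" "x = \<pi> ^ m \<cdot>\<^sub>m y" by (auto simp: M_def M0_def \<phi>_def)
    then have "\<phi> x = \<pi> ^ m \<cdot>\<^sub>m \<phi> y" by (simp add: \<phi>_def diag_conj_smult S_carrier)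
    then show "x \<in> N \<and> \<phi> x \<in> N" using y by (auto simp: N_def)
  next
    assume "x \<in> N \<and> \<phi> x \<in> N"
    then obtain y z where yz: "y \<in> S" "x = \<pi> ^ m \<cdot>\<^sub>m y" "z \<in> S" "\<phi> x = \<pi> ^ m \<cdot>\<^sub>m z" by (auto simp: N_def)
    then have "\<pi> ^ m \<cdot>\<^sub>m \<phi> y = \<pi> ^ m \<cdot>\<^sub>m z" by (simp add: \<phi>_def diag_conj_smult S_carrier)
    then have "inverse (\<pi> ^ m) \<cdot>\<^sub>m (\<pi> ^ m \<cdot>\<^sub>m \<phi> y) = inverse (\<pi> ^ m) \<cdot>\<^sub>m (\<pi> ^ m \<cdot>\<^sub>m z)" by simp
    moreover have "inverse (\<pi> ^ m) \<cdot>\<^sub>m (\<pi> ^ m \<cdot>\<^sub>m u) = u" for u :: "'k mat"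
      unfolding smult_smult_mat using pim(1) by (intro eq_matI) auto
    ultimately have "\<phi> y = z" by simp
    then show "x \<in> M" using yz by (auto simp: M_def M0_def \<phi>_def)
  qed
  have carrier: "x \<in> carrier_mat n n" if "x \<in> N" for x
    using that by (auto simp: N_def S_carrier)
  have N_sub: "is_submodule Z n N" unfolding N_def by (rule S_multiples_submodule)
  have N_bracket: "lie_bracket x y \<in> N" if "x \<in> N" "y \<in> N" for x y
    using S_multiples_lie_bracket[OF pim(2)] that by (simp add: N_def)
  have \<phi>_add: "\<phi> (x + y) = \<phi> x + \<phi> y" and \<phi>_smult: "\<phi> (z \<cdot>\<^sub>m x) = z \<cdot>\<^sub>m \<phi> x"
    and \<phi>_bracket: "\<phi> (lie_bracket x y) = lie_bracket (\<phi> x) (\<phi> y)" if "x \<in> N" "y \<in> N" for x y z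
    using carrier[OF that(1)] carrier[OF that(2)] pik
    by (simp_all add: \<phi>_def diag_conj_add diag_conj_smult diag_conj_lie_bracket)
  have "0\<^sub>m n n \<in> N" "\<phi> (0\<^sub>m n n) = 0\<^sub>m n n"
    using N_sub by (simp_all add: is_submodule_def \<phi>_def diag_conj_zero)
  then have M_sub: "lie_subalgebra Z n M"
    using N_sub N_bracket carrier
    by (auto simp: lie_subalgebra_def is_submodule_def M_iff \<phi>_add \<phi>_smult \<phi>_bracket)
  have virtual: "virtual_endomorphism Z n L M \<phi>"
    unfolding virtual_endomorphism_def
    using M_sub MN NL by (auto simp: M_iff \<phi>_add \<phi>_smult \<phi>_bracket)
  have "I = {0\<^sub>m n n}" if I: "lie_ideal Z n L I" "I \<subseteq> M" "\<phi> ` I \<subseteq> I" for I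
  proof -
    have "x = 0\<^sub>m n n" if x: "x \<in> I" for x
    proof (rule invariant_ideal_trivial[OF k pim(1) _ _ _ x])
      show "I \<subseteq> S" using I(1) L(3) by (auto simp: lie_ideal_def)
      show "diag_conj n d (\<pi> ^ k) y \<in> I" if "y \<in> I" for y using I(3) that by (auto simp: \<phi>_def)
      fix a y assume ay: "a \<in> S" "y \<in> I"
      then have "\<pi> ^ m \<cdot>\<^sub>m a \<in> L" using L(2) by auto
      then have "lie_bracket (\<pi> ^ m \<cdot>\<^sub>m a) y \<in> I" using I(1) ay(2) by (auto simp: lie_ideal_def)
      moreover have "y \<in> carrier_mat n n" using ay(2) I(2) MN carrier by auto
      ultimately show "\<pi> ^ m \<cdot>\<^sub>m lie_bracket a y \<in> I"
        using ay(1) by (simp add: lie_bracket_smult_left[of _ n] S_carrier)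
    qed
    moreover have "0\<^sub>m n n \<in> I" using I(1) by (simp add: lie_ideal_def is_submodule_def)
    ultimately show ?thesis by blast
  qed
  then have simple: "simple_virtual_endomorphism Z n L M \<phi>"
    using virtual by (auto simp: simple_virtual_endomorphism_def)
  have index: "add_index L M = add_index L N * card (residue_field R) ^ ((\<Sum>i\<in>A. d c - d i) * k)"
    using add_index_tower(1)[OF groups(1-3) MN NL] add_index_smult(1)[OF pim(1) S_subset groups(4)]
      card_S_mod_M0(1)[of k] by (simp add: N_def M_def mult.commute)
  have "finite (cosets_in N M)"
    using add_index_smult(2)[OF pim(1) S_subset groups(4)] card_S_mod_M0(2) by (simp add: N_def M_def)
  moreover have "finite (cosets_in L N)"
    using finite_cosets_in_subset[OF finite_S_mod_pi_power L(3) S_subset groups(2)[unfolded N_def]]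
    by (simp add: N_def)
  ultimately have finite: "finite (cosets_in L M)"
    using add_index_tower(2)[OF groups(1-3) MN NL] by simp
  have "\<exists>j. add_index L M = p ^ j"
  proof (rule add_index_prime_power[OF prime_p groups(1,3) _ finite])
    show "M \<subseteq> L" using MN NL by auto
    fix x assume "x \<in> L"
    then have x: "x \<in> S" using L(3) by auto
    \<comment> \<open>The factor \<open>\<pi> ^ m\<close> brings \<open>x\<close> into the
      congruence lattice, and \<open>\<pi> ^ (k * d c)\<close> meets all conditions on the column
      since \<open>d c - d i \<le> d c\<close>. The power of \<open>p\<close> with the summed
      exponent is a multiple of their product.\<close>
    have "of_nat p ^ (m + k * d c) \<in> (*) (\<pi> ^ (m + k * d c)) ` R"
      using multiples_power_subset[OF p_in_pi_R, of "m + k * d c"] R_one by force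
    then obtain r where r: "r \<in> R" "of_nat p ^ (m + k * d c) = \<pi> ^ (m + k * d c) * r" by auto
    define y where "y = (\<pi> ^ (k * d c) * r) \<cdot>\<^sub>m x"
    have y: "y \<in> S" unfolding y_def by (intro S_smult R_mult R_power pi_in_R r(1) x)
    have "y \<in> M0 k"
      unfolding mem_M0_iff[OF y]
    proof
      fix i assume i: "i \<in> A"
      have "y $$ (i, c) = \<pi> ^ (k * d c) * (r * x $$ (i, c))"
        using S_carrier[OF x] A_D(1)[OF i] c_less by (simp add: y_def)
      moreover have "r * x $$ (i, c) \<in> R" using r(1) x A_D(1)[OF i] c_less by (auto simp: mem_S_iff intro: R_mult)
      ultimately show "y $$ (i, c) \<in> (*) (\<pi> ^ (k * (d c - d i))) ` R"
        using multiples_power_mono[OF pi_in_R, of "k * (d c - d i)" "k * d c"] by auto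
    qed
    moreover have "of_nat (p ^ (m + k * d c)) \<cdot>\<^sub>m x = \<pi> ^ m \<cdot>\<^sub>m y"
      unfolding of_nat_power r(2) y_def smult_smult_mat by (simp add: power_add mult.assoc)
    ultimately show "of_nat (p ^ (m + k * d c)) \<cdot>\<^sub>m x \<in> M" by (simp add: M_def)
  qed
  then obtain j where "add_index L M = p ^ j" ..
  then show ?thesis
    using simple index unfolding self_similar_of_index_def N_def by metis
qed

end

lemma self_similarI:
  assumes "self_similar_of_index p Z n L N" shows "self_similar p Z n L"
proof -
  obtain j where "N = p ^ j" using assms by (auto simp: self_similar_of_index_def)
  then show ?thesis using assms by (auto simp: self_similar_def)
qed

text \<open>As all brackets vanish, scalar multiplication is a homomorphism. An ideal stable under
  division by \<open>p\<close> has entries divisible by every power of \<open>p\<close>. The index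
  of \<open>M\<close> in \<open>L\<close> is finite because \<open>M\<close> contains a congruence
  lattice.\<close>

lemma (in matrix_lattice) abelian_self_similar:
  assumes abelian: "\<And>x y. x \<in> S \<Longrightarrow> y \<in> S \<Longrightarrow> lie_bracket x y = 0\<^sub>m n n"
    and L: "is_submodule Z n L" "L \<subseteq> S" "finite (cosets_in S L)"
  shows "self_similar p Z n L"
proof -
  let ?p = "of_nat p :: 'k"
  define M where "M = (\<cdot>\<^sub>m) ?p ` L"
  define \<phi> where "\<phi> = (\<cdot>\<^sub>m) (inverse ?p)"
  have L_carrier: "x \<in> carrier_mat n n" if "x \<in> L" for x using that L(2) S_carrier by auto
  have L_zero: "0\<^sub>m n n \<in> L" using L(1) by (simp add: is_submodule_def)
  have L_add: "x + y \<in> L" if "x \<in> L" "y \<in> L" for x y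
    using L(1) that by (simp add: is_submodule_def)
  have L_smult: "z \<cdot>\<^sub>m x \<in> L" if "z \<in> Z" "x \<in> L" for x z
    using L(1) that by (simp add: is_submodule_def)
  have M_L: "M \<subseteq> L" using L_smult Z_of_nat by (auto simp: M_def)
  have M_carrier: "x \<in> carrier_mat n n" if "x \<in> M" for x using that M_L L_carrier by auto
  have \<phi>_p: "\<phi> (?p \<cdot>\<^sub>m x) = x" for x
    unfolding \<phi>_def smult_smult_mat using of_nat_p_nonzero by (intro eq_matI) auto
  have M_sub: "is_submodule Z n M"
    unfolding is_submodule_def
  proof (intro conjI ballI subsetI)
    show "0\<^sub>m n n \<in> M" unfolding M_def using L_zero by (intro image_eqI[of _ _ "0\<^sub>m n n"]) auto
    fix x assume "x \<in> M"
    then obtain a where a: "a \<in> L" "x = ?p \<cdot>\<^sub>m a" by (auto simp: M_def)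
    {
      fix y assume "y \<in> M"
      then obtain b where b: "b \<in> L" "y = ?p \<cdot>\<^sub>m b" by (auto simp: M_def)
      have "x + y = ?p \<cdot>\<^sub>m (a + b)"
        using add_smult_distrib_left_mat[OF L_carrier[OF a(1)] L_carrier[OF b(1)]] a b by simp
      then show "x + y \<in> M" unfolding M_def using L_add[OF a(1) b(1)] by blast
    }
    fix z assume "z \<in> Z"
    then have "z \<cdot>\<^sub>m x = ?p \<cdot>\<^sub>m (z \<cdot>\<^sub>m a)" "z \<cdot>\<^sub>m a \<in> L"
      using L_smult[OF _ a(1)] by (simp_all add: a(2) smult_smult_mat mult.commute)
    then show "z \<cdot>\<^sub>m x \<in> M" unfolding M_def by blast
  qed (rule M_carrier)
  have bracket: "lie_bracket x y = 0\<^sub>m n n" if "x \<in> L" "y \<in> L" for x y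
    using abelian that L(2) by auto
  have \<phi>_L: "\<phi> x \<in> L" if "x \<in> M" for x using that \<phi>_p by (auto simp: M_def)
  have \<phi>_zero: "\<phi> (0\<^sub>m n n) = 0\<^sub>m n n" unfolding \<phi>_def by (rule eq_matI) auto
  have virtual: "virtual_endomorphism Z n L M \<phi>"
    unfolding virtual_endomorphism_def lie_subalgebra_def
  proof (intro conjI ballI)
    show "\<phi> ` M \<subseteq> L" using \<phi>_L by auto
    fix x y assume xy: "x \<in> M" "y \<in> M"
    then have "x \<in> L" "y \<in> L" using M_L by auto
    then show "lie_bracket x y \<in> M" using bracket M_sub by (simp add: is_submodule_def)
    show "\<phi> (x + y) = \<phi> x + \<phi> y"
      unfolding \<phi>_def using add_smult_distrib_left_mat[OF M_carrier[OF xy(1)] M_carrier[OF xy(2)]] .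
    show "\<phi> (lie_bracket x y) = lie_bracket (\<phi> x) (\<phi> y)"
      using bracket \<phi>_L xy \<open>x \<in> L\<close> \<open>y \<in> L\<close> \<phi>_zero by simp
  next
    fix z x assume "x \<in> M"
    show "\<phi> (z \<cdot>\<^sub>m x) = z \<cdot>\<^sub>m \<phi> x" by (simp add: \<phi>_def smult_smult_mat mult.commute)
  qed (use M_sub M_L in auto)
  have "I = {0\<^sub>m n n}" if I: "lie_ideal Z n L I" "I \<subseteq> M" "\<phi> ` I \<subseteq> I" for I
  proof -
    have "x = 0\<^sub>m n n" if x: "x \<in> I" for x
    proof (rule eq_matI)
      have iter: "inverse (?p ^ j) \<cdot>\<^sub>m x \<in> I" for j
      proof (induction j)
        case 0
        have "inverse (?p ^ 0) \<cdot>\<^sub>m x = x" by (rule eq_matI) auto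
        then show ?case using x by simp
      next
        case (Suc j)
        then have "\<phi> (inverse (?p ^ j) \<cdot>\<^sub>m x) \<in> I" using I(3) by auto
        then show ?case by (simp add: \<phi>_def smult_smult_mat)
      qed
      fix i j assume "i < dim_row (0\<^sub>m n n :: 'k mat)" "j < dim_col (0\<^sub>m n n :: 'k mat)"
      then have ij: "i < n" "j < n" by auto
      have xc: "x \<in> carrier_mat n n" using x I(2) M_carrier by auto
      have "x $$ (i, j) = 0"
      proof (rule p_divisible_imp_zero)
        fix l
        have "inverse (?p ^ l) \<cdot>\<^sub>m x \<in> S" using iter[of l] I(2) M_L L(2) by blast
        then have "inverse (?p ^ l) * x $$ (i, j) \<in> R" using ij xc by (auto simp: mem_S_iff)
        moreover have "x $$ (i, j) = ?p ^ l * (inverse (?p ^ l) * x $$ (i, j))"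
          using of_nat_p_nonzero by simp
        ultimately show "x $$ (i, j) \<in> (*) (?p ^ l) ` R" by blast
      qed
      then show "x $$ (i, j) = 0\<^sub>m n n $$ (i, j)" using ij by simp
    qed (use x I(2) M_carrier in auto)
    moreover have "0\<^sub>m n n \<in> I" using I(1) by (simp add: lie_ideal_def is_submodule_def)
    ultimately show ?thesis by blast
  qed
  then have simple: "simple_virtual_endomorphism Z n L M \<phi>"
    using virtual by (auto simp: simple_virtual_endomorphism_def)
  obtain m where m: "(\<cdot>\<^sub>m) (\<pi> ^ m) ` S \<subseteq> L" using finite_index_imp_congruence[OF L] .
  obtain e where e: "\<pi> ^ e \<in> (*) ?p ` R" using ex_pi_power_in_p_R by blast
  have C: "(\<cdot>\<^sub>m) (\<pi> ^ (m + e)) ` S \<subseteq> M"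
  proof
    fix y assume "y \<in> (\<cdot>\<^sub>m) (\<pi> ^ (m + e)) ` S"
    then obtain x where x: "x \<in> S" "y = \<pi> ^ (m + e) \<cdot>\<^sub>m x" by auto
    obtain r where r: "r \<in> R" "\<pi> ^ e = ?p * r" using e by auto
    have "y = ?p \<cdot>\<^sub>m (\<pi> ^ m \<cdot>\<^sub>m (r \<cdot>\<^sub>m x))"
      unfolding x(2) power_add r(2) smult_smult_mat by (simp add: mult_ac)
    moreover have "\<pi> ^ m \<cdot>\<^sub>m (r \<cdot>\<^sub>m x) \<in> L" using m S_smult[OF r(1) x(1)] by blast
    ultimately show "y \<in> M" unfolding M_def by blast
  qed
  have groups: "mat_subgroup n L" "mat_subgroup n M" "mat_subgroup n ((\<cdot>\<^sub>m) (\<pi> ^ (m + e)) ` S)"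
    using L(1) M_sub S_multiples_submodule by (simp_all add: mat_subgroup_submodule)
  have "finite (cosets_in L ((\<cdot>\<^sub>m) (\<pi> ^ (m + e)) ` S))"
    by (rule finite_cosets_in_subset[OF finite_S_mod_pi_power L(2) S_subset groups(3)])
  then have "finite (cosets_in L M)" by (rule add_index_tower(3)[OF groups C M_L])
  then have "\<exists>j. add_index L M = p ^ j"
    by (rule add_index_prime_power[OF prime_p groups(1,2) M_L, of 1]) (auto simp: M_def)
  then show ?thesis
    using simple unfolding self_similar_def self_similar_of_index_def by metis
qed

lemma (in graded_lattice) finite_index_self_similar:
  assumes "lie_subalgebra Z n L" "L \<subseteq> S" "finite (cosets_in S L)"
  shows "self_similar p Z n L"
proof -
  obtain m where m: "(\<cdot>\<^sub>m) (\<pi> ^ m) ` S \<subseteq> L"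
    using finite_index_imp_congruence[of L] assms by (auto simp: lie_subalgebra_def)
  show ?thesis
    using self_similar_of_index_power[of 1, OF _ assms(1) m assms(2)]
    by (auto intro: self_similarI)
qed

section \<open>The classical lattices\<close>

context padic_uniformizer
begin

abbreviation trace_zero :: "nat \<Rightarrow> 'k mat \<Rightarrow> bool" where
  "trace_zero n x \<equiv> (\<Sum>i<n. x $$ (i, i)) = 0"

lemma sl_matrix_lattice: "matrix_lattice p Q v \<pi> n (trace_zero n)"
proof unfold_locales
  fix x y :: "'k mat" assume xy: "x \<in> carrier_mat n n" "y \<in> carrier_mat n n"
  show "trace_zero n (x + y)" if "trace_zero n x" "trace_zero n y"
    using that xy by (simp add: sum.distrib)
  have "(\<Sum>i<n. \<Sum>l<n. x $$ (i, l) * y $$ (l, i)) = (\<Sum>i<n. \<Sum>l<n. y $$ (i, l) * x $$ (l, i))"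
    by (subst sum.swap) (simp add: mult.commute)
  then show "trace_zero n (lie_bracket x y)"
    using xy by (simp add: lie_bracket_index[of _ n] sum_subtractf)
next
  fix x :: "'k mat" and r assume "x \<in> carrier_mat n n" "trace_zero n x"
  then show "trace_zero n (r \<cdot>\<^sub>m x)" by (simp flip: sum_distrib_left)
qed simp

text \<open>The entries of column 0 below the diagonal are unconstrained, and conjugation fixes the
  diagonal, hence the trace. A scalar matrix of trace zero vanishes because \<open>n\<close> is
  invertible in characteristic 0.\<close>

lemma sl_graded_lattice:
  assumes "n \<ge> 2"
  shows "graded_lattice p Q v \<pi> n (trace_zero n) 0 ({..<n} - {0}) (\<lambda>i. if i = 0 then 1 else 0)"
    (is "graded_lattice _ _ _ _ _ _ _ ?A ?d")
proof -
  interpret matrix_lattice p Q v \<pi> n "trace_zero n" by (rule sl_matrix_lattice)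
  have P_conj: "trace_zero n (diag_conj n ?d t x)" if "t \<noteq> 0" "trace_zero n x" for t and x :: "'k mat"
  proof -
    have "(\<Sum>i<n. diag_conj n ?d t x $$ (i, i)) = (\<Sum>i<n. x $$ (i, i))"
      by (rule sum.cong) (use that(1) in auto)
    then show ?thesis using that(2) by simp
  qed
  show ?thesis
  proof unfold_locales
    fix r :: "nat \<Rightarrow> 'k" assume r: "\<And>i. i \<in> ?A \<Longrightarrow> r i \<in> R"
    define a where "a = mat n n (\<lambda>(i, j). if j = 0 \<and> i \<noteq> 0 then r i else 0)"
    have "trace_zero n a" by (auto simp: a_def intro!: sum.neutral)
    then have "a \<in> S" using r by (auto simp: mem_S_iff a_def R_zero)
    then show "\<exists>a\<in>S. \<forall>i\<in>?A. a $$ (i, 0) = r i"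
      using assms by (intro bexI[of _ a]) (auto simp: a_def)
  next
    fix x :: "'k mat" assume "trace_zero n x"
      and scalar: "\<And>i j. i < n \<Longrightarrow> i \<noteq> 0 \<Longrightarrow> j \<in> insert 0 ?A \<Longrightarrow>
        x $$ (i, j) = (if i = j then x $$ (0, 0) else 0)"
    have "x $$ (i, i) = x $$ (0, 0)" if "i \<in> {..<n}" for i
      using scalar[of i i] that by (cases "i = 0") auto
    then have "(\<Sum>i<n. x $$ (i, i)) = (\<Sum>i<n. x $$ (0, 0))" by (rule sum.cong[OF refl])
    also have "\<dots> = of_nat n * x $$ (0, 0)" by simp
    finally have "(\<Sum>i<n. x $$ (i, i)) = of_nat n * x $$ (0, 0)" .
    then show "x $$ (0, 0) = 0" using \<open>trace_zero n x\<close> assms by simp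
  next
    fix x :: "'k mat" assume "x \<in> carrier_mat n n"
      and "\<And>i j. i < n \<Longrightarrow> j \<in> insert 0 ?A \<Longrightarrow> x $$ (i, j) = 0"
    then show "x = 0\<^sub>m n n" by (intro eq_matI) auto
  next
    fix x t assume x: "x \<in> S" and t: "t \<in> R" "t \<noteq> 0"
      and div: "\<And>i. i \<in> ?A \<Longrightarrow> x $$ (i, 0) \<in> (*) (t ^ (?d 0 - ?d i)) ` R"
    have "diag_conj n ?d t x $$ (i, j) \<in> R" if "i < n" "j < n" for i j
    proof (cases "j = 0 \<and> i \<noteq> 0")
      case True
      then show ?thesis using div[of i] that t(2) by auto
    next
      case False
      then show ?thesis using x that t by (auto simp: mem_S_iff intro: R_mult)
    qed
    then show "diag_conj n ?d t x \<in> S" using x t(2) P_conj by (simp add: mem_S_iff)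
  qed (use assms in auto)
qed

end

text \<open>
  The forms defining the symplectic and orthogonal lattices have matrices \<open>s\<close> with a single
  entry \<open>h i = 1\<close> or \<open>h i = - 1\<close> in row \<open>i\<close>, in column \<open>\<tau> i\<close>; the sign \<open>\<epsilon>\<close> is \<open>- 1\<close> for alternating
  and \<open>1\<close> for symmetric forms.
\<close>

locale signed_form = padic_uniformizer p Q v \<pi>
  for p :: nat and Q :: "'k::field_char_0 set" and v :: "'k \<Rightarrow> real" and \<pi> :: 'k +
  fixes n :: nat and s :: "'k mat" and \<tau> :: "nat \<Rightarrow> nat" and h :: "nat \<Rightarrow> 'k" and \<epsilon> :: 'k
  assumes tau_less: "i < n \<Longrightarrow> \<tau> i < n" and tau_tau: "i < n \<Longrightarrow> \<tau> (\<tau> i) = i"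
    and h_sign: "i < n \<Longrightarrow> h i = 1 \<or> h i = - 1"
    and eps_sign: "\<epsilon> = 1 \<or> \<epsilon> = - 1"
    and h_tau: "i < n \<Longrightarrow> h (\<tau> i) = \<epsilon> * h i"
    and s_carrier: "s \<in> carrier_mat n n"
    and s_index: "i < n \<Longrightarrow> j < n \<Longrightarrow> s $$ (i, j) = (if j = \<tau> i then h i else 0)"
begin

abbreviation preserves :: "'k mat \<Rightarrow> bool" where
  "preserves x \<equiv> s * x + transpose_mat x * s = 0\<^sub>m n n"

lemma h_square: "i < n \<Longrightarrow> h i * h i = 1" and eps_square: "\<epsilon> * \<epsilon> = 1"
  using h_sign[of i] eps_sign by auto

lemma h_in_R: "i < n \<Longrightarrow> h i \<in> R"
  using h_sign[of i] R_one R_uminus by auto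

lemma form_index:
  assumes x: "x \<in> carrier_mat n n" and ij: "i < n" "j < n"
  shows "(s * x + transpose_mat x * s) $$ (i, j) = h i * x $$ (\<tau> i, j) + h (\<tau> j) * x $$ (\<tau> j, i)"
proof -
  have xt: "transpose_mat x \<in> carrier_mat n n" using x by simp
  have "(s * x) $$ (i, j) = (\<Sum>l<n. if l = \<tau> i then h i * x $$ (l, j) else 0)"
    unfolding mult_mat_index[OF s_carrier x ij] using ij by (intro sum.cong) (auto simp: s_index)
  also have "\<dots> = h i * x $$ (\<tau> i, j)" using tau_less[OF ij(1)] by simp
  finally have 1: "(s * x) $$ (i, j) = h i * x $$ (\<tau> i, j)" .
  have "(transpose_mat x * s) $$ (i, j) = (\<Sum>l<n. if l = \<tau> j then h l * x $$ (l, i) else 0)"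
    unfolding mult_mat_index[OF xt s_carrier ij]
  proof (rule sum.cong)
    fix l assume "l \<in> {..<n}"
    then have l: "l < n" by simp
    then have "j = \<tau> l \<longleftrightarrow> l = \<tau> j" using tau_tau[OF l] tau_tau[OF ij(2)] by metis
    then show "transpose_mat x $$ (i, l) * s $$ (l, j) = (if l = \<tau> j then h l * x $$ (l, i) else 0)"
      using l ij x by (simp add: s_index)
  qed simp
  also have "\<dots> = h (\<tau> j) * x $$ (\<tau> j, i)" using tau_less[OF ij(2)] by simp
  finally show ?thesis using 1 s_carrier x ij by simp
qed

text \<open>Solving entry \<open>(\<tau> i, j)\<close> of the defining equation for
  \<open>x $$ (i, j)\<close>, with signs squaring to 1, turns membership into a symmetry: entry
  \<open>(i, j)\<close> is mirrored, up to sign, in entry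
  \<open>(\<tau> j, \<tau> i)\<close>.\<close>

lemma preserves_iff:
  assumes x: "x \<in> carrier_mat n n"
  shows "preserves x \<longleftrightarrow> (\<forall>i<n. \<forall>j<n. x $$ (i, j) = - (h i * h j * x $$ (\<tau> j, \<tau> i)))"
proof
  assume P: "preserves x"
  show "\<forall>i<n. \<forall>j<n. x $$ (i, j) = - (h i * h j * x $$ (\<tau> j, \<tau> i))"
  proof (intro allI impI)
    fix i j assume ij: "i < n" "j < n"
    have "h (\<tau> i) * x $$ (i, j) + h (\<tau> j) * x $$ (\<tau> j, \<tau> i) = 0"
      using form_index[OF x tau_less[OF ij(1)] ij(2)] P tau_tau ij tau_less by simp
    then have "\<epsilon> * h i * (\<epsilon> * h i * x $$ (i, j) + \<epsilon> * h j * x $$ (\<tau> j, \<tau> i)) = 0"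
      using h_tau ij by simp
    moreover have "\<epsilon> * h i * (\<epsilon> * h i * x $$ (i, j) + \<epsilon> * h j * x $$ (\<tau> j, \<tau> i))
        = (\<epsilon> * \<epsilon>) * (h i * h i) * x $$ (i, j) + (\<epsilon> * \<epsilon>) * (h i * h j * x $$ (\<tau> j, \<tau> i))"
      by (simp add: algebra_simps)
    ultimately show "x $$ (i, j) = - (h i * h j * x $$ (\<tau> j, \<tau> i))"
      using h_square[OF ij(1)] eps_square by (simp add: eq_neg_iff_add_eq_0)
  qed
next
  assume rel: "\<forall>i<n. \<forall>j<n. x $$ (i, j) = - (h i * h j * x $$ (\<tau> j, \<tau> i))"
  show "preserves x"
  proof (rule eq_matI)
    fix i j assume "i < dim_row (0\<^sub>m n n :: 'k mat)" "j < dim_col (0\<^sub>m n n :: 'k mat)"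
    then have ij: "i < n" "j < n" by auto
    have "h i * x $$ (\<tau> i, j) = - (\<epsilon> * (h i * h i) * h j * x $$ (\<tau> j, i))"
      using rel[rule_format, OF tau_less[OF ij(1)] ij(2)] h_tau[OF ij(1)] tau_tau[OF ij(1)]
      by (simp add: mult_ac)
    then have "h i * x $$ (\<tau> i, j) + h (\<tau> j) * x $$ (\<tau> j, i) = 0"
      using h_square[OF ij(1)] h_tau[OF ij(2)] by simp
    then show "(s * x + transpose_mat x * s) $$ (i, j) = 0\<^sub>m n n $$ (i, j)"
      using form_index[OF x ij] ij by simp
  qed (use x s_carrier in auto)
qed

lemma preserves_index:
  "x \<in> carrier_mat n n \<Longrightarrow> preserves x \<Longrightarrow> i < n \<Longrightarrow> j < n \<Longrightarrow>
    x $$ (i, j) = - (h i * h j * x $$ (\<tau> j, \<tau> i))"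
  using preserves_iff[of x] by blast

text \<open>Adjoints with respect to the form reverse products, and the two minus signs from
  \<open>preserves_index\<close> cancel. Hence the commutator of \<open>x\<close> and
  \<open>y\<close> again equals minus its adjoint.\<close>

lemma preserves_mult:
  assumes "x \<in> carrier_mat n n" "y \<in> carrier_mat n n" "preserves x" "preserves y" "i < n" "j < n"
  shows "(\<Sum>l<n. x $$ (i, l) * y $$ (l, j)) = h i * h j * (\<Sum>l<n. y $$ (\<tau> j, l) * x $$ (l, \<tau> i))"
proof -
  have "(\<Sum>l<n. x $$ (i, l) * y $$ (l, j)) = (\<Sum>l<n. h i * h j * (y $$ (\<tau> j, \<tau> l) * x $$ (\<tau> l, \<tau> i)))"
  proof (rule sum.cong)
    fix l assume "l \<in> {..<n}"
    then have l: "l < n" by simp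
    have "x $$ (i, l) * y $$ (l, j) = (h l * h l) * (h i * h j * (y $$ (\<tau> j, \<tau> l) * x $$ (\<tau> l, \<tau> i)))"
      unfolding preserves_index[OF assms(1,3,5) l] preserves_index[OF assms(2,4) l assms(6)]
      by (simp only: minus_mult_minus mult_ac)
    then show "x $$ (i, l) * y $$ (l, j) = h i * h j * (y $$ (\<tau> j, \<tau> l) * x $$ (\<tau> l, \<tau> i))"
      using h_square[OF l] by simp
  qed simp
  also have "\<dots> = h i * h j * (\<Sum>l<n. y $$ (\<tau> j, \<tau> l) * x $$ (\<tau> l, \<tau> i))"
    by (simp add: sum_distrib_left)
  also have "(\<Sum>l<n. y $$ (\<tau> j, \<tau> l) * x $$ (\<tau> l, \<tau> i)) = (\<Sum>l<n. y $$ (\<tau> j, l) * x $$ (l, \<tau> i))"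
    by (rule sum.reindex_bij_witness[of _ \<tau> \<tau>]) (auto simp: tau_tau tau_less)
  finally show ?thesis .
qed

lemma form_matrix_lattice: "matrix_lattice p Q v \<pi> n preserves"
proof unfold_locales
  show "preserves (0\<^sub>m n n)" by (subst preserves_iff) (auto simp: tau_less)
  fix x :: "'k mat" assume x: "x \<in> carrier_mat n n" and Px: "preserves x"
  show "preserves (r \<cdot>\<^sub>m x)" for r
  proof (subst preserves_iff, use x in simp, intro allI impI)
    fix i j assume ij: "i < n" "j < n"
    show "(r \<cdot>\<^sub>m x) $$ (i, j) = - (h i * h j * (r \<cdot>\<^sub>m x) $$ (\<tau> j, \<tau> i))"
      using preserves_index[OF x Px ij] x ij tau_less by (simp add: mult_ac)
  qed
  fix y :: "'k mat" assume y: "y \<in> carrier_mat n n" and Py: "preserves y"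
  show "preserves (x + y)"
  proof (subst preserves_iff, use x y in simp, intro allI impI)
    fix i j assume ij: "i < n" "j < n"
    show "(x + y) $$ (i, j) = - (h i * h j * (x + y) $$ (\<tau> j, \<tau> i))"
      using preserves_index[OF x Px ij] preserves_index[OF y Py ij] x y ij tau_less
      by (simp add: distrib_left)
  qed
  show "preserves (lie_bracket x y)"
  proof (subst preserves_iff, rule lie_bracket_carrier[OF x y], intro allI impI)
    fix i j assume ij: "i < n" "j < n"
    show "lie_bracket x y $$ (i, j) = - (h i * h j * lie_bracket x y $$ (\<tau> j, \<tau> i))"
      unfolding lie_bracket_index[OF x y ij] lie_bracket_index[OF x y tau_less[OF ij(2)] tau_less[OF ij(1)]]
        preserves_mult[OF x y Px Py ij] preserves_mult[OF y x Py Px ij]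
      by (simp add: right_diff_distrib)
  qed
qed

text \<open>Since \<open>\<tau> c \<noteq> c\<close>, the basis vector at \<open>c\<close> is
  isotropic with partner \<open>\<tau> c\<close>. The weights satisfy
  \<open>d i + d (\<tau> i) = 2\<close>, so the diagonal matrix multiplies the form by
  \<open>t ^ 2\<close> and conjugation preserves the algebra. For \<open>\<epsilon> = 1\<close>
  entry \<open>(\<tau> c, c)\<close> is its own negative, which is why \<open>\<tau> c\<close> is
  left out of \<open>A\<close>. The index \<open>j0\<close> excludes scalars: the diagonal entries
  at \<open>j0\<close> and \<open>\<tau> j0\<close> are opposite.\<close>

lemma form_graded_lattice:
  assumes c: "c < n" "\<tau> c \<noteq> c"
    and A: "A = {i. i < n \<and> i \<noteq> c \<and> (i = \<tau> c \<longrightarrow> \<epsilon> = - 1)}"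
    and j0: "j0 \<in> A" "\<tau> j0 \<in> insert c A"
    and d: "d = (\<lambda>i. if i = c then 2 else if i = \<tau> c then 0 else (1::nat))"
  shows "graded_lattice p Q v \<pi> n preserves c A d"
proof -
  interpret matrix_lattice p Q v \<pi> n preserves by (rule form_matrix_lattice)
  have tau_c: "\<tau> i = c \<longleftrightarrow> i = \<tau> c" if "i < n" for i
    using tau_tau[OF that] tau_tau[OF c(1)] by metis
  have d_sum: "d i + d (\<tau> i) = 2" if "i < n" for i
    using tau_c[OF that] tau_tau[OF c(1)] c(2) that tau_tau[OF that] unfolding d by auto
  have zero_if_neg: "z = 0" if "z = - z" for z :: 'k
    using that by (simp add: eq_neg_iff_add_eq_0)
  have eps_c: "h (\<tau> c) * h c = \<epsilon>" "h c * h (\<tau> c) = \<epsilon>"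
    using h_tau[OF c(1)] h_square[OF c(1)] by (simp_all add: mult.assoc mult.left_commute)
  have P_conj: "preserves (diag_conj n d t x)"
    if x: "x \<in> carrier_mat n n" and t: "t \<noteq> 0" and Px: "preserves x" for t and x :: "'k mat"
  proof (subst preserves_iff, simp, intro allI impI)
    fix i j assume ij: "i < n" "j < n"
    have "t ^ d i * t ^ d (\<tau> i) = t ^ d j * t ^ d (\<tau> j)"
      using d_sum[OF ij(1)] d_sum[OF ij(2)] by (simp flip: power_add)
    then have "t ^ d i / t ^ d j = t ^ d (\<tau> j) / t ^ d (\<tau> i)"
      using t by (simp add: frac_eq_eq mult_ac)
    moreover have "diag_conj n d t x $$ (i, j) = t ^ d i / t ^ d j * x $$ (i, j)" using ij by simp
    moreover have "diag_conj n d t x $$ (\<tau> j, \<tau> i) = t ^ d (\<tau> j) / t ^ d (\<tau> i) * x $$ (\<tau> j, \<tau> i)"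
      using ij tau_less by simp
    ultimately show "diag_conj n d t x $$ (i, j) = - (h i * h j * diag_conj n d t x $$ (\<tau> j, \<tau> i))"
      using preserves_index[OF x Px ij] by (simp only: mult_ac mult_minus_right)
  qed
  have column_0: "x $$ (i, c) = 0"
    if x: "x \<in> carrier_mat n n" "preserves x" and i: "i < n" "i \<noteq> c" "i \<notin> A" for x :: "'k mat" and i
  proof -
    have i: "i = \<tau> c" "\<epsilon> = 1" using i A eps_sign by auto
    have "x $$ (\<tau> c, c) = - (h (\<tau> c) * h c * x $$ (\<tau> c, c))"
      using preserves_index[OF x tau_less[OF c(1)] c(1)] tau_tau[OF c(1)] by simp
    then show ?thesis unfolding i(1) eps_c i(2) using zero_if_neg by simp
  qed
  show ?thesis
  proof unfold_locales
    show "c < n" by (rule c)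
    show "A \<subseteq> {..<n} - {c}" using A by auto
    show "d i < d c" if "i \<in> A" for i using that by (auto simp: A d)
    show "x $$ (i, c) = 0"
      if "x \<in> carrier_mat n n" "preserves x" "i < n" "i \<noteq> c" "i \<notin> A" for x i
      using column_0 that by blast
  next
    fix r :: "nat \<Rightarrow> 'k" assume r: "\<And>i. i \<in> A \<Longrightarrow> r i \<in> R"
    define r' where "r' i = (if i \<in> A then r i else 0)" for i
    have r'_R: "r' i \<in> R" for i using r R_zero by (simp add: r'_def)
    \<comment> \<open>\<open>a\<close> has the prescribed column \<open>c\<close> and, in row
      \<open>\<tau> c\<close>, the mirror images forced by the form.\<close>
    define a where "a = mat n n (\<lambda>(i, j). if j = c then r' i
      else if i = \<tau> c then - (h i * h j * r' (\<tau> j)) else 0)"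
    have a_index: "a $$ (i, j) = (if j = c then r' i
      else if i = \<tau> c then - (h i * h j * r' (\<tau> j)) else 0)" if "i < n" "j < n" for i j
      using that by (simp add: a_def)
    have a_carrier: "a \<in> carrier_mat n n" by (simp add: a_def)
    \<comment> \<open>Column and row meet at \<open>(\<tau> c, c)\<close>, which mirrors itself. A
      symmetric form demands 0 there, and \<open>r'\<close> is 0 because \<open>\<tau> c\<close> is
      then outside \<open>A\<close>.\<close>
    have eps_r': "r' (\<tau> c) = - (\<epsilon> * r' (\<tau> c))" using eps_sign c by (auto simp: r'_def A)
    have "preserves a"
      unfolding preserves_iff[OF a_carrier]
    proof (intro allI impI)
      fix i j assume ij: "i < n" "j < n"
      note t = tau_less[OF ij(1)] tau_less[OF ij(2)]
      consider "j = c" "i = \<tau> c" | "j = c" "i \<noteq> \<tau> c" | "j \<noteq> c" "i = \<tau> c" | "j \<noteq> c" "i \<noteq> \<tau> c" by blast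
      then show "a $$ (i, j) = - (h i * h j * a $$ (\<tau> j, \<tau> i))"
      proof cases
        case 1
        then show ?thesis
          using a_index[OF ij] a_index[OF t(2,1)] tau_tau[OF c(1)] eps_r' eps_c by simp
      next
        case 2
        have "a $$ (\<tau> j, \<tau> i) = - (h (\<tau> c) * h (\<tau> i) * r' i)"
          using 2 a_index[OF t(2,1)] tau_c[OF ij(1)] tau_tau[OF ij(1)] by simp
        then have "- (h i * h j * a $$ (\<tau> j, \<tau> i)) = (h c * h (\<tau> c)) * (h i * h (\<tau> i)) * r' i"
          using 2 by (simp add: mult_ac)
        also have "h i * h (\<tau> i) = \<epsilon>"
          using h_tau[OF ij(1)] h_square[OF ij(1)] by (simp add: mult.left_commute)
        finally show ?thesis using a_index[OF ij] 2 eps_c eps_square by simp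
      next
        case 3
        then show ?thesis using a_index[OF ij] a_index[OF t(2,1)] tau_tau[OF c(1)] by simp
      next
        case 4
        then have "\<tau> i \<noteq> c" "\<tau> j \<noteq> \<tau> c" using tau_c[OF ij(1)] tau_tau[OF ij(2)] tau_tau[OF c(1)] by metis+
        then show ?thesis using a_index[OF ij] a_index[OF t(2,1)] 4 by simp
      qed
    qed
    moreover have "a $$ (i, j) \<in> R" if "i < n" "j < n" for i j
      unfolding a_index[OF that]
      using r'_R h_in_R[OF that(1)] h_in_R[OF that(2)] R_zero by (auto intro!: R_uminus R_mult)
    ultimately have "a \<in> S" using a_carrier by (simp add: mem_S_iff)
    moreover have "\<forall>i\<in>A. a $$ (i, c) = r i" using c(1) by (auto simp: a_index r'_def A)
    ultimately show "\<exists>a\<in>S. \<forall>i\<in>A. a $$ (i, c) = r i" by blast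
  next
    fix x :: "'k mat" assume x: "x \<in> carrier_mat n n" "preserves x"
      and scalar: "\<And>i j. i < n \<Longrightarrow> i \<noteq> c \<Longrightarrow> j \<in> insert c A \<Longrightarrow>
        x $$ (i, j) = (if i = j then x $$ (c, c) else 0)"
    have j: "j0 < n" "j0 \<noteq> c" using j0 A by auto
    have 1: "x $$ (j0, j0) = x $$ (c, c)" using scalar[OF j, of j0] j0 by simp
    have 2: "x $$ (\<tau> j0, \<tau> j0) = x $$ (c, c)"
      using scalar[OF tau_less[OF j(1)] _ j0(2)] by (cases "\<tau> j0 = c") auto
    have "x $$ (c, c) = - x $$ (c, c)"
      using preserves_index[OF x j(1) j(1)] h_square[OF j(1)] 1 2 by simp
    then show "x $$ (c, c) = 0" by (rule zero_if_neg)
  next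
    fix x :: "'k mat" assume x: "x \<in> carrier_mat n n" "preserves x"
      and columns: "\<And>i j. i < n \<Longrightarrow> j \<in> insert c A \<Longrightarrow> x $$ (i, j) = 0"
    have "x $$ (i, j) = 0" if ij: "i < n" "j < n" for i j
    proof (cases "j \<in> insert c A")
      case True
      then show ?thesis using columns ij by blast
    next
      case False
      \<comment> \<open>Only column \<open>\<tau> c\<close> of a symmetric form remains. Its entries
        mirror row \<open>c\<close>, which vanishes in the columns treated before; entry
        \<open>(c, \<tau> c)\<close> mirrors itself and is its own negative.\<close>
      then have j: "j = \<tau> c" "\<epsilon> = 1" using ij A eps_sign by auto
      show ?thesis
      proof (cases "i = c")
        case True
        have "x $$ (c, \<tau> c) = - (h c * h (\<tau> c) * x $$ (c, \<tau> c))"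
          using preserves_index[OF x c(1) tau_less[OF c(1)]] tau_tau[OF c(1)] by simp
        then have "x $$ (c, \<tau> c) = 0" unfolding eps_c j(2) using zero_if_neg by simp
        then show ?thesis using True j by simp
      next
        case False
        then have "\<tau> i \<noteq> \<tau> c" using tau_tau[OF ij(1)] tau_tau[OF c(1)] by metis
        then have "\<tau> i \<in> insert c A" using tau_less[OF ij(1)] A by auto
        then have "x $$ (c, \<tau> i) = 0" using columns[OF c(1)] by blast
        then show ?thesis
          using preserves_index[OF x ij] tau_tau[OF c(1)] j(1) by simp
      qed
    qed
    then show "x = 0\<^sub>m n n" using x(1) by (intro eq_matI) auto
  next
    fix x t assume x: "x \<in> S" and t: "t \<in> R" "t \<noteq> 0"
      and div: "\<And>i. i \<in> A \<Longrightarrow> x $$ (i, c) \<in> (*) (t ^ (d c - d i)) ` R"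
    have xc: "x \<in> carrier_mat n n" "preserves x" using x by (auto simp: mem_S_iff)
    have "diag_conj n d t x $$ (i, j) \<in> R" if ij: "i < n" "j < n" for i j
    proof -
      have xR: "x $$ (i, j) \<in> R" using x ij by (simp add: mem_S_iff)
      \<comment> \<open>Outside column \<open>c\<close> a negative power of \<open>t\<close> arises
        only in row \<open>\<tau> c\<close>, of weight 0, at columns of weight 1. These entries
        mirror entries of column \<open>c\<close> in rows of weight 1 and inherit their divisibility
        by \<open>t\<close>.\<close>
      consider "d j \<le> d i" | "j = c" "i \<noteq> c" | "j \<noteq> c" "j \<noteq> \<tau> c" "i = \<tau> c" "d i = 0" "d j = 1"
        using c(2) unfolding d
        by (cases "i = c"; cases "j = c"; cases "i = \<tau> c"; cases "j = \<tau> c") auto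
      then show ?thesis
      proof cases
        case 1
        then have "t ^ d i = t ^ d j * t ^ (d i - d j)" by (simp flip: power_add)
        then have "diag_conj n d t x $$ (i, j) = t ^ (d i - d j) * x $$ (i, j)"
          using ij t(2) by simp
        then show ?thesis using xR t(1) by (simp add: R_mult R_power)
      next
        case 2
        show ?thesis
        proof (cases "i \<in> A")
          case True
          then obtain r where r: "r \<in> R" "x $$ (i, c) = t ^ (d c - d i) * r" using div by blast
          have "d i \<le> d c" by (simp add: d)
          then have "t ^ d c = t ^ d i * t ^ (d c - d i)" by (simp flip: power_add)
          then have "diag_conj n d t x $$ (i, j) = r" using ij 2 r(2) t(2) by simp
          then show ?thesis using r(1) by simp
        next
          case False
          then show ?thesis using column_0[OF xc ij(1) 2(2)] 2 ij R_zero by simp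
        qed
      next
        case 3
        have "\<tau> j \<noteq> c" "\<tau> j \<noteq> \<tau> c"
          using 3 tau_c[OF ij(2)] tau_tau[OF ij(2)] tau_tau[OF c(1)] by metis+
        then have jA: "\<tau> j \<in> A" "d (\<tau> j) = 1" "d c = 2" using tau_less[OF ij(2)] by (auto simp: A d)
        then obtain r where r: "r \<in> R" "x $$ (\<tau> j, c) = t * r" using div[OF jA(1)] by auto
        have "x $$ (i, j) = - (h i * h j * (t * r))"
          using preserves_index[OF xc ij] 3 tau_tau[OF c(1)] r(2) by simp
        then have "diag_conj n d t x $$ (i, j) = - (h i * h j * r)"
          using ij 3 t(2) by simp
        then show ?thesis using h_in_R ij r(1) by (simp add: R_uminus R_mult)
      qed
    qed
    then show "diag_conj n d t x \<in> S" using xc t(2) P_conj by (simp add: mem_S_iff)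
  qed
qed

text \<open>Each index other than \<open>c\<close> and \<open>\<tau> c\<close> contributes 2 - 1,
  and the partner \<open>\<tau> c\<close> contributes 2 - 0 when it belongs to \<open>A\<close>,
  that is for \<open>\<epsilon> = - 1\<close>. This is the origin of n and n - 2 in the
  exponent.\<close>

lemma weight_sum:
  assumes c: "c < n" "\<tau> c \<noteq> c"
    and A: "A = {i. i < n \<and> i \<noteq> c \<and> (i = \<tau> c \<longrightarrow> \<epsilon> = - 1)}"
    and d: "d = (\<lambda>i. if i = c then 2 else if i = \<tau> c then 0 else (1::nat))"
  shows "(\<Sum>i\<in>A. d c - d i) = (if \<epsilon> = - 1 then n else n - 2)"
proof -
  have tc: "\<tau> c < n" using tau_less c(1) .
  let ?B = "{..<n} - {c, \<tau> c}"
  have "(\<Sum>i\<in>?B. d c - d i) = (\<Sum>i\<in>?B. 1)" by (rule sum.cong) (auto simp: d)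
  also have "\<dots> = n - 2" using c tc by simp
  finally have B: "(\<Sum>i\<in>?B. d c - d i) = n - 2" .
  show ?thesis
  proof (cases "\<epsilon> = - 1")
    case True
    then have "A = insert (\<tau> c) ?B" using c tc by (auto simp: A)
    moreover have "\<tau> c \<notin> ?B" by simp
    ultimately have "(\<Sum>i\<in>A. d c - d i) = (d c - d (\<tau> c)) + (n - 2)" using B by simp
    also have "\<dots> = n" using c tc by (simp add: d)
    finally show ?thesis using True by simp
  next
    case False
    then have "A = ?B" by (auto simp: A)
    then show ?thesis using B False by simp
  qed
qed

end

section \<open>The matrices of the symplectic and orthogonal forms\<close>

lemma sp_form_index:
  assumes "even n" "i < n" "j < n"
  shows "sp_form n $$ (i, j) = (if j = (if i < n div 2 then i + n div 2 else i - n div 2)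
    then (if i < n div 2 then 1 else - 1) else (0 :: 'k::field))"
  using assms by (auto simp: sp_form_def Let_def elim!: evenE)

lemma so_form_even_index:
  assumes "even n" "i < n" "j < n"
  shows "so_form n $$ (i, j) = (if j = (if i < n div 2 then i + n div 2 else i - n div 2)
    then 1 else (0 :: 'k::field))"
  using assms by (auto simp: so_form_def Let_def elim!: evenE)

text \<open>Removing row and column 0 leaves the even form of size \<open>2 * l\<close>, with all
  indices shifted by one.\<close>

lemma so_form_odd_index:
  assumes "odd n" "i < n" "j < n"
  shows "so_form n $$ (i, j) =
    (if j = (if i = 0 then 0 else if i \<le> n div 2 then i + n div 2 else i - n div 2)
     then 1 else (0 :: 'k::field))"
proof -
  obtain l where l: "n = 2 * l + 1" using assms(1) by (rule oddE)
  have s: "so_form n = four_block_mat (1\<^sub>m 1) (0\<^sub>m 1 (2 * l)) (0\<^sub>m (2 * l) 1) (so_form (2 * l) :: 'k mat)"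
    by (simp add: so_form_def Let_def l)
  have car: "(so_form (2 * l) :: 'k mat) \<in> carrier_mat (2 * l) (2 * l)"
    by (auto simp: so_form_def Let_def)
  show ?thesis
  proof (cases "i = 0 \<or> j = 0")
    case True
    then show ?thesis using assms(2,3) car unfolding s by (auto simp: l)
  next
    case False
    then obtain i' j' where ij: "i = Suc i'" "j = Suc j'" by (metis not0_implies_Suc)
    then have "so_form n $$ (i, j) = (so_form (2 * l) :: 'k mat) $$ (i', j')"
      using assms(2,3) car unfolding s by (simp add: l)
    also have "\<dots> = (if j' = (if i' < l then i' + l else i' - l) then 1 else 0)"
    proof -
      have "2 * l div 2 = l" by simp
      note so_form_even_index[of "2 * l" i' j', unfolded this]
      then show ?thesis using assms(2,3) ij by (simp add: l)
    qed
    finally show ?thesis using ij by (auto simp: l)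
  qed
qed

context padic_uniformizer
begin

lemma sp_signed_form:
  assumes "even n"
  shows "signed_form p Q v \<pi> n (sp_form n)
    (\<lambda>i. if i < n div 2 then i + n div 2 else i - n div 2) (\<lambda>i. if i < n div 2 then 1 else - 1) (- 1)"
proof unfold_locales
  show "sp_form n \<in> carrier_mat n n"
    using assms by (auto simp: sp_form_def Let_def elim!: evenE)
qed (use assms in \<open>auto simp: sp_form_index elim!: evenE\<close>)

lemma so_signed_form_even:
  assumes "even n"
  shows "signed_form p Q v \<pi> n (so_form n)
    (\<lambda>i. if i < n div 2 then i + n div 2 else i - n div 2) (\<lambda>_. 1) 1"
proof unfold_locales
  show "so_form n \<in> carrier_mat n n"
    using assms by (auto simp: so_form_def Let_def elim!: evenE)
qed (use assms in \<open>auto simp: so_form_even_index elim!: evenE\<close>)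

lemma so_signed_form_odd:
  assumes "odd n"
  shows "signed_form p Q v \<pi> n (so_form n)
    (\<lambda>i. if i = 0 then 0 else if i \<le> n div 2 then i + n div 2 else i - n div 2) (\<lambda>_. 1) 1"
proof unfold_locales
  show "so_form n \<in> carrier_mat n n"
    using assms by (auto simp: so_form_def Let_def elim!: oddE)
qed (use assms in \<open>auto simp: so_form_odd_index elim!: oddE\<close>)

text \<open>The index \<open>j\<close> takes the part of \<open>j0\<close> in
  \<open>form_graded_lattice\<close>, where it excludes scalars.\<close>

lemma form_lattice_graded:
  assumes form: "signed_form p Q v \<pi> n s \<tau> h \<epsilon>"
    and c: "c < n" "\<tau> c \<noteq> c" and j: "j < n" "j \<noteq> c" "j = \<tau> c \<longrightarrow> \<epsilon> = - 1"
    and tj: "\<tau> j = c \<or> \<tau> j \<noteq> \<tau> c"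
  obtains P A d where "graded_lattice p Q v \<pi> n P c A d"
    and "form_lattice s R n = {x \<in> carrier_mat n n. elements_mat x \<subseteq> R \<and> P x}"
    and "(\<Sum>i\<in>A. d c - d i) = (if \<epsilon> = - 1 then n else n - 2)"
proof -
  interpret signed_form p Q v \<pi> n s \<tau> h \<epsilon> by (rule form)
  define A where "A = {i. i < n \<and> i \<noteq> c \<and> (i = \<tau> c \<longrightarrow> \<epsilon> = - 1)}"
  define d where "d = (\<lambda>i. if i = c then 2 else if i = \<tau> c then 0 else (1::nat))"
  have "j \<in> A" "\<tau> j \<in> insert c A" using j tj tau_less[OF j(1)] by (auto simp: A_def)
  then have "graded_lattice p Q v \<pi> n preserves c A d"
    by (rule form_graded_lattice[OF c A_def _ _ d_def])
  then show thesis
    by (rule that) (simp add: form_lattice_def, rule weight_sum[OF c A_def d_def])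
qed

lemma classical_lattice_graded:
  assumes "n \<ge> 2" "\<sigma> = SP \<longrightarrow> even n" "\<sigma> = SO \<longrightarrow> n \<ge> 3"
  obtains P c A d where "graded_lattice p Q v \<pi> n P c A d"
    and "classical_lattice \<sigma> R n = {x \<in> carrier_mat n n. elements_mat x \<subseteq> R \<and> P x}"
    and "(\<Sum>i\<in>A. d c - d i) = index_exponent \<sigma> n"
proof (cases \<sigma>)
  case SL
  show thesis
  proof (rule that[OF sl_graded_lattice[OF assms(1)]])
    show "classical_lattice \<sigma> R n = {x \<in> carrier_mat n n. elements_mat x \<subseteq> R \<and> trace_zero n x}"
      by (simp add: SL sl_lattice_def)
    have "(\<Sum>i\<in>{..<n} - {0}. (if (0::nat) = 0 then 1 else 0) - (if i = 0 then 1 else 0)) = (\<Sum>i\<in>{..<n} - {0}. 1::nat)"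
      by (rule sum.cong) auto
    then show "(\<Sum>i\<in>{..<n} - {0}. (if (0::nat) = 0 then 1 else 0) - (if i = 0 then 1 else 0)) = index_exponent \<sigma> n"
      using assms(1) by (simp add: SL)
  qed
next
  case SP
  then obtain l where l: "n = 2 * l" using assms(2) by (auto elim: evenE)
  have e: "even n" using l by simp
  \<comment> \<open>Index 0 pairs with \<open>l\<close>, which lies in \<open>A\<close> for an
    alternating form, and the partner of \<open>l\<close> is \<open>c = 0\<close> itself.\<close>
  show thesis
    by (rule form_lattice_graded[OF sp_signed_form[OF e], of 0 l])
      (use l assms(1) SP that in auto)
next
  case SO
  show thesis
  proof (cases "even n")
    case True
    then obtain l where l: "n = 2 * l" by (auto elim: evenE)
    \<comment> \<open>Here \<open>n \<ge> 4\<close>, so index 1 differs from both 0 and its partner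
      \<open>l\<close>.\<close>
    show thesis
      by (rule form_lattice_graded[OF so_signed_form_even[OF True], of 0 1])
        (use l assms(3) SO that in auto)
  next
    case False
    then obtain l where l: "n = 2 * l + 1" by (auto elim: oddE)
    \<comment> \<open>Index 0 is fixed by \<open>\<tau>\<close> and cannot serve as
      \<open>c\<close>, but it can serve as \<open>j\<close>; index 1 is isotropic with partner
      \<open>l + 1\<close>.\<close>
    show thesis
      by (rule form_lattice_graded[OF so_signed_form_odd[OF False], of 1 0])
        (use l assms(3) SO that in auto)
  qed
qed

text \<open>\<open>\<tau>\<close> swaps the two indices, so each off-diagonal entry is its own
  mirror image and vanishes; the remaining diagonal matrices commute. The grading breaks down here:
  \<open>A\<close> would be empty and the conjugation the identity.\<close>

lemma so2_self_similar:
  assumes L: "is_submodule Z 2 L" "L \<subseteq> form_lattice (so_form 2) R 2"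
    "finite (cosets_in (form_lattice (so_form 2) R 2) L)"
  shows "self_similar p Z 2 L"
proof -
  interpret signed_form p Q v \<pi> 2 "so_form 2"
    "\<lambda>i. if i < 2 div 2 then i + 2 div 2 else i - 2 div 2" "\<lambda>_. 1" 1
    by (rule so_signed_form_even) simp
  interpret matrix_lattice p Q v \<pi> 2 preserves by (rule form_matrix_lattice)
  have S: "form_lattice (so_form 2) R 2 = S" by (simp add: form_lattice_def S_def)
  have off: "x $$ (0, Suc 0) = 0" "x $$ (Suc 0, 0) = 0" if "x \<in> S" for x
  proof -
    have x: "x \<in> carrier_mat 2 2" "preserves x" using that by (auto simp: mem_S_iff)
    show "x $$ (0, Suc 0) = 0" "x $$ (Suc 0, 0) = 0"
      using preserves_index[OF x, of 0 1] preserves_index[OF x, of 1 0]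
      by (simp_all add: eq_neg_iff_add_eq_0)
  qed
  show ?thesis
  proof (rule abelian_self_similar[OF _ L[unfolded S]])
    fix x y assume xy: "x \<in> S" "y \<in> S"
    then have car: "x \<in> carrier_mat 2 2" "y \<in> carrier_mat 2 2" by (simp_all add: S_carrier)
    show "lie_bracket x y = 0\<^sub>m 2 2"
    proof (rule eq_matI)
      fix i j assume "i < dim_row (0\<^sub>m 2 2 :: 'k mat)" "j < dim_col (0\<^sub>m 2 2 :: 'k mat)"
      then have ij: "i < 2" "j < 2" by auto
      then have "i = 0 \<or> i = Suc 0" "j = 0 \<or> j = Suc 0" by auto
      then have "lie_bracket x y $$ (i, j) = 0"
        unfolding lie_bracket_index[OF car ij]
        using off[OF xy(1)] off[OF xy(2)]
        by (auto simp: numeral_2_eq_2 lessThan_Suc mult.commute)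
      then show "lie_bracket x y $$ (i, j) = 0\<^sub>m 2 2 $$ (i, j)" using ij by simp
    qed (use lie_bracket_carrier[OF car] in auto)
  qed
qed

end

theorem corollary8:
  fixes p n q :: nat and Q Z R :: "'k::field_char_0 set" and v :: "'k \<Rightarrow> real" and \<pi> :: 'k
  assumes "prime p"
    and "padic_numbers p Q v"
    and "finite_extension Q"
    and "Z = padic_integers Q v"
    and "R = ring_of_integers Z"
    and "uniformizer R \<pi>"
    and "q = card (residue_field R)"
    and "n \<ge> 2"
  shows "(\<forall>\<sigma> L. (\<sigma> = SP \<longrightarrow> even n) \<longrightarrow> lie_lattice Z n L \<longrightarrow>
            L \<subseteq> classical_lattice \<sigma> R n \<longrightarrow> finite (cosets_in (classical_lattice \<sigma> R n) L) \<longrightarrow>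
            self_similar p Z n L)
       \<and> (\<forall>\<sigma> k m L. k \<ge> 1 \<longrightarrow> (\<sigma> = SP \<longrightarrow> even n) \<longrightarrow> (\<sigma> = SO \<longrightarrow> n \<ge> 3) \<longrightarrow>
            lie_lattice Z n L \<longrightarrow>
            congruence_lattice \<sigma> R \<pi> m n \<subseteq> L \<longrightarrow> L \<subseteq> classical_lattice \<sigma> R n \<longrightarrow>
            self_similar_of_index p Z n L
              (add_index L (congruence_lattice \<sigma> R \<pi> m n) * q ^ (index_exponent \<sigma> n * k)))"
proof -
  interpret padic_numbers p Q v by (rule assms(2))
  interpret loc: padic_uniformizer p Q v \<pi>
    using assms(1,3,6) by unfold_locales (simp_all add: assms(4,5))
  show ?thesis
    unfolding assms(4,5,7)
  proof (intro conjI allI impI)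
    fix \<sigma> and L :: "'k mat set"
    assume \<sigma>: "\<sigma> = SP \<longrightarrow> even n" and "lie_lattice loc.Z n L"
      and L: "L \<subseteq> classical_lattice \<sigma> loc.R n" "finite (cosets_in (classical_lattice \<sigma> loc.R n) L)"
    then have sub: "lie_subalgebra loc.Z n L" by (simp add: lie_lattice_def)
    show "self_similar p loc.Z n L"
    proof (cases "\<sigma> = SO \<and> n = 2")
      case True
      then show ?thesis
        using loc.so2_self_similar[of L] sub L by (simp add: lie_subalgebra_def)
    next
      case False
      then have "\<sigma> = SO \<longrightarrow> n \<ge> 3" using \<open>n \<ge> 2\<close> by auto
      from loc.classical_lattice_graded[OF \<open>n \<ge> 2\<close> \<sigma> this]
      obtain P c A d where graded: "graded_lattice p Q v \<pi> n P c A d"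
        and eq: "classical_lattice \<sigma> loc.R n = {x \<in> carrier_mat n n. elements_mat x \<subseteq> loc.R \<and> P x}" .
      interpret graded_lattice p Q v \<pi> n P c A d by (rule graded)
      show ?thesis
        using finite_index_self_similar[OF sub] L unfolding eq S_def[symmetric] by blast
    qed
  next
    fix \<sigma> and k m :: nat and L :: "'k mat set"
    assume k: "1 \<le> k" and \<sigma>: "\<sigma> = SP \<longrightarrow> even n" "\<sigma> = SO \<longrightarrow> n \<ge> 3"
      and "lie_lattice loc.Z n L"
      and L: "congruence_lattice \<sigma> loc.R \<pi> m n \<subseteq> L" "L \<subseteq> classical_lattice \<sigma> loc.R n"
    then have sub: "lie_subalgebra loc.Z n L" by (simp add: lie_lattice_def)
    from loc.classical_lattice_graded[OF \<open>n \<ge> 2\<close> \<sigma>]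
    obtain P c A d where graded: "graded_lattice p Q v \<pi> n P c A d"
      and eq: "classical_lattice \<sigma> loc.R n = {x \<in> carrier_mat n n. elements_mat x \<subseteq> loc.R \<and> P x}"
      and exponent: "(\<Sum>i\<in>A. d c - d i) = index_exponent \<sigma> n" .
    interpret graded_lattice p Q v \<pi> n P c A d by (rule graded)
    have "congruence_lattice \<sigma> loc.R \<pi> m n = (\<cdot>\<^sub>m) (\<pi> ^ m) ` S"
      by (simp add: congruence_lattice_def eq S_def)
    then show "self_similar_of_index p loc.Z n L
        (add_index L (congruence_lattice \<sigma> loc.R \<pi> m n) *
          card (residue_field loc.R) ^ (index_exponent \<sigma> n * k))"
      using self_similar_of_index_power[of k, OF _ sub] k L
      unfolding eq S_def[symmetric] exponent by simp
  qed
qed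

end
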